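(* Let $M=n^{-1}X^TX$ be a sample covariance matrix with parameter $a>0$ whose entries have moments $\mu_3=\mathbf{E}\{(X^{(m,n)}_{\alpha j})^3\}$, $\mu_4=\mathbf{E}\{(X^{(m,n)}_{\alpha j})^4\}$ independent of $\alpha,j,m,n$, and such that $L^{(4)}_{mn}(\tau)\to0$ for every $\tau>0$ as $n,m\to\infty$, $m/n\to c\in[1,\infty)$. Let $M^\tau$ be the truncated matrix, $u_{n\tau}(t)=\operatorname{Tr}e^{itM^\tau}$, $\mathcal{N}_{n\tau}[\varphi]=\operatorname{Tr}\varphi(M^\tau)$. Then for every $\tau>0$ there is $C_\tau(\mu_4)$ depending only on $\tau$ and $\mu_4$ (and $a$, $c$) such that, for all sufficiently large $m,n$ in this limit, all $t\in\mathbb{R}$ and all $\varphi:\mathbb{R}\to\mathbb{R}$ with $\int(1+|t|^4)|\widehat\varphi(t)|dt<\infty$, $$\mathbf{Var}\{u_{n\tau}(t)\}\le C_\tau(\mu_4)(1+|t|^4)^2,\qquad \mathbf{Var}\{\mathcal{N}_{n\tau}[\varphi]\}\le C_\tau(\mu_4)\Big(\int(1+|t|^4)|\widehat\varphi(t)|dt\Big)^2.$$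
   Context: Sample covariance matrix: $M=Y^TY$, $Y=n^{-1/2}X$, $X=\{X^{(m,n)}_{\alpha j}\}$ a real $m\times n$ matrix with independent entries with laws $F^{(m,n)}_{\alpha j}$, mean $0$, variance $a^2$. $L_{mn}^{(4)}(\tau)=n^{-2}\sum_{\alpha,j}\int_{|X|>\tau\sqrt n}X^4F^{(m,n)}_{\alpha j}(dX)$. Truncation: $X^\tau_{\alpha j}=\operatorname{sign}(X^{(m,n)}_{\alpha j})\min\{|X^{(m,n)}_{\alpha j}|,\tau\sqrt n\}$, $Y^\tau=n^{-1/2}X^\tau$, $M^\tau=(Y^\tau)^TY^\tau$. $\widehat\varphi(t)=\frac1{2\pi}\int e^{-it\lambda}\varphi(\lambda)d\lambda$.
   Formalization: The test function φ is additionally assumed continuous and Lebesgue integrable: integrability makes φ̂ defined, and without continuity the bound fails (φ the indicator of {0} has φ̂=0, but for ±1 entries the multiplicity of eigenvalue 0 has positive variance). *)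

theory Defs
  imports "HOL-Probability.Probability" "Jordan_Normal_Form.Char_Poly"
begin

definition trunc :: "real \<Rightarrow> nat \<Rightarrow> real \<Rightarrow> real" where
  "trunc \<tau> n x = sgn x * min \<bar>x\<bar> (\<tau> * sqrt (real n))"

text \<open>The truncated sample covariance matrix M^tau = (Y^tau)^T Y^tau, Y^tau = n^(-1/2) X^tau,
  where X is the m x n data matrix with entries Xe alpha j (alpha < m, j < n).
  It is an n x n real symmetric matrix.\<close>
definition Mtau :: "real \<Rightarrow> nat \<Rightarrow> nat \<Rightarrow> (nat \<Rightarrow> nat \<Rightarrow> real) \<Rightarrow> real mat" where
  "Mtau \<tau> m n Xe = mat n n (\<lambda>(j, k).
      (\<Sum>\<alpha><m. trunc \<tau> n (Xe \<alpha> j) * trunc \<tau> n (Xe \<alpha> k)) / real n)"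

text \<open>Eigenvalues (with multiplicity) of a real matrix: roots of the characteristic polynomial.
  For real symmetric matrices this multiset has exactly dim elements.\<close>
definition eigvals :: "real mat \<Rightarrow> real multiset" where
  "eigvals A = proots (char_poly A)"

text \<open>Tr f(A) for a real symmetric matrix A (functional calculus): sum of f over the eigenvalues.\<close>
definition tr_fun :: "(real \<Rightarrow> 'b::comm_monoid_add) \<Rightarrow> real mat \<Rightarrow> 'b" where
  "tr_fun f A = sum_mset (image_mset f (eigvals A))"

definition fourier_hat :: "(real \<Rightarrow> real) \<Rightarrow> real \<Rightarrow> complex" where
  "fourier_hat \<phi> t = (integral\<^sup>L lborel (\<lambda>x. exp (- (\<i> * complex_of_real (t * x))) * complex_of_real (\<phi> x)))
      / complex_of_real (2 * pi)"

definition cvar :: "'a measure \<Rightarrow> ('a \<Rightarrow> complex) \<Rightarrow> real" where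
  "cvar P Z = integral\<^sup>L P (\<lambda>\<omega>. (cmod (Z \<omega> - integral\<^sup>L P Z))\<^sup>2)"

definition rvar :: "'a measure \<Rightarrow> ('a \<Rightarrow> real) \<Rightarrow> real" where
  "rvar P Z = integral\<^sup>L P (\<lambda>\<omega>. (Z \<omega> - integral\<^sup>L P Z)\<^sup>2)"

definition L4 :: "'a measure \<Rightarrow> (nat \<Rightarrow> nat \<Rightarrow> 'a \<Rightarrow> real) \<Rightarrow> nat \<Rightarrow> nat \<Rightarrow> real \<Rightarrow> real" where
  "L4 P Xn m n \<tau> = (\<Sum>\<alpha><m. \<Sum>j<n.
      integral\<^sup>L P (\<lambda>\<omega>. if \<bar>Xn \<alpha> j \<omega>\<bar> > \<tau> * sqrt (real n) then (Xn \<alpha> j \<omega>) ^ 4 else 0))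
      / (real n)\<^sup>2"

definition scm_hyp :: "(nat \<Rightarrow> 'a measure) \<Rightarrow> (nat \<Rightarrow> nat \<Rightarrow> nat \<Rightarrow> 'a \<Rightarrow> real) \<Rightarrow> (nat \<Rightarrow> nat)
    \<Rightarrow> real \<Rightarrow> real \<Rightarrow> real \<Rightarrow> real \<Rightarrow> bool" where
  "scm_hyp P X m a c \<mu>3 \<mu>4 \<longleftrightarrow>
     a > 0 \<and> c \<ge> 1 \<and>
     ((\<lambda>n. real (m n) / real n) \<longlongrightarrow> c) sequentially \<and>
     (\<forall>n. prob_space (P n)) \<and>
     (\<forall>n. prob_space.indep_vars (P n) (\<lambda>_. borel) (\<lambda>(\<alpha>, j). X n \<alpha> j) ({..<m n} \<times> {..<n})) \<and>
     (\<forall>n. \<forall>\<alpha><m n. \<forall>j<n.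
        integrable (P n) (X n \<alpha> j) \<and>
        integrable (P n) (\<lambda>\<omega>. (X n \<alpha> j \<omega>) ^ 4) \<and>
        integral\<^sup>L (P n) (X n \<alpha> j) = 0 \<and>
        integral\<^sup>L (P n) (\<lambda>\<omega>. (X n \<alpha> j \<omega>)\<^sup>2) = a\<^sup>2 \<and>
        integral\<^sup>L (P n) (\<lambda>\<omega>. (X n \<alpha> j \<omega>) ^ 3) = \<mu>3 \<and>
        integral\<^sup>L (P n) (\<lambda>\<omega>. (X n \<alpha> j \<omega>) ^ 4) = \<mu>4) \<and>
     (\<forall>\<tau>>0. ((\<lambda>n. L4 (P n) (X n) (m n) n \<tau>) \<longlongrightarrow> 0) sequentially)"

end

theory Submission
  imports Defs
begin

unbundle no vec_syntax

text \<open>By the Efron--Stein inequality the variance of a linear statistic is at most the sum, over all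
  matrix entries, of the mean square of the change caused by setting that entry to zero. Such a
  change is a perturbation of the Gram matrix of rank at most two. Averaging the scalar Taylor
  expansion over the squared scalar products of the two eigenbases expands the trace to first order
  with a remainder controlled by the Frobenius norm. The first order term is an entry of
  \<open>\<phi>'(M)\<close> applied to a row of the data matrix, so its squares add up along the row to at most a
  multiple of the squared norm of the row; this and the bound \<open>\<tau> \<surd>n\<close> on the entries make the \<open>m n\<close>
  contributions sum up to \<open>O(m / n)\<close>. Only bounds on \<open>\<phi>'\<close> and on its Lipschitz constant enter; for
  \<open>e\<^sup>i\<^sup>t\<^sup>\<lambda>\<close> they are \<open>|t|\<close> and \<open>t\<^sup>2\<close>, and for general \<open>\<phi>\<close> they follow by Fourier inversion.\<close>

text \<open>Removing entry (alpha, j), of value v, has first order effect (2 v / n) q0, where q0 is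
  coordinate j of phi'(M0) r0, and M0 and the row r0 are taken after removal. Two needs conflict.
  For the expectation to factor into E v^2 times E q0^2, the second factor must not depend on v, and
  q0 does not. For one operator norm bound to control the sum over j, all coordinates must come from
  the same matrix and the same vector; this fails for q0, since M0 and r0 change with j, but holds
  for q, computed from the full matrix and row. So the expectation is factored first and q0 is
  compared with q afterwards, through the Lipschitz bound on phi' in Frobenius norm. Without the sum
  over j each q0 would only be known to be at most of order sqrt n, the norm of a row, and the m n
  terms would add up to order m instead of m / n. In the Efron-Stein step an entry is reset to the
  fixed value 0, not to an independent copy, so that each difference involves a single random entry
  v.\<close>

section \<open>Spectral theorem for real symmetric matrices\<close>

text \<open>The characteristic polynomial has a complex root z. For a complex eigenvector v of z,
  the Hermitian form \<open>q\<close> equals its own conjugate because the matrix is real and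
  symmetric, and it also equals z times the squared norm of v, so z is real.\<close>

lemma symmetric_real_eigenvalue:
  fixes A :: "real mat"
  assumes A: "A \<in> carrier_mat n n" and sym: "\<And>i j. i < n \<Longrightarrow> j < n \<Longrightarrow> A $$ (i,j) = A $$ (j,i)"
    and n: "n > 0"
  obtains e where "eigenvalue A e"
proof -
  define Ac where "Ac = map_mat complex_of_real A"
  have Ac: "Ac \<in> carrier_mat n n" using A by (simp add: Ac_def)
  have "degree (char_poly Ac) = n" using degree_monic_char_poly[OF Ac] by simp
  hence "\<not> constant (poly (char_poly Ac))" using n by (simp add: constant_degree)
  then obtain z where z: "poly (char_poly Ac) z = 0"
    using fundamental_theorem_of_algebra by blast
  hence "eigenvalue Ac z" using eigenvalue_root_char_poly[OF Ac] by simp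
  then obtain v where v: "eigenvector Ac v z" unfolding eigenvalue_def by auto
  have vc: "v \<in> carrier_vec n" and v0: "v \<noteq> 0\<^sub>v n" and ev: "Ac *\<^sub>v v = z \<cdot>\<^sub>v v"
    using v Ac unfolding eigenvector_def by auto
  have evi: "(\<Sum>j<n. of_real (A $$ (i,j)) * v $ j) = z * v $ i" if i: "i < n" for i
  proof -
    have "(Ac *\<^sub>v v) $ i = (\<Sum>j<n. of_real (A $$ (i,j)) * v $ j)"
      using i Ac A vc by (simp add: scalar_prod_def Ac_def atLeast0LessThan)
    moreover have "(z \<cdot>\<^sub>v v) $ i = z * v $ i" using i vc by simp
    ultimately show ?thesis using ev by simp
  qed
  define q where "q = (\<Sum>i<n. \<Sum>j<n. of_real (A $$ (i,j)) * v $ j * cnj (v $ i))"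
  have q1: "q = z * (\<Sum>i<n. v $ i * cnj (v $ i))"
    unfolding q_def sum_distrib_left sum_distrib_right[symmetric]
    by (intro sum.cong refl) (simp add: evi)
  have "cnj q = (\<Sum>i<n. \<Sum>j<n. of_real (A $$ (i,j)) * cnj (v $ j) * v $ i)"
    by (simp add: q_def)
  also have "\<dots> = (\<Sum>j<n. \<Sum>i<n. of_real (A $$ (i,j)) * cnj (v $ j) * v $ i)"
    by (rule sum.swap)
  also have "\<dots> = q" unfolding q_def
    by (intro sum.cong refl) (simp add: sym mult_ac)
  finally have "cnj q = q" .
  hence q2: "Im q = 0" by (metis complex_cnj_cancel_iff complex_cnj_complex_of_real cnj.simps(2) neg_equal_zero)
  define r where "r = (\<Sum>i<n. (cmod (v $ i))\<^sup>2)"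
  have r: "(\<Sum>i<n. v $ i * cnj (v $ i)) = of_real r"
    unfolding r_def of_real_sum by (simp only: complex_norm_square)
  obtain i where i: "i < n" "v $ i \<noteq> 0" using v0 vc by (auto simp: vec_eq_iff)
  have "r \<noteq> 0" unfolding r_def
    using i by (subst sum_nonneg_eq_0_iff) auto
  moreover have "Im z * r = 0" using q1 q2 r by simp
  ultimately have "Im z = 0" by simp
  hence zr: "z = of_real (Re z)" by (simp add: complex_eq_iff)
  have "char_poly Ac = map_poly of_real (char_poly A)"
    unfolding Ac_def using of_real_hom.char_poly_hom[OF A] by simp
  hence "poly (map_poly of_real (char_poly A)) (complex_of_real (Re z)) = 0" using z zr by metis
  hence "poly (char_poly A) (Re z) = 0" by simp
  hence "eigenvalue A (Re z)" using eigenvalue_root_char_poly[OF A] by simp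
  thus ?thesis by (rule that)
qed

lemma symmetric_matD:
  assumes "A \<in> carrier_mat n n" "A\<^sup>T = A" "i < n" "j < n"
  shows "A $$ (i,j) = A $$ (j,i)"
  using assms by (metis carrier_matD index_transpose_mat(1))

text \<open>The reflection that exchanges v and the first unit vector. It is its own transpose and
  inverse, so conjugating by it keeps a matrix symmetric.\<close>

lemma householder:
  fixes v :: "real vec"
  assumes v: "v \<in> carrier_vec n" and n: "n > 0" and v1: "v \<bullet> v = 1"
  obtains W where "W \<in> carrier_mat n n" "W\<^sup>T = W" "W * W = 1\<^sub>m n" "col W 0 = v"
proof -
  define w where "w i = v $ i - (if i = 0 then 1 else 0)" for i
  \<comment> \<open>If v is the first unit vector, then w = 0 and c = 2 / 0 = 0, so W is the
    identity; the degenerate case needs no separate construction.\<close>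
  define c where "c = 2 / (\<Sum>i<n. (w i)\<^sup>2)"
  define W where "W = mat n n (\<lambda>(i,j). (if i = j then 1 else 0) - c * w i * w j)"
  have vs: "(\<Sum>i<n. (v $ i)\<^sup>2) = 1"
    using v1 v by (simp add: scalar_prod_def atLeast0LessThan power2_eq_square)
  have ww: "(\<Sum>i<n. (w i)\<^sup>2) = 2 - 2 * v $ 0"
  proof -
    have "(\<Sum>i<n. (w i)\<^sup>2) = (\<Sum>i<n. (v $ i)\<^sup>2 + (if i = 0 then 1 - 2 * v $ 0 else 0))"
      by (intro sum.cong refl) (auto simp: w_def power2_eq_square algebra_simps)
    also have "\<dots> = 2 - 2 * v $ 0" using n vs by (simp add: sum.distrib sum.delta)
    finally show ?thesis .
  qed
  have cc: "c * c * (\<Sum>i<n. (w i)\<^sup>2) = 2 * c"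
    unfolding c_def by (cases "(\<Sum>i<n. (w i)\<^sup>2) = 0") (auto simp: field_simps)
  have W: "W \<in> carrier_mat n n" by (simp add: W_def)
  moreover have "W\<^sup>T = W" by (rule eq_matI) (auto simp: W_def)
  moreover have "W * W = 1\<^sub>m n"
  proof (rule eq_matI)
    fix i j assume ij: "i < dim_row (1\<^sub>m n :: real mat)" "j < dim_col (1\<^sub>m n :: real mat)"
    have "(W * W) $$ (i,j) = (\<Sum>k<n. ((if i = k then 1 else 0) - c * w i * w k) * ((if k = j then 1 else 0) - c * w k * w j))"
      using ij by (simp add: W_def scalar_prod_def atLeast0LessThan)
    also have "\<dots> = (\<Sum>k<n. (if k = i then (if i = j then 1 else 0) - c * w i * w j else 0)
        + (if k = j then - c * w i * w j else 0) + c * c * w i * w j * (w k)\<^sup>2)"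
      by (intro sum.cong refl) (auto simp: power2_eq_square algebra_simps)
    also have "\<dots> = (if i = j then 1 else 0) - c * w i * w j - c * w i * w j + w i * w j * (c * c * (\<Sum>k<n. (w k)\<^sup>2))"
      using ij by (simp add: sum.distrib sum.delta sum_distrib_left mult_ac)
    also have "\<dots> = (if i = j then 1 else 0)" unfolding cc by simp
    finally show "(W * W) $$ (i,j) = 1\<^sub>m n $$ (i,j)" using ij by simp
  qed (simp_all add: W_def)
  moreover have "col W 0 = v"
  proof (rule eq_vecI)
    fix i assume i: "i < dim_vec v"
    hence i': "i < n" using v by simp
    \<comment> \<open>By \<open>ww\<close> the squared norm of w is 2 - 2 v_0 = -2 w_0, which gives
      c w_0 = -1 unless w vanishes.\<close>
    have "c * w 0 = -1 \<or> (\<Sum>i<n. (w i)\<^sup>2) = 0"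
      using ww by (auto simp: c_def w_def field_simps)
    moreover have "w i = 0" if "(\<Sum>i<n. (w i)\<^sup>2) = 0"
      using that i' by (subst (asm) sum_nonneg_eq_0_iff) auto
    moreover have "c * w i * w 0 = (c * w 0) * w i" by simp
    ultimately have "c * w i * w 0 = - w i" by (elim disjE) (simp_all only: mult_minus_left mult_1 mult_zero_right mult_zero_left minus_zero)
    thus "col W 0 $ i = v $ i" using i' n by (auto simp: W_def w_def)
  qed (use v in \<open>simp add: W_def\<close>)
  ultimately show ?thesis by (rule that)
qed

text \<open>Deflation: conjugating by a reflection that carries the first unit vector to a unit
  eigenvector splits off a 1 x 1 block, and the remaining block is symmetric of size one
  less.\<close>

lemma symmetric_mat_diagonalization:
  fixes A :: "real mat"
  assumes "A \<in> carrier_mat n n" "A\<^sup>T = A"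
  shows "\<exists>U D. U \<in> carrier_mat n n \<and> D \<in> carrier_mat n n \<and> diagonal_mat D \<and> U\<^sup>T * U = 1\<^sub>m n \<and> A = U * D * U\<^sup>T"
  using assms
proof (induction n arbitrary: A)
  case 0
  show ?case
    by (rule exI[of _ "1\<^sub>m 0"], rule exI[of _ "1\<^sub>m 0"]) (use 0 in \<open>auto simp: diagonal_mat_def\<close>)
next
  case (Suc n A)
  note A = Suc.prems(1)
  obtain e where "eigenvalue A e"
    using symmetric_real_eigenvalue[OF A] symmetric_matD[OF Suc.prems] by blast
  then obtain u where u: "u \<in> carrier_vec (Suc n)" "u \<noteq> 0\<^sub>v (Suc n)" "A *\<^sub>v u = e \<cdot>\<^sub>v u"
    unfolding eigenvalue_def eigenvector_def using A by auto
  define r where "r = u \<bullet> u"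
  have "u \<bullet> u = (\<Sum>i<Suc n. (u $ i)\<^sup>2)"
    using u(1) by (simp add: scalar_prod_def atLeast0LessThan power2_eq_square)
  moreover obtain i where i: "i < Suc n" "u $ i \<noteq> 0" using u by (auto simp: vec_eq_iff)
  moreover have "(\<Sum>i<Suc n. (u $ i)\<^sup>2) > 0"
    by (rule sum_pos2[OF _ _ , of _ i]) (use i in auto)
  ultimately have r: "r > 0" by (simp add: r_def)
  define v where "v = (1 / sqrt r) \<cdot>\<^sub>v u"
  have v: "v \<in> carrier_vec (Suc n)" using u by (simp add: v_def)
  have v1: "v \<bullet> v = 1" using r u(1) unfolding v_def r_def
    by (simp add: field_simps flip: real_sqrt_mult)
  have Av: "A *\<^sub>v v = e \<cdot>\<^sub>v v" using A u unfolding v_def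
    by (simp add: mult_mat_vec smult_smult_assoc mult.commute)
  obtain W where W: "W \<in> carrier_mat (Suc n) (Suc n)" "W\<^sup>T = W" "W * W = 1\<^sub>m (Suc n)" "col W 0 = v"
    using householder[OF v _ v1] by blast
  define B where "B = W * A * W"
  have B: "B \<in> carrier_mat (Suc n) (Suc n)" using W A by (simp add: B_def)
  have BT: "B\<^sup>T = B" unfolding B_def using W A Suc.prems(2)
    by (simp add: transpose_mult[of _ "Suc n" "Suc n" _ "Suc n"] assoc_mult_mat[of _ "Suc n" "Suc n" _ "Suc n" _ "Suc n"])
  \<comment> \<open>Since v is column 0 of W and W W = 1, W maps v to the first unit vector. Hence
    the first column of B is e times that vector, and symmetry of B gives the first row.\<close>
  have "col B 0 = (W * A) *\<^sub>v v" unfolding B_def using W A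
    by (subst col_mult2[of _ "Suc n" "Suc n" _ "Suc n"]) auto
  also have "\<dots> = W *\<^sub>v (e \<cdot>\<^sub>v v)" using W A v Av by (simp add: assoc_mult_mat_vec)
  also have "\<dots> = e \<cdot>\<^sub>v (W *\<^sub>v v)" using W v by (simp add: mult_mat_vec)
  also have "W *\<^sub>v v = col (W * W) 0" using W
    by (subst col_mult2[of _ "Suc n" "Suc n" _ "Suc n"]) auto
  also have "\<dots> = unit_vec (Suc n) 0" using W(3) by simp
  finally have col0: "col B 0 = e \<cdot>\<^sub>v unit_vec (Suc n) 0" .
  have Bi0: "B $$ (i, 0) = (if i = 0 then e else 0)" if "i < Suc n" for i
    using arg_cong[OF col0, of "\<lambda>x. x $ i"] that B by auto
  have B0i: "B $$ (0, i) = (if i = 0 then e else 0)" if "i < Suc n" for i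
    using Bi0[OF that] symmetric_matD[OF B BT, of 0 i] that by simp
  define A' where "A' = mat n n (\<lambda>(i,j). B $$ (Suc i, Suc j))"
  have A': "A' \<in> carrier_mat n n" by (simp add: A'_def)
  have "A'\<^sup>T = A'" by (rule eq_matI) (auto simp: A'_def intro!: symmetric_matD[OF B BT])
  from Suc.IH[OF A' this] obtain U D where UD: "U \<in> carrier_mat n n" "D \<in> carrier_mat n n"
    "diagonal_mat D" "U\<^sup>T * U = 1\<^sub>m n" "A' = U * D * U\<^sup>T" by blast
  define Z1 where "Z1 = (0\<^sub>m 1 n :: real mat)"
  define Z2 where "Z2 = (0\<^sub>m n 1 :: real mat)"
  define E where "E = mat 1 1 (\<lambda>_. e)"
  have car: "Z1 \<in> carrier_mat 1 n" "Z2 \<in> carrier_mat n 1" "E \<in> carrier_mat 1 1"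
    by (auto simp: Z1_def Z2_def E_def)
  define U' where "U' = four_block_mat (1\<^sub>m 1) Z1 Z2 U"
  define D' where "D' = four_block_mat E Z1 Z2 D"
  have U': "U' \<in> carrier_mat (Suc n) (Suc n)" and D': "D' \<in> carrier_mat (Suc n) (Suc n)"
    using UD four_block_carrier_mat[of "1\<^sub>m 1" 1 1 U n n] four_block_carrier_mat[of E 1 1 D n n] car
    by (auto simp: U'_def D'_def)
  have U'T: "U'\<^sup>T = four_block_mat (1\<^sub>m 1) Z1 Z2 (U\<^sup>T)"
    unfolding U'_def using UD car
    by (subst transpose_four_block_mat[of _ 1 1 _ n _ n]) (auto simp: Z1_def Z2_def)
  have Bblock: "B = four_block_mat E Z1 Z2 A'"
    by (rule eq_matI) (use B in \<open>auto simp: four_block_mat_def Let_def E_def Z1_def Z2_def A'_def Bi0 B0i\<close>)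
  have UT: "U\<^sup>T \<in> carrier_mat n n" using UD by simp
  have I: "U'\<^sup>T * U' = 1\<^sub>m (Suc n)"
  proof -
    have "U'\<^sup>T * U' = four_block_mat (1\<^sub>m 1) Z1 Z2 (1\<^sub>m n)"
      unfolding U'T unfolding U'_def using UD UT car
      by (subst mult_four_block_mat[of _ 1 1 _ n _ n _ _ 1 _ n]) (auto simp: Z1_def Z2_def)
    thus ?thesis unfolding Z1_def Z2_def by (simp add: four_block_one_mat)
  qed
  have dec: "B = U' * D' * U'\<^sup>T"
  proof -
    have UDc: "U * D \<in> carrier_mat n n" using UD by simp
    have "U' * D' = four_block_mat E Z1 Z2 (U * D)"
      unfolding U'_def D'_def using UD UT car
      by (subst mult_four_block_mat[of _ 1 1 _ n _ n _ _ 1 _ n]) (auto simp: Z1_def Z2_def)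
    hence "U' * D' * U'\<^sup>T = four_block_mat E Z1 Z2 (U * D * U\<^sup>T)"
      unfolding U'T using UD UT car UDc
      by (simp, subst mult_four_block_mat[of _ 1 1 _ n _ n _ _ 1 _ n]) (auto simp: Z1_def Z2_def)
    thus ?thesis using Bblock UD(5) by simp
  qed
  have diag: "diagonal_mat D'"
    using UD(2,3) car unfolding diagonal_mat_def D'_def
    by (auto simp: four_block_mat_def Let_def E_def Z1_def Z2_def)
  note assoc = assoc_mult_mat[of _ "Suc n" "Suc n" _ "Suc n" _ "Suc n"]
  have tr: "(W * U')\<^sup>T = U'\<^sup>T * W" using W U' by (simp add: transpose_mult[of _ "Suc n" "Suc n" _ "Suc n"])
  have U'T_c: "U'\<^sup>T \<in> carrier_mat (Suc n) (Suc n)" using U' by simp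
  have "(W * U')\<^sup>T * (W * U') = U'\<^sup>T * (W * W) * U'"
    unfolding tr using W(1) U' U'T_c by (simp add: assoc)
  hence 1: "(W * U')\<^sup>T * (W * U') = 1\<^sub>m (Suc n)" using W U' I U'T_c by simp
  have "A = (W * W) * A * (W * W)" using W A by simp
  also have "\<dots> = W * B * W" unfolding B_def using W(1) A by (simp add: assoc)
  also have "\<dots> = (W * U') * D' * (W * U')\<^sup>T"
    unfolding tr dec using W(1) U' U'T_c D' by (simp add: assoc)
  finally have 2: "A = (W * U') * D' * (W * U')\<^sup>T" .
  show ?case
    by (rule exI[of _ "W * U'"], rule exI[of _ D']) (use 1 2 diag W U' D' in auto)
qed

section \<open>Trace inequalities\<close>

text \<open>The clauses are U^T U = 1 and U U^T = 1: orthonormality of the columns, which serve as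
  eigenvectors, and their completeness. Each is used on its own as the hypothesis of
  \<open>parseval\<close>.\<close>

definition orthonormal :: "nat \<Rightarrow> (nat \<Rightarrow> nat \<Rightarrow> real) \<Rightarrow> bool" where
  "orthonormal n U \<longleftrightarrow>
     (\<forall>i<n. \<forall>k<n. (\<Sum>j<n. U j i * U j k) = (if i = k then 1 else 0)) \<and>
     (\<forall>j<n. \<forall>l<n. (\<Sum>i<n. U j i * U l i) = (if j = l then 1 else 0))"

text \<open>The matrix U diag(f) U^T.\<close>

definition spec_mat :: "nat \<Rightarrow> (nat \<Rightarrow> nat \<Rightarrow> real) \<Rightarrow> (nat \<Rightarrow> real) \<Rightarrow> nat \<Rightarrow> nat \<Rightarrow> real" where
  "spec_mat n U f j l = (\<Sum>i<n. f i * U j i * U l i)"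

text \<open>The matrix U^T V; for orthonormal U and V its squared entries form a doubly stochastic
  matrix.\<close>

definition overlap :: "nat \<Rightarrow> (nat \<Rightarrow> nat \<Rightarrow> real) \<Rightarrow> (nat \<Rightarrow> nat \<Rightarrow> real) \<Rightarrow> nat \<Rightarrow> nat \<Rightarrow> real" where
  "overlap n U V i k = (\<Sum>j<n. U j i * V j k)"

lemma sum_mult_delta_lessThan:
  fixes f :: "nat \<Rightarrow> real"
  assumes "i < n" shows "(\<Sum>k<n. f k * (if i = k then 1 else 0)) = f i"
  using assms by (simp add: if_distrib cong: if_cong)

text \<open>This is Tr(U f U^T V g V^T). With the sums over j and l innermost, the summand factors
  into two copies of the same overlap.\<close>

lemma spec_mat_inner:
  "(\<Sum>j<n. \<Sum>l<n. spec_mat n U f j l * spec_mat n V g j l) =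
   (\<Sum>i<n. \<Sum>k<n. f i * g k * (overlap n U V i k)\<^sup>2)"
proof -
  have "(\<Sum>j<n. \<Sum>l<n. spec_mat n U f j l * spec_mat n V g j l) =
     (\<Sum>j<n. \<Sum>l<n. \<Sum>i<n. \<Sum>k<n. f i * g k * ((U j i * V j k) * (U l i * V l k)))"
    unfolding spec_mat_def sum_product by (intro sum.cong refl) (simp add: mult_ac)
  also have "\<dots> = (\<Sum>j<n. \<Sum>i<n. \<Sum>l<n. \<Sum>k<n. f i * g k * ((U j i * V j k) * (U l i * V l k)))"
    by (intro sum.cong refl sum.swap)
  also have "\<dots> = (\<Sum>i<n. \<Sum>j<n. \<Sum>l<n. \<Sum>k<n. f i * g k * ((U j i * V j k) * (U l i * V l k)))"
    by (rule sum.swap)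
  also have "\<dots> = (\<Sum>i<n. \<Sum>j<n. \<Sum>k<n. \<Sum>l<n. f i * g k * ((U j i * V j k) * (U l i * V l k)))"
    by (intro sum.cong refl sum.swap)
  also have "\<dots> = (\<Sum>i<n. \<Sum>k<n. \<Sum>j<n. \<Sum>l<n. f i * g k * ((U j i * V j k) * (U l i * V l k)))"
    by (intro sum.cong refl sum.swap)
  also have "\<dots> = (\<Sum>i<n. \<Sum>k<n. f i * g k * (overlap n U V i k)\<^sup>2)"
    unfolding overlap_def power2_eq_square sum_product unfolding sum_distrib_left ..
  finally show ?thesis .
qed

lemma spec_mat_inner_self:
  assumes "orthonormal n U"
  shows "(\<Sum>j<n. \<Sum>l<n. spec_mat n U f j l * spec_mat n U g j l) = (\<Sum>i<n. f i * g i)"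
proof -
  have "(\<Sum>i<n. \<Sum>k<n. f i * g k * (overlap n U U i k)\<^sup>2) =
     (\<Sum>i<n. \<Sum>k<n. (f i * g k) * (if i = k then 1 else 0))"
    using assms by (intro sum.cong refl) (auto simp: overlap_def orthonormal_def)
  thus ?thesis unfolding spec_mat_inner by (simp add: sum_mult_delta_lessThan)
qed

lemma parseval:
  fixes W :: "nat \<Rightarrow> nat \<Rightarrow> real"
  assumes "\<And>i k. i < n \<Longrightarrow> k < n \<Longrightarrow> (\<Sum>j<n. W j i * W j k) = (if i = k then 1 else 0)"
  shows "(\<Sum>j<n. (\<Sum>i<n. c i * W j i)\<^sup>2) = (\<Sum>i<n. (c i)\<^sup>2)"
proof -
  have "(\<Sum>j<n. (\<Sum>i<n. c i * W j i)\<^sup>2) = (\<Sum>j<n. \<Sum>i<n. \<Sum>k<n. c i * c k * (W j i * W j k))"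
    unfolding power2_eq_square sum_product by (intro sum.cong refl) (simp add: mult_ac)
  also have "\<dots> = (\<Sum>i<n. \<Sum>j<n. \<Sum>k<n. c i * c k * (W j i * W j k))"
    by (rule sum.swap)
  also have "\<dots> = (\<Sum>i<n. \<Sum>k<n. \<Sum>j<n. c i * c k * (W j i * W j k))"
    by (intro sum.cong refl sum.swap)
  also have "\<dots> = (\<Sum>i<n. \<Sum>k<n. (c i * c k) * (if i = k then 1 else 0))"
    unfolding sum_distrib_left[symmetric] using assms by (intro sum.cong refl) auto
  also have "\<dots> = (\<Sum>i<n. (c i)\<^sup>2)" by (simp add: sum_mult_delta_lessThan power2_eq_square)
  finally show ?thesis .
qed

text \<open>Parseval for column i of U, a unit vector, expanded in the columns of V; completeness of
  V is what enters.\<close>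

lemma overlap_sum_right:
  assumes "orthonormal n U" "orthonormal n V" "i < n"
  shows "(\<Sum>k<n. (overlap n U V i k)\<^sup>2) = 1"
proof -
  have "(\<Sum>k<n. (overlap n U V i k)\<^sup>2) = (\<Sum>j<n. (U j i)\<^sup>2)"
    unfolding overlap_def using assms(2) by (intro parseval) (auto simp: orthonormal_def)
  thus ?thesis using assms(1,3) by (simp add: orthonormal_def power2_eq_square)
qed

lemma overlap_sum_left:
  assumes "orthonormal n U" "orthonormal n V" "k < n"
  shows "(\<Sum>i<n. (overlap n U V i k)\<^sup>2) = 1"
  using overlap_sum_right[OF assms(2,1,3)] by (simp add: overlap_def mult.commute)

text \<open>This and the next lemma spread a sum over one spectrum over pairs of eigenvalues, so
  that the traces of two matrices become averages with the same weights and can be compared pair by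
  pair.\<close>

lemma sum_overlap_left:
  assumes "orthonormal n U" "orthonormal n V"
  shows "(\<Sum>i<n. \<Sum>k<n. f i * (overlap n U V i k)\<^sup>2) = (\<Sum>i<n. f i)"
  unfolding sum_distrib_left[symmetric] using overlap_sum_right[OF assms] by simp

lemma sum_overlap_right:
  assumes "orthonormal n U" "orthonormal n V"
  shows "(\<Sum>i<n. \<Sum>k<n. f k * (overlap n U V i k)\<^sup>2) = (\<Sum>k<n. f k)"
  by (subst sum.swap, unfold sum_distrib_left[symmetric]) (use overlap_sum_left[OF assms] in simp)

text \<open>The identity behind the Hoffman-Wielandt inequality. After expanding the square, the two
  diagonal terms are spread over pairs of eigenvalues, and the square is completed under the common
  weights.\<close>

lemma spec_mat_diff_frobenius:
  assumes "orthonormal n U" "orthonormal n V"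
  shows "(\<Sum>j<n. \<Sum>l<n. (spec_mat n U f j l - spec_mat n V g j l)\<^sup>2) =
    (\<Sum>i<n. \<Sum>k<n. (f i - g k)\<^sup>2 * (overlap n U V i k)\<^sup>2)"
proof -
  have "(\<Sum>j<n. \<Sum>l<n. (spec_mat n U f j l - spec_mat n V g j l)\<^sup>2) =
     (\<Sum>j<n. \<Sum>l<n. spec_mat n U f j l * spec_mat n U f j l)
     + (\<Sum>j<n. \<Sum>l<n. spec_mat n V g j l * spec_mat n V g j l)
     - 2 * (\<Sum>j<n. \<Sum>l<n. spec_mat n U f j l * spec_mat n V g j l)"
    unfolding sum_distrib_left sum.distrib[symmetric] sum_subtractf[symmetric]
    by (intro sum.cong refl) (simp add: power2_eq_square algebra_simps)
  also have "\<dots> = (\<Sum>i<n. \<Sum>k<n. (f i * f i) * (overlap n U V i k)\<^sup>2) + (\<Sum>i<n. \<Sum>k<n. (g k * g k) * (overlap n U V i k)\<^sup>2)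
      - 2 * (\<Sum>i<n. \<Sum>k<n. f i * g k * (overlap n U V i k)\<^sup>2)"
    unfolding spec_mat_inner_self[OF assms(1)] spec_mat_inner_self[OF assms(2)]
      sum_overlap_left[OF assms, of "\<lambda>i. f i * f i"] sum_overlap_right[OF assms, of "\<lambda>i. g i * g i"]
    unfolding spec_mat_inner ..
  also have "\<dots> = (\<Sum>i<n. \<Sum>k<n. (f i - g k)\<^sup>2 * (overlap n U V i k)\<^sup>2)"
    unfolding sum_distrib_left sum.distrib[symmetric] sum_subtractf[symmetric]
    by (intro sum.cong refl) (simp add: power2_eq_square algebra_simps)
  finally show ?thesis .
qed

text \<open>Both Frobenius norms are averages over pairs of eigenvalues with the same weights, so
  the scalar inequality passes to matrices with the same constant.\<close>

lemma spec_mat_lipschitz: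
  assumes "orthonormal n U" "orthonormal n V"
    and lip: "\<And>x y. \<bar>h x - h y\<bar> \<le> K * \<bar>x - y\<bar>"
  shows "(\<Sum>j<n. \<Sum>l<n. (spec_mat n U (\<lambda>i. h (\<alpha> i)) j l - spec_mat n V (\<lambda>i. h (\<beta> i)) j l)\<^sup>2)
    \<le> K\<^sup>2 * (\<Sum>j<n. \<Sum>l<n. (spec_mat n U \<alpha> j l - spec_mat n V \<beta> j l)\<^sup>2)"
proof -
  have "(h x - h y)\<^sup>2 \<le> K\<^sup>2 * (x - y)\<^sup>2" for x y
    using power_mono[OF lip[of x y], of 2] by (simp add: power_mult_distrib)
  thus ?thesis
    unfolding spec_mat_diff_frobenius[OF assms(1,2)] sum_distrib_left
    by (intro sum_mono) (simp add: mult.assoc[symmetric] mult_right_mono)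
qed

text \<open>Averaging the scalar Taylor bound at each pair of eigenvalues over the doubly stochastic
  weights \<^term>\<open>(overlap n U V i k)\<^sup>2\<close> gives the trace inequality, as in Klein's inequality.\<close>

lemma trace_taylor:
  assumes "orthonormal n U" "orthonormal n V"
    and tay: "\<And>x y. \<bar>g x - g y - h y * (x - y)\<bar> \<le> K / 2 * (x - y)\<^sup>2"
  shows "\<bar>(\<Sum>i<n. g (\<alpha> i)) - (\<Sum>i<n. g (\<beta> i)) -
      (\<Sum>j<n. \<Sum>l<n. spec_mat n V (\<lambda>i. h (\<beta> i)) j l * (spec_mat n U \<alpha> j l - spec_mat n V \<beta> j l))\<bar>
    \<le> K / 2 * (\<Sum>j<n. \<Sum>l<n. (spec_mat n U \<alpha> j l - spec_mat n V \<beta> j l)\<^sup>2)"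
proof -
  let ?p = "\<lambda>i k. (overlap n U V i k)\<^sup>2"
  have "(\<Sum>j<n. \<Sum>l<n. spec_mat n V (\<lambda>i. h (\<beta> i)) j l * (spec_mat n U \<alpha> j l - spec_mat n V \<beta> j l))
     = (\<Sum>j<n. \<Sum>l<n. spec_mat n U \<alpha> j l * spec_mat n V (\<lambda>i. h (\<beta> i)) j l)
      - (\<Sum>j<n. \<Sum>l<n. spec_mat n V (\<lambda>i. h (\<beta> i)) j l * spec_mat n V \<beta> j l)"
    unfolding sum_subtractf[symmetric] by (intro sum.cong refl) (simp add: algebra_simps)
  also have "\<dots> = (\<Sum>i<n. \<Sum>k<n. \<alpha> i * h (\<beta> k) * ?p i k) - (\<Sum>i<n. \<Sum>k<n. (h (\<beta> k) * \<beta> k) * ?p i k)"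
    unfolding spec_mat_inner_self[OF assms(2)] sum_overlap_right[OF assms(1,2), of "\<lambda>k. h (\<beta> k) * \<beta> k"]
    unfolding spec_mat_inner ..
  finally have "(\<Sum>i<n. g (\<alpha> i)) - (\<Sum>i<n. g (\<beta> i)) -
      (\<Sum>j<n. \<Sum>l<n. spec_mat n V (\<lambda>i. h (\<beta> i)) j l * (spec_mat n U \<alpha> j l - spec_mat n V \<beta> j l))
    = (\<Sum>i<n. \<Sum>k<n. g (\<alpha> i) * ?p i k) - (\<Sum>i<n. \<Sum>k<n. g (\<beta> k) * ?p i k)
     - ((\<Sum>i<n. \<Sum>k<n. \<alpha> i * h (\<beta> k) * ?p i k) - (\<Sum>i<n. \<Sum>k<n. (h (\<beta> k) * \<beta> k) * ?p i k))"
    unfolding sum_overlap_right[OF assms(1,2), of "\<lambda>k. g (\<beta> k)"]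
      sum_overlap_left[OF assms(1,2), of "\<lambda>k. g (\<alpha> k)"] by (simp only:)
  also have "\<dots> = (\<Sum>i<n. \<Sum>k<n. (g (\<alpha> i) - g (\<beta> k) - h (\<beta> k) * (\<alpha> i - \<beta> k)) * ?p i k)"
    unfolding sum_subtractf[symmetric] by (intro sum.cong refl) (simp add: algebra_simps)
  finally have eq: "(\<Sum>i<n. g (\<alpha> i)) - (\<Sum>i<n. g (\<beta> i)) -
      (\<Sum>j<n. \<Sum>l<n. spec_mat n V (\<lambda>i. h (\<beta> i)) j l * (spec_mat n U \<alpha> j l - spec_mat n V \<beta> j l))
    = (\<Sum>i<n. \<Sum>k<n. (g (\<alpha> i) - g (\<beta> k) - h (\<beta> k) * (\<alpha> i - \<beta> k)) * ?p i k)" .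
  have "\<bar>\<Sum>i<n. \<Sum>k<n. (g (\<alpha> i) - g (\<beta> k) - h (\<beta> k) * (\<alpha> i - \<beta> k)) * ?p i k\<bar>
      \<le> (\<Sum>i<n. \<Sum>k<n. \<bar>(g (\<alpha> i) - g (\<beta> k) - h (\<beta> k) * (\<alpha> i - \<beta> k)) * ?p i k\<bar>)"
    by (rule order_trans[OF sum_abs], intro sum_mono sum_abs)
  also have "\<dots> \<le> (\<Sum>i<n. \<Sum>k<n. K / 2 * (\<alpha> i - \<beta> k)\<^sup>2 * ?p i k)"
    unfolding abs_mult abs_power2 by (intro sum_mono mult_right_mono tay zero_le_power2)
  also have "\<dots> = K / 2 * (\<Sum>j<n. \<Sum>l<n. (spec_mat n U \<alpha> j l - spec_mat n V \<beta> j l)\<^sup>2)"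
    unfolding spec_mat_diff_frobenius[OF assms(1,2)] sum_distrib_left mult.assoc ..
  finally show ?thesis unfolding eq .
qed

text \<open>The operator norm bound: pass to the coordinates \<open>z\<close> of y in the
  eigenbasis, multiply by f there, and pass back; both changes of basis preserve the norm. Later y
  is a row of the data matrix, and this is what saves a factor n when the first order terms are
  summed along the row.\<close>

lemma spec_mat_vec_bound:
  assumes U: "orthonormal n U" and f: "\<And>i. i < n \<Longrightarrow> \<bar>f i\<bar> \<le> K"
  shows "(\<Sum>j<n. (\<Sum>l<n. spec_mat n U f j l * y l)\<^sup>2) \<le> K\<^sup>2 * (\<Sum>l<n. (y l)\<^sup>2)"
proof -
  define z where "z i = (\<Sum>l<n. y l * U l i)" for i
  have "(\<Sum>l<n. spec_mat n U f j l * y l) = (\<Sum>i<n. (f i * z i) * U j i)" for j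
    unfolding spec_mat_def z_def sum_distrib_left sum_distrib_right
    by (subst sum.swap) (simp add: mult_ac)
  hence "(\<Sum>j<n. (\<Sum>l<n. spec_mat n U f j l * y l)\<^sup>2) = (\<Sum>i<n. (f i * z i)\<^sup>2)"
    using U by (simp add: parseval orthonormal_def)
  also have "\<dots> \<le> (\<Sum>i<n. K\<^sup>2 * (z i)\<^sup>2)"
    unfolding power_mult_distrib
    using power_mono[OF f, of _ 2] by (intro sum_mono mult_right_mono) auto
  also have "\<dots> = K\<^sup>2 * (\<Sum>l<n. (y l)\<^sup>2)"
  proof -
    have "(\<Sum>i<n. (z i)\<^sup>2) = (\<Sum>l<n. (y l)\<^sup>2)"
      unfolding z_def by (rule parseval[where W = "\<lambda>i l. U l i"]) (use U in \<open>auto simp: orthonormal_def\<close>)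
    thus ?thesis by (simp add: sum_distrib_left[symmetric])
  qed
  finally show ?thesis .
qed

lemma spec_mat_entry_bound:
  assumes U: "orthonormal n U" and f: "\<And>i. i < n \<Longrightarrow> \<bar>f i\<bar> \<le> K" and jl: "j < n" "l < n"
  shows "\<bar>spec_mat n U f j l\<bar> \<le> K"
proof -
  have K: "K \<ge> 0" using f[of j] jl by auto
  let ?y = "\<lambda>k. if k = l then 1 else (0::real)"
  have y: "(\<Sum>k<n. (?y k)\<^sup>2) = 1" using jl(2) by (simp add: if_distrib[of "\<lambda>x. x\<^sup>2"] cong: if_cong)
  have "(spec_mat n U f j l)\<^sup>2 = (\<Sum>k<n. spec_mat n U f j k * ?y k)\<^sup>2"
    using jl(2) by (simp add: if_distrib cong: if_cong)
  also have "\<dots> \<le> (\<Sum>j<n. (\<Sum>k<n. spec_mat n U f j k * ?y k)\<^sup>2)"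
    using jl(1) by (intro member_le_sum[where f = "\<lambda>j. (\<Sum>k<n. spec_mat n U f j k * ?y k)\<^sup>2"]) auto
  also have "\<dots> \<le> K\<^sup>2" using spec_mat_vec_bound[OF U f, where y = ?y] y by simp
  finally show ?thesis using K by (simp add: abs_le_square_iff[symmetric])
qed

text \<open>Traces count eigenvalues with multiplicity, so the multiset is read off the
  characteristic polynomial: similarity to the diagonal matrix turns it into a product of linear
  factors, indexed in the same way as the eigenvectors.\<close>

lemma symmetric_mat_spectral:
  fixes A :: "real mat"
  assumes A: "A \<in> carrier_mat n n" and sym: "A\<^sup>T = A"
  obtains U \<alpha> where "orthonormal n U" "\<And>j l. j < n \<Longrightarrow> l < n \<Longrightarrow> A $$ (j,l) = spec_mat n U \<alpha> j l"
    "eigvals A = image_mset \<alpha> (mset_set {..<n})"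
proof -
  obtain U D where U: "U \<in> carrier_mat n n" and D: "D \<in> carrier_mat n n" "diagonal_mat D"
    and I: "U\<^sup>T * U = 1\<^sub>m n" and dec: "A = U * D * U\<^sup>T"
    using symmetric_mat_diagonalization[OF assms] by blast
  have UT: "U\<^sup>T \<in> carrier_mat n n" using U by simp
  have I': "U * U\<^sup>T = 1\<^sub>m n" using mat_mult_left_right_inverse[OF UT U I] .
  define d where "d i = D $$ (i,i)" for i
  define u where "u j i = U $$ (j,i)" for j i
  have "orthonormal n u" unfolding orthonormal_def
  proof (intro conjI allI impI)
    fix i k assume ik: "i < n" "k < n"
    show "(\<Sum>j<n. u j i * u j k) = (if i = k then 1 else 0)"
      using arg_cong[OF I, of "\<lambda>M. M $$ (i,k)"] U ik by (simp add: scalar_prod_def u_def atLeast0LessThan)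
    show "(\<Sum>j<n. u i j * u k j) = (if i = k then 1 else 0)"
      using arg_cong[OF I', of "\<lambda>M. M $$ (i,k)"] U ik by (simp add: scalar_prod_def u_def atLeast0LessThan)
  qed
  moreover have "A $$ (j,l) = spec_mat n u d j l" if jl: "j < n" "l < n" for j l
  proof -
    have UD: "(U * D) $$ (j, i) = U $$ (j,i) * d i" if i: "i < n" for i
    proof -
      have "(U * D) $$ (j, i) = (\<Sum>k<n. U $$ (j,k) * D $$ (k,i))"
        using U D jl i by (simp add: scalar_prod_def atLeast0LessThan)
      also have "\<dots> = (\<Sum>k<n. (U $$ (j,k) * d k) * (if i = k then 1 else 0))"
        using D i by (intro sum.cong refl) (auto simp: diagonal_mat_def d_def)
      also have "\<dots> = U $$ (j,i) * d i" using i by (rule sum_mult_delta_lessThan)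
      finally show ?thesis .
    qed
    have "(M * U\<^sup>T) $$ (j,l) = (\<Sum>i<n. M $$ (j,i) * U $$ (l,i))" if "M \<in> carrier_mat n n" for M
      using that U jl by (simp add: scalar_prod_def atLeast0LessThan)
    from this[OF mult_carrier_mat[OF U D(1)]]
    have "A $$ (j,l) = (\<Sum>i<n. (U * D) $$ (j,i) * U $$ (l,i))"
      unfolding dec .
    also have "\<dots> = spec_mat n u d j l" unfolding spec_mat_def u_def
      by (intro sum.cong refl) (simp only: UD lessThan_iff mult_ac)
    finally show ?thesis .
  qed
  moreover have "eigvals A = image_mset d (mset_set {..<n})"
  proof -
    have "similar_mat_wit A D U (U\<^sup>T)"
      by (rule similar_mat_witI[OF I' I dec A D(1) U UT])
    hence "char_poly A = char_poly D" by (intro char_poly_similar) (auto simp: similar_mat_def)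
    also have "\<dots> = (\<Prod>a\<leftarrow>diag_mat D. [:- a, 1:])"
      by (rule char_poly_upper_triangular[OF D(1)]) (use D in \<open>auto simp: diagonal_mat_def\<close>)
    also have "\<dots> = (\<Prod>i<n. [:- d i, 1:])"
      using D by (simp add: diag_mat_def d_def prod.list_conv_set_nth atLeast0LessThan)
    finally have "proots (char_poly A) = (\<Sum>i<n. proots [:- d i, 1:])"
      by (simp add: proots_prod)
    also have "\<dots> = (\<Sum>i<n. {#d i#})" by simp
    also have "\<dots> = image_mset d (mset_set {..<n})"
      by (induction n) (auto simp: lessThan_Suc)
    finally show ?thesis by (simp add: eigvals_def)
  qed
  ultimately show ?thesis by (rule that)
qed

section \<open>The Efron--Stein inequality\<close>

text \<open>The decomposition into variance and squared bias. It serves to split off a conditional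
  variance, to replace the mean by another centre, and, with c = 0, to give Jensen's inequality for
  squares.\<close>

lemma (in prob_space) integral_square_shift:
  fixes f :: "'a \<Rightarrow> real"
  assumes f: "f \<in> borel_measurable M" and B: "\<And>x. x \<in> space M \<Longrightarrow> \<bar>f x\<bar> \<le> B"
  shows "(\<integral>x. (f x - c)\<^sup>2 \<partial>M) = (\<integral>x. (f x - integral\<^sup>L M f)\<^sup>2 \<partial>M) + (integral\<^sup>L M f - c)\<^sup>2"
proof -
  have i1: "integrable M f"
    using f B by (intro integrable_const_bound[where B = B]) auto
  have i2: "integrable M (\<lambda>x. (f x)\<^sup>2)"
    using f power_mono[OF B, of _ 2] by (intro integrable_const_bound[where B = "B\<^sup>2"]) auto
  have "(\<integral>x. (f x - d)\<^sup>2 \<partial>M) = (\<integral>x. (f x)\<^sup>2 \<partial>M) - 2 * d * integral\<^sup>L M f + d\<^sup>2" for d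
  proof -
    have "(\<integral>x. (f x - d)\<^sup>2 \<partial>M) = (\<integral>x. (f x)\<^sup>2 - 2 * d * f x + d\<^sup>2 \<partial>M)"
      by (simp add: power2_eq_square algebra_simps)
    also have "\<dots> = (\<integral>x. (f x)\<^sup>2 \<partial>M) - (\<integral>x. 2 * d * f x \<partial>M) + d\<^sup>2"
      using i1 i2 by (simp add: prob_space)
    finally show ?thesis by simp
  qed
  from this[of c] this[of "integral\<^sup>L M f"] show ?thesis
    by (simp add: power2_eq_square algebra_simps)
qed

lemma (in prob_space) integrable_bounded:
  fixes f :: "'a \<Rightarrow> real"
  assumes "f \<in> borel_measurable M" "\<And>x. x \<in> space M \<Longrightarrow> \<bar>f x\<bar> \<le> B"
  shows "integrable M f"
  by (rule integrable_const_bound[OF AE_I2 assms(1), where B = B]) (simp add: assms(2))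

lemma (in prob_space) abs_integral_le:
  fixes f :: "'a \<Rightarrow> real"
  assumes f: "f \<in> borel_measurable M" and B: "\<And>x. x \<in> space M \<Longrightarrow> \<bar>f x\<bar> \<le> B"
  shows "\<bar>integral\<^sup>L M f\<bar> \<le> B"
proof -
  have "\<bar>integral\<^sup>L M f\<bar> \<le> (\<integral>x. \<bar>f x\<bar> \<partial>M)" by (rule integral_abs_bound)
  also have "\<dots> \<le> (\<integral>x. B \<partial>M)"
    using integrable_bounded[OF assms] B by (intro integral_mono) auto
  finally show ?thesis by (simp add: prob_space)
qed

lemma (in prob_space) square_integral_le:
  fixes f :: "'a \<Rightarrow> real"
  assumes "f \<in> borel_measurable M" "\<And>x. x \<in> space M \<Longrightarrow> \<bar>f x\<bar> \<le> B"
  shows "(integral\<^sup>L M f)\<^sup>2 \<le> (\<integral>x. (f x)\<^sup>2 \<partial>M)"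
  using integral_square_shift[OF assms, of 0] by (simp add: integral_nonneg_AE)

lemma measurable_fun_upd_const:
  assumes "k \<in> I" "z \<in> space (M k)"
  shows "(\<lambda>x. x(k := z)) \<in> measurable (PiM I M) (PiM I M)"
  unfolding fun_upd_def
proof (rule measurable_PiM_single')
  fix i assume i: "i \<in> I"
  show "(\<lambda>x. if i = k then z else x i) \<in> measurable (PiM I M) (M i)"
    using i assms by (cases "i = k") auto
qed (use assms in \<open>auto simp: space_PiM PiE_iff extensional_def\<close>)

lemma measurable_add_dim':
  "i \<notin> I \<Longrightarrow> x \<in> space (PiM I M) \<Longrightarrow> (\<lambda>y. x(i := y)) \<in> measurable (M i) (PiM (insert i I) M)"
  by measurable

text \<open>Induction on the index set: integrating out one coordinate splits the variance into the
  conditional variance, bounded by the second moment about the value at \<^term>\<open>z i\<close>, and the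
  variance of the conditional expectation, to which Jensen's inequality applies.\<close>

lemma efron_stein:
  fixes F :: "('i \<Rightarrow> 'a) \<Rightarrow> real"
  assumes M: "\<And>i. prob_space (M i)" and z: "\<And>i. z i \<in> space (M i)"
    and I: "finite I" and F: "F \<in> borel_measurable (PiM I M)"
    and B: "\<And>x. x \<in> space (PiM I M) \<Longrightarrow> \<bar>F x\<bar> \<le> B"
  shows "(\<integral>x. (F x - integral\<^sup>L (PiM I M) F)\<^sup>2 \<partial>PiM I M)
    \<le> (\<Sum>i\<in>I. \<integral>x. (F x - F (x(i := z i)))\<^sup>2 \<partial>PiM I M)"
  using I F B
proof (induction I arbitrary: F rule: finite_induct)
  case empty
  interpret prob_space "PiM {} M" by (rule prob_space_PiM[OF M])
  have "integral\<^sup>L (PiM {} M) F = (\<integral>x. F (\<lambda>_. undefined) \<partial>PiM {} M)"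
    by (intro Bochner_Integration.integral_cong refl) (simp add: space_PiM)
  hence E: "integral\<^sup>L (PiM {} M) F = F (\<lambda>_. undefined)" by (simp add: prob_space)
  have "(\<integral>x. (F x - integral\<^sup>L (PiM {} M) F)\<^sup>2 \<partial>PiM {} M) = (\<integral>x. 0 \<partial>PiM {} M)"
    unfolding E by (intro Bochner_Integration.integral_cong refl) (simp add: space_PiM)
  thus ?case by simp
next
  case (insert i I F)
  note [measurable] = insert.prems(1)
  note B = insert.prems(2)
  interpret product_sigma_finite M
    unfolding product_sigma_finite_def using M by (auto intro: prob_space_imp_sigma_finite)
  interpret Mi: prob_space "M i" by (rule M)
  interpret Q: prob_space "PiM I M" by (rule prob_space_PiM[OF M])
  interpret R: prob_space "PiM (insert i I) M" by (rule prob_space_PiM[OF M])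
  have B0: "B \<ge> 0"
    using R.not_empty B abs_ge_zero order_trans by (metis all_not_in_conv)
  have sp: "x(i := y) \<in> space (PiM (insert i I) M)" if "x \<in> space (PiM I M)" "y \<in> space (M i)" for x y
    using that by (auto simp: space_PiM PiE_iff extensional_def)
  have spk: "x(k := z k) \<in> space (PiM J M)" if "x \<in> space (PiM J M)" "k \<in> J" for x k J
    using that z by (auto simp: space_PiM PiE_iff extensional_def)
  have fub: "integral\<^sup>L (PiM (insert i I) M) H = (\<integral>x. (\<integral>y. H (x(i:=y)) \<partial>M i) \<partial>PiM I M)"
    if "H \<in> borel_measurable (PiM (insert i I) M)" "\<And>x. x \<in> space (PiM (insert i I) M) \<Longrightarrow> \<bar>H x\<bar> \<le> C" for H and C :: real
    using insert.hyps R.integrable_bounded[OF that] by (intro product_integral_insert)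
  define G where "G x = (\<integral>y. F (x(i := y)) \<partial>M i)" for x
  define c where "c = integral\<^sup>L (PiM (insert i I) M) F"
  have c: "c = integral\<^sup>L (PiM I M) G"
    unfolding c_def G_def by (rule fub[OF insert.prems])
  have Fm: "(\<lambda>y. F (x(i := y))) \<in> borel_measurable (M i)" if "x \<in> space (PiM I M)" for x
    by (rule measurable_compose[OF measurable_add_dim'[OF insert.hyps(2) that] insert.prems(1)])
  have Gm [measurable]: "G \<in> borel_measurable (PiM I M)"
    unfolding G_def by measurable
  have GB: "\<bar>G x\<bar> \<le> B" if "x \<in> space (PiM I M)" for x
    unfolding G_def by (rule Mi.abs_integral_le[OF Fm[OF that] B[OF sp[OF that]]])
  have sqB: "\<bar>(a - b)\<^sup>2\<bar> \<le> (2 * B)\<^sup>2" if "\<bar>a\<bar> \<le> B" "\<bar>b\<bar> \<le> B" for a b :: real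
  proof -
    have "\<bar>a - b\<bar> \<le> \<bar>2 * B\<bar>" using that by linarith
    thus ?thesis by (simp only: abs_power2 abs_le_square_iff)
  qed
  have cB: "\<bar>c\<bar> \<le> B"
    unfolding c by (rule Q.abs_integral_le[OF Gm GB])
  \<comment> \<open>The conditional version of the k-th term of the bound, with coordinate i
    integrated out and the others fixed.\<close>
  define D where "D k x = (\<integral>y. (F (x(i:=y)) - F (x(i := y, k := z k)))\<^sup>2 \<partial>M i)" for k x
  have Fk [measurable]: "(\<lambda>x. F (x(k := z k))) \<in> borel_measurable (PiM (insert i I) M)" if "k \<in> insert i I" for k
    by (rule measurable_compose[OF measurable_fun_upd_const insert.prems(1)]) (use that z in auto)
  have Dk: "(\<integral>x. (F x - F (x(k := z k)))\<^sup>2 \<partial>PiM (insert i I) M) = integral\<^sup>L (PiM I M) (D k)"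
    if k: "k \<in> insert i I" for k
    unfolding D_def
    by (rule fub[OF borel_measurable_power[OF borel_measurable_diff[OF insert.prems(1) Fk[OF k]]] sqB[OF B B[OF spk[OF _ k]]]])
  have Dm: "D k \<in> borel_measurable (PiM I M)" if k: "k \<in> insert i I" for k
  proof -
    note [measurable] = Fk[OF k]
    show ?thesis unfolding D_def by measurable
  qed
  have DB: "\<bar>D k x\<bar> \<le> (2 * B)\<^sup>2" if k: "k \<in> insert i I" and x: "x \<in> space (PiM I M)" for k x
  proof -
    have m: "(\<lambda>y. F (x(i := y, k := z k))) \<in> borel_measurable (M i)"
      by (rule measurable_compose[OF measurable_add_dim'[OF insert.hyps(2) x] Fk[OF k]])
    show ?thesis unfolding D_def
      by (intro Mi.abs_integral_le sqB B sp[OF x] spk k borel_measurable_power borel_measurable_diff Fm[OF x] m)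
  qed
  have Dint: "integrable (PiM I M) (D k)" if "k \<in> insert i I" for k
    by (rule Q.integrable_bounded[OF Dm[OF that] DB[OF that]])
  have GI: "integrable (PiM I M) (\<lambda>x. (G x - b)\<^sup>2)" if "\<bar>b\<bar> \<le> B" for b
    by (rule Q.integrable_bounded[OF _ sqB[OF GB that]]) auto
  have "(\<integral>x. (F x - c)\<^sup>2 \<partial>PiM (insert i I) M) = (\<integral>x. (\<integral>y. (F (x(i:=y)) - c)\<^sup>2 \<partial>M i) \<partial>PiM I M)"
    by (rule fub[OF _ sqB[OF B cB]]) auto
  also have "\<dots> = (\<integral>x. (\<integral>y. (F (x(i:=y)) - G x)\<^sup>2 \<partial>M i) + (G x - c)\<^sup>2 \<partial>PiM I M)"
    unfolding G_def
    by (intro Bochner_Integration.integral_cong refl Mi.integral_square_shift[where B = B] Fm B sp)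
  \<comment> \<open>F (x(i := z i)) does not depend on the coordinate being integrated, so the mean
    square distance from it is at least the variance about G x.\<close>
  also have "\<dots> \<le> (\<integral>x. D i x + (G x - c)\<^sup>2 \<partial>PiM I M)"
  proof (rule integral_mono)
    show "integrable (PiM I M) (\<lambda>x. D i x + (G x - c)\<^sup>2)"
      by (intro Bochner_Integration.integrable_add Dint GI cB) auto
  next
    fix x assume x: "x \<in> space (PiM I M)"
    have "D i x = (\<integral>y. (F (x(i:=y)) - G x)\<^sup>2 \<partial>M i) + (G x - F (x(i := z i)))\<^sup>2"
      unfolding D_def G_def fun_upd_upd
      by (intro Mi.integral_square_shift[where B = B] Fm B sp x)
    thus "(\<integral>y. (F (x(i:=y)) - G x)\<^sup>2 \<partial>M i) + (G x - c)\<^sup>2 \<le> D i x + (G x - c)\<^sup>2" by simp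
  next
    \<comment> \<open>Integrability of the conditional variance: it is a second moment minus a
      squared mean, and both are measurable and bounded in x.\<close>
    have "(\<integral>y. (F (x(i:=y)) - G x)\<^sup>2 \<partial>M i) = (\<integral>y. (F (x(i:=y)) - 0)\<^sup>2 \<partial>M i) - (G x)\<^sup>2"
      if x: "x \<in> space (PiM I M)" for x
    proof -
      have "(\<integral>y. (F (x(i:=y)) - 0)\<^sup>2 \<partial>M i) = (\<integral>y. (F (x(i:=y)) - G x)\<^sup>2 \<partial>M i) + (G x - 0)\<^sup>2"
        unfolding G_def by (intro Mi.integral_square_shift[where B = B] Fm B sp x)
      thus ?thesis by simp
    qed
    moreover have "integrable (PiM I M) (\<lambda>x. (\<integral>y. (F (x(i:=y)) - 0)\<^sup>2 \<partial>M i) - (G x)\<^sup>2)"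
    proof (rule Bochner_Integration.integrable_diff)
      show "integrable (PiM I M) (\<lambda>x. \<integral>y. (F (x(i:=y)) - 0)\<^sup>2 \<partial>M i)"
      proof (rule Q.integrable_bounded)
        fix x assume x: "x \<in> space (PiM I M)"
        show "\<bar>\<integral>y. (F (x(i:=y)) - 0)\<^sup>2 \<partial>M i\<bar> \<le> (2*B)\<^sup>2"
          using B0 by (intro Mi.abs_integral_le sqB B sp[OF x] borel_measurable_power
            borel_measurable_diff Fm[OF x] borel_measurable_const) simp_all
      qed measurable
      show "integrable (PiM I M) (\<lambda>x. (G x)\<^sup>2)" using GI[of 0] B0 by simp
    qed
    ultimately have "integrable (PiM I M) (\<lambda>x. \<integral>y. (F (x(i:=y)) - G x)\<^sup>2 \<partial>M i)"
      by (simp cong: Bochner_Integration.integrable_cong)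
    thus "integrable (PiM I M) (\<lambda>x. (\<integral>y. (F (x(i:=y)) - G x)\<^sup>2 \<partial>M i) + (G x - c)\<^sup>2)"
      by (intro Bochner_Integration.integrable_add GI cB)
  qed
  also have "\<dots> = integral\<^sup>L (PiM I M) (D i) + (\<integral>x. (G x - c)\<^sup>2 \<partial>PiM I M)"
    by (intro Bochner_Integration.integral_add Dint GI cB) auto
  also have "(\<integral>x. (G x - c)\<^sup>2 \<partial>PiM I M) \<le> (\<Sum>k\<in>I. \<integral>x. (G x - G (x(k := z k)))\<^sup>2 \<partial>PiM I M)"
    unfolding c by (rule insert.IH[OF Gm GB])
  also have "\<dots> \<le> (\<Sum>k\<in>I. integral\<^sup>L (PiM I M) (D k))"
  proof (rule sum_mono)
    fix k assume k: "k \<in> I"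
    have ki: "k \<noteq> i" using k insert.hyps by auto
    have Gk [measurable]: "(\<lambda>x. G (x(k := z k))) \<in> borel_measurable (PiM I M)"
      by (rule measurable_compose[OF measurable_fun_upd_const Gm]) (use k z in auto)
    show "(\<integral>x. (G x - G (x(k := z k)))\<^sup>2 \<partial>PiM I M) \<le> integral\<^sup>L (PiM I M) (D k)"
    proof (rule integral_mono)
      show "integrable (PiM I M) (D k)" using k by (intro Dint) auto
      show "integrable (PiM I M) (\<lambda>x. (G x - G (x(k := z k)))\<^sup>2)"
        by (rule Q.integrable_bounded[OF _ sqB[OF GB GB[OF spk[OF _ k]]]]) auto
      fix x assume x: "x \<in> space (PiM I M)"
      have xk: "x(k := z k) \<in> space (PiM I M)" by (rule spk[OF x k])
      have int: "integrable (M i) (\<lambda>y. F (w(i := y)))" if "w \<in> space (PiM I M)" for w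
        by (rule Mi.integrable_bounded[OF Fm[OF that] B[OF sp[OF that]]])
      have eq: "G x - G (x(k := z k)) = (\<integral>y. F (x(i := y)) - F (x(k := z k, i := y)) \<partial>M i)"
        unfolding G_def by (intro Bochner_Integration.integral_diff[symmetric] int x xk)
      have "(G x - G (x(k := z k)))\<^sup>2 \<le> (\<integral>y. (F (x(i := y)) - F (x(k := z k, i := y)))\<^sup>2 \<partial>M i)"
        unfolding eq
      proof (rule Mi.square_integral_le[where B = "2 * B"])
        fix y assume y: "y \<in> space (M i)"
        show "\<bar>F (x(i := y)) - F (x(k := z k, i := y))\<bar> \<le> 2 * B"
        proof -
          have "\<bar>F (x(i := y))\<bar> \<le> B" "\<bar>F (x(k := z k, i := y))\<bar> \<le> B"
            by (intro B sp x xk y)+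
          thus ?thesis by linarith
        qed
      qed (intro borel_measurable_diff Fm x xk)
      also have "\<dots> = D k x" unfolding D_def fun_upd_twist[OF ki] ..
      finally show "(G x - G (x(k := z k)))\<^sup>2 \<le> D k x" .
    qed
  qed
  finally have "(\<integral>x. (F x - c)\<^sup>2 \<partial>PiM (insert i I) M) \<le> (\<Sum>k\<in>insert i I. integral\<^sup>L (PiM I M) (D k))"
    using insert.hyps by simp
  also have "\<dots> = (\<Sum>k\<in>insert i I. \<integral>x. (F x - F (x(k := z k)))\<^sup>2 \<partial>PiM (insert i I) M)"
    by (intro sum.cong refl Dk[symmetric])
  finally show ?case unfolding c_def .
qed

text \<open>Independence of coordinate i from the others: resetting it to z makes the second factor
  constant along that coordinate, so Fubini separates the two integrals.\<close>

lemma integral_PiM_mult_upd: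
  fixes G :: "('i \<Rightarrow> 'a) \<Rightarrow> real"
  assumes M: "\<And>i. prob_space (M i)" and z: "z \<in> space (M i)"
    and I: "finite I" "i \<in> I" and G: "G \<in> borel_measurable (PiM I M)"
    and B: "\<And>x. x \<in> space (PiM I M) \<Longrightarrow> \<bar>G x\<bar> \<le> B"
    and u: "u \<in> borel_measurable (M i)" "\<And>y. y \<in> space (M i) \<Longrightarrow> \<bar>u y\<bar> \<le> C"
  shows "(\<integral>x. u (x i) * G (x(i := z)) \<partial>PiM I M) = integral\<^sup>L (M i) u * (\<integral>x. G (x(i := z)) \<partial>PiM I M)"
proof -
  interpret product_sigma_finite M
    unfolding product_sigma_finite_def using M by (auto intro: prob_space_imp_sigma_finite)
  interpret Q: prob_space "PiM I M" by (rule prob_space_PiM[OF M])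
  interpret Mi: prob_space "M i" by (rule M)
  define J where "J = I - {i}"
  have J: "finite J" "i \<notin> J" "I = insert i J" using I by (auto simp: J_def)
  have sp: "x(i := z) \<in> space (PiM I M)" if "x \<in> space (PiM I M)" for x
    using that z I by (auto simp: space_PiM PiE_iff extensional_def)
  note [measurable] = u(1)
  have Gm [measurable]: "(\<lambda>x. G (x(i := z))) \<in> borel_measurable (PiM I M)"
    by (rule measurable_compose[OF measurable_fun_upd_const G]) (use z I in auto)
  have [measurable]: "(\<lambda>x. u (x i)) \<in> borel_measurable (PiM I M)"
    by (rule measurable_compose[OF _ u(1)]) (use I in simp)
  have Gi: "integrable (PiM I M) (\<lambda>x. G (x(i := z)))"
    by (rule Q.integrable_bounded[OF Gm B[OF sp]])
  have ui: "x i \<in> space (M i)" if "x \<in> space (PiM I M)" for x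
    using that I by (auto simp: space_PiM)
  have UG: "integrable (PiM I M) (\<lambda>x. u (x i) * G (x(i := z)))"
  proof (rule Q.integrable_bounded)
    fix x assume x: "x \<in> space (PiM I M)"
    have "\<bar>u (x i)\<bar> * \<bar>G (x(i := z))\<bar> \<le> C * B"
      using B[OF sp[OF x]] u(2)[OF ui[OF x]] by (intro mult_mono) auto
    thus "\<bar>u (x i) * G (x(i := z))\<bar> \<le> C * B" by (simp add: abs_mult)
  qed auto
  have "(\<integral>x. u (x i) * G (x(i := z)) \<partial>PiM I M) = (\<integral>x. (\<integral>y. u y * G (x(i := z)) \<partial>M i) \<partial>PiM J M)"
    using product_integral_insert[OF J(1,2) UG[unfolded J(3)]] by (simp add: J(3))
  also have "\<dots> = integral\<^sup>L (M i) u * (\<integral>x. (\<integral>y. G (x(i := z)) \<partial>M i) \<partial>PiM J M)"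
    by (simp add: Mi.prob_space)
  also have "(\<integral>x. (\<integral>y. G (x(i := z)) \<partial>M i) \<partial>PiM J M) = (\<integral>x. G (x(i := z)) \<partial>PiM I M)"
    using product_integral_insert[OF J(1,2) Gi[unfolded J(3)]] by (simp add: J(3))
  finally show ?thesis .
qed

section \<open>Fourier inversion\<close>

text \<open>The function \<open>h\<close> plays the role of the derivative of \<open>g\<close>. Phrasing the \<open>C\<^sup>1\<^sup>,\<^sup>1\<close> bounds without
  derivatives lets them pass to Fourier integrals directly.\<close>

definition c11_bound :: "real \<Rightarrow> (real \<Rightarrow> real) \<Rightarrow> (real \<Rightarrow> real) \<Rightarrow> bool" where
  "c11_bound K g h \<longleftrightarrow> (\<forall>x. \<bar>h x\<bar> \<le> K) \<and> (\<forall>x y. \<bar>h x - h y\<bar> \<le> K * \<bar>x - y\<bar>) \<and>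
     (\<forall>x y. \<bar>g x - g y - h y * (x - y)\<bar> \<le> K / 2 * (x - y)\<^sup>2)"

section \<open>Exponentials as functions with bounded Lipschitz derivative\<close>

lemma iexp_lipschitz: "cmod (iexp (t * x) - iexp (t * y)) \<le> \<bar>t\<bar> * \<bar>x - y\<bar>"
proof -
  have "iexp (t * x) - iexp (t * y) = iexp (t * y) * (iexp (t * (x - y)) - 1)"
    by (simp add: algebra_simps flip: exp_add)
  hence "cmod (iexp (t * x) - iexp (t * y)) = cmod (iexp (t * (x - y)) - 1)"
    by (simp add: norm_mult)
  also have "\<dots> \<le> \<bar>t * (x - y)\<bar>"
    using iexp_approx1[of "t * (x - y)" 0] by simp
  finally show ?thesis by (simp add: abs_mult)
qed

lemma iexp_taylor:
  "cmod (iexp (t * x) - iexp (t * y) - \<i> * t * iexp (t * y) * (x - y)) \<le> t\<^sup>2 / 2 * (x - y)\<^sup>2"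
proof -
  have "iexp (t * x) - iexp (t * y) - \<i> * t * iexp (t * y) * (x - y)
      = iexp (t * y) * (iexp (t * (x - y)) - (1 + \<i> * (t * (x - y))))"
    by (simp add: algebra_simps flip: exp_add)
  hence "cmod (iexp (t * x) - iexp (t * y) - \<i> * t * iexp (t * y) * (x - y))
      = cmod (iexp (t * (x - y)) - (1 + \<i> * (t * (x - y))))"
    by (simp only: norm_mult norm_exp_i_times mult_1)
  also have "\<dots> \<le> \<bar>t * (x - y)\<bar>\<^sup>2 / 2"
    using iexp_approx1[of "t * (x - y)" 1] by (simp add: numeral_2_eq_2)
  finally show ?thesis by (simp add: power_mult_distrib)
qed

text \<open>The bounds are proved for the complex exponential and passed to its real and imaginary
  parts, since \<open>c11_bound\<close> concerns real functions and taking parts does not increase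
  the modulus.\<close>

lemma c11_bound_trig:
  fixes t :: real
  assumes K: "\<bar>t\<bar> \<le> K" "t\<^sup>2 \<le> K"
  shows "c11_bound K (\<lambda>x. Re (iexp (t * x))) (\<lambda>x. Re (\<i> * t * iexp (t * x)))"
    and "c11_bound K (\<lambda>x. Im (iexp (t * x))) (\<lambda>x. Im (\<i> * t * iexp (t * x)))"
proof -
  let ?h = "\<lambda>x. \<i> * t * iexp (t * x)"
  have h1: "cmod (?h x) \<le> K" for x using K by (simp add: norm_mult)
  have h2: "cmod (?h x - ?h y) \<le> K * \<bar>x - y\<bar>" for x y
  proof -
    have "cmod (?h x - ?h y) = \<bar>t\<bar> * cmod (iexp (t * x) - iexp (t * y))"
      by (simp add: norm_mult flip: right_diff_distrib)
    also have "\<dots> \<le> \<bar>t\<bar> * (\<bar>t\<bar> * \<bar>x - y\<bar>)" by (intro mult_left_mono iexp_lipschitz) auto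
    also have "\<dots> = t\<^sup>2 * \<bar>x - y\<bar>" by (simp add: power2_eq_square abs_mult_self_eq flip: mult.assoc)
    also have "\<dots> \<le> K * \<bar>x - y\<bar>" using K by (intro mult_right_mono) auto
    finally show ?thesis .
  qed
  have h3: "cmod (iexp (t * x) - iexp (t * y) - ?h y * (x - y)) \<le> K / 2 * (x - y)\<^sup>2" for x y
    by (rule order_trans[OF iexp_taylor], rule mult_right_mono) (use K in auto)
  show "c11_bound K (\<lambda>x. Re (iexp (t * x))) (\<lambda>x. Re (?h x))" unfolding c11_bound_def
  proof (intro conjI allI)
    fix x y :: real
    show "\<bar>Re (?h x)\<bar> \<le> K" by (rule order_trans[OF abs_Re_le_cmod h1])
    show "\<bar>Re (?h x) - Re (?h y)\<bar> \<le> K * \<bar>x - y\<bar>"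
      using order_trans[OF abs_Re_le_cmod h2[of x y]] by (simp only: minus_complex.sel)
    have e: "Re (?h y) * (x - y) = Re (?h y * (x - y))" by (simp only: Re_complex_of_real times_complex.sel Im_complex_of_real of_real_diff[symmetric] mult_zero_right diff_zero)
    show "\<bar>Re (iexp (t * x)) - Re (iexp (t * y)) - Re (?h y) * (x - y)\<bar> \<le> K / 2 * (x - y)\<^sup>2"
      unfolding e using order_trans[OF abs_Re_le_cmod h3[of x y]] by (simp only: minus_complex.sel)
  qed
  show "c11_bound K (\<lambda>x. Im (iexp (t * x))) (\<lambda>x. Im (?h x))" unfolding c11_bound_def
  proof (intro conjI allI)
    fix x y :: real
    show "\<bar>Im (?h x)\<bar> \<le> K" by (rule order_trans[OF abs_Im_le_cmod h1])
    show "\<bar>Im (?h x) - Im (?h y)\<bar> \<le> K * \<bar>x - y\<bar>"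
      using order_trans[OF abs_Im_le_cmod h2[of x y]] by (simp only: minus_complex.sel)
    have e: "Im (?h y) * (x - y) = Im (?h y * (x - y))" by (simp only: Re_complex_of_real times_complex.sel Im_complex_of_real of_real_diff[symmetric] mult_zero_right add_0_left)
    show "\<bar>Im (iexp (t * x)) - Im (iexp (t * y)) - Im (?h y) * (x - y)\<bar> \<le> K / 2 * (x - y)\<^sup>2"
      unfolding e using order_trans[OF abs_Im_le_cmod h3[of x y]] by (simp only: minus_complex.sel)
  qed
qed

text \<open>The characteristic function of the standard normal law is again a Gaussian; the scale s
  enters by the substitution z = s t.\<close>

lemma gaussian_fourier_integral:
  fixes s w :: real
  assumes s: "s > 0"
  shows "(\<integral>t. iexp (t * w) * of_real (exp (- (s * t)\<^sup>2 / 2)) \<partial>lborel) =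
     of_real (2 * pi * (std_normal_density (w / s) / s))"
proof -
  have sq: "(\<integral>z. iexp (z * v) * of_real (exp (- z\<^sup>2 / 2)) \<partial>lborel) = of_real (sqrt (2 * pi) * exp (- v\<^sup>2 / 2))" for v :: real
  proof -
    have "(\<integral>z. std_normal_density z *\<^sub>R iexp (v * z) \<partial>lborel) = char std_normal_distribution v"
      unfolding char_def by (subst integral_density) auto
    hence "(\<integral>z. std_normal_density z *\<^sub>R iexp (v * z) \<partial>lborel) = of_real (exp (- v\<^sup>2 / 2))"
      by (simp add: char_std_normal_distribution)
    moreover have "(\<integral>z. iexp (z * v) * of_real (exp (- z\<^sup>2 / 2)) \<partial>lborel)
        = (\<integral>z. sqrt (2 * pi) *\<^sub>R (std_normal_density z *\<^sub>R iexp (v * z)) \<partial>lborel)"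
      by (intro Bochner_Integration.integral_cong refl)
        (simp add: std_normal_density_def scaleR_conv_of_real mult_ac)
    ultimately show ?thesis by (simp add: scaleR_conv_of_real)
  qed
  have "(\<integral>t. iexp (t * w) * of_real (exp (- (s * t)\<^sup>2 / 2)) \<partial>lborel)
      = \<bar>1 / s\<bar> *\<^sub>R (\<integral>z. iexp ((0 + 1 / s * z) * w) * of_real (exp (- (s * (0 + 1 / s * z))\<^sup>2 / 2)) \<partial>lborel)"
    using s by (intro lborel_integral_real_affine) auto
  also have "\<dots> = (1 / s) *\<^sub>R (\<integral>z. iexp (z * (w / s)) * of_real (exp (- z\<^sup>2 / 2)) \<partial>lborel)"
    using s by simp
  also have "\<dots> = of_real (2 * pi * (std_normal_density (w / s) / s))"
  proof -
    define E where "E = exp (- (w / s)\<^sup>2 / 2)"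
    have "2 * pi * (std_normal_density (w / s) / s) = (2 * pi / sqrt (2 * pi)) * E / s"
      by (simp add: std_normal_density_def E_def)
    also have "\<dots> = 1 / s * (sqrt (2 * pi) * E)"
      by (subst real_div_sqrt) auto
    finally show ?thesis unfolding sq E_def by (simp only: scaleR_conv_of_real of_real_mult)
  qed
  finally show ?thesis .
qed

lemma integrable_std_normal: "integrable lborel std_normal_density"
  by simp

lemma fourier_hat_measurable:
  assumes [measurable]: "\<phi> \<in> borel_measurable borel"
  shows "fourier_hat \<phi> \<in> borel_measurable borel"
  unfolding fourier_hat_def[abs_def] by measurable

text \<open>The Gaussian factor makes the double integral in t and y absolutely convergent, so
  Fubini applies. The integral over t then gives the Gaussian kernel of width s, and the left side
  is the convolution of phi with it.\<close>

lemma fourier_gaussian_mean: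
  fixes \<phi> :: "real \<Rightarrow> real"
  assumes \<phi>: "integrable lborel \<phi>" and s: "s > 0"
  shows "(\<integral>t. iexp (t * x) * fourier_hat \<phi> t * of_real (exp (- (s * t)\<^sup>2 / 2)) \<partial>lborel) =
     of_real (\<integral>y. \<phi> y * (std_normal_density ((x - y) / s) / s) \<partial>lborel)"
proof -
  have [measurable]: "\<phi> \<in> borel_measurable borel" using borel_measurable_integrable[OF \<phi>] by simp
  define G where "G t = exp (- (s * t)\<^sup>2 / 2)" for t
  have [measurable]: "G \<in> borel_measurable borel" unfolding G_def[abs_def] by measurable
  have Gi: "integrable lborel G"
  proof -
    have "integrable lborel (\<lambda>t. sqrt (2 * pi) * std_normal_density (0 + s * t))"
      using lborel_integrable_real_affine[OF integrable_std_normal, of s 0] s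
      by (intro integrable_mult_right) auto
    thus ?thesis by (simp add: std_normal_density_def G_def[abs_def])
  qed
  define f where "f t y = iexp (t * (x - y)) * of_real (G t) * of_real (\<phi> y) / of_real (2 * pi)" for t y
  have fi: "integrable (lborel \<Otimes>\<^sub>M lborel) (\<lambda>(t, y). f t y)"
  proof (rule lborel_pair.Fubini_integrable)
    show "(\<lambda>(t, y). f t y) \<in> borel_measurable (lborel \<Otimes>\<^sub>M lborel)"
      unfolding f_def by measurable
    have n: "norm (f t y) = G t * (\<bar>\<phi> y\<bar> / (2 * pi))" for t y
      by (simp add: f_def norm_mult norm_divide G_def)
    show "integrable lborel (\<lambda>t. \<integral>y. norm (case (t, y) of (t, y) \<Rightarrow> f t y) \<partial>lborel)"
      using Gi by (simp add: n)
    show "AE t in lborel. integrable lborel (\<lambda>y. case (t, y) of (t, y) \<Rightarrow> f t y)"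
    proof (rule AE_I2)
      fix t :: real
      have "integrable lborel (\<lambda>y. G t * (\<bar>\<phi> y\<bar> / (2 * pi)))" using \<phi> by auto
      hence "integrable lborel (\<lambda>y. norm (f t y))" by (simp add: n)
      moreover have "f t \<in> borel_measurable lborel" unfolding f_def by measurable
      ultimately show "integrable lborel (\<lambda>y. case (t, y) of (t, y) \<Rightarrow> f t y)"
        by (simp add: integrable_norm_iff)
    qed
  qed
  have "(\<integral>t. iexp (t * x) * fourier_hat \<phi> t * of_real (G t) \<partial>lborel) = (\<integral>t. (\<integral>y. f t y \<partial>lborel) \<partial>lborel)"
  proof (intro Bochner_Integration.integral_cong refl)
    fix t :: real
    have "(\<integral>y. f t y \<partial>lborel) = (\<integral>y. (iexp (t * x) * of_real (G t) / of_real (2 * pi)) * (exp (- (\<i> * complex_of_real (t * y))) * complex_of_real (\<phi> y)) \<partial>lborel)"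
      by (intro Bochner_Integration.integral_cong refl)
        (simp add: f_def algebra_simps exp_diff exp_minus field_simps)
    also have "\<dots> = (iexp (t * x) * of_real (G t) / of_real (2 * pi)) * (\<integral>y. exp (- (\<i> * complex_of_real (t * y))) * complex_of_real (\<phi> y) \<partial>lborel)"
      by (rule integral_mult_right_zero)
    finally show "iexp (t * x) * fourier_hat \<phi> t * of_real (G t) = (\<integral>y. f t y \<partial>lborel)"
      by (simp add: fourier_hat_def)
  qed
  also have "\<dots> = (\<integral>y. (\<integral>t. f t y \<partial>lborel) \<partial>lborel)"
    by (rule lborel_pair.Fubini_integral[OF fi, symmetric])
  also have "\<dots> = (\<integral>y. of_real (\<phi> y * (std_normal_density ((x - y) / s) / s)) \<partial>lborel)"
  proof (intro Bochner_Integration.integral_cong refl)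
    fix y :: real
    have "(\<integral>t. f t y \<partial>lborel) = (\<integral>t. (of_real (\<phi> y) / of_real (2 * pi)) * (iexp (t * (x - y)) * of_real (G t)) \<partial>lborel)"
      by (intro Bochner_Integration.integral_cong refl) (simp add: f_def)
    also have "\<dots> = (of_real (\<phi> y) / of_real (2 * pi)) * (\<integral>t. iexp (t * (x - y)) * of_real (G t) \<partial>lborel)"
      by (rule integral_mult_right_zero)
    also have "\<dots> = of_real (\<phi> y * (std_normal_density ((x - y) / s) / s))"
      unfolding G_def gaussian_fourier_integral[OF s] by simp
    finally show "(\<integral>t. f t y \<partial>lborel) = of_real (\<phi> y * (std_normal_density ((x - y) / s) / s))" .
  qed
  also have "\<dots> = of_real (\<integral>y. \<phi> y * (std_normal_density ((x - y) / s) / s) \<partial>lborel)"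
    by (rule integral_complex_of_real)
  finally show ?thesis unfolding G_def .
qed

text \<open>A continuous integrable phi may be unbounded, so it is split at distance 1 from x. The
  near part is bounded by compactness and converges by dominated convergence after rescaling. On the
  far part the kernel is uniformly small, and integrability of phi suffices.\<close>

lemma gaussian_approximate_identity:
  fixes \<phi> :: "real \<Rightarrow> real" and s :: "nat \<Rightarrow> real"
  assumes \<phi>: "integrable lborel \<phi>" and cont: "continuous_on UNIV \<phi>"
    and s: "\<And>k. s k > 0" "s \<longlonglongrightarrow> 0"
  shows "(\<lambda>k. \<integral>y. \<phi> y * (std_normal_density ((x - y) / s k) / s k) \<partial>lborel) \<longlonglongrightarrow> \<phi> x"
proof -
  have [measurable]: "\<phi> \<in> borel_measurable borel" using borel_measurable_integrable[OF \<phi>] by simp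
  have [measurable]: "cball x 1 \<in> sets borel" by simp
  let ?I = "indicator (cball x 1) :: real \<Rightarrow> real"
  let ?N = std_normal_density
  define p1 where "p1 y = \<phi> y * ?I y" for y
  define p2 where "p2 y = \<phi> y * (1 - ?I y)" for y
  have [measurable]: "p1 \<in> borel_measurable borel" "p2 \<in> borel_measurable borel"
    unfolding p1_def p2_def by measurable
  obtain B where B: "\<And>y. y \<in> cball x 1 \<Longrightarrow> \<bar>\<phi> y\<bar> \<le> B"
  proof -
    have "compact (\<phi> ` cball x 1)"
      by (intro compact_continuous_image continuous_on_subset[OF cont]) auto
    thus ?thesis using that compact_imp_bounded[of "\<phi> ` cball x 1"] unfolding bounded_iff by force
  qed
  have p1B: "\<bar>p1 y\<bar> \<le> B" for y
  proof (cases "y \<in> cball x 1")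
    case False
    have "0 \<le> B" using B[of x] by simp
    thus ?thesis using False by (simp add: p1_def)
  qed (use B in \<open>simp add: p1_def\<close>)
  \<comment> \<open>From exp u >= u with u = 1 / (2 r^2), the Gaussian is at most 2 r^2 at distance
    at least 1 from its centre; dividing by the width r leaves 2 r.\<close>
  have N_le: "?N (u / r) / r \<le> 2 * r" if "r > 0" "\<bar>u\<bar> \<ge> 1" for u r :: real
  proof -
    have u2: "1 \<le> u\<^sup>2" using that(2) by (simp add: abs_le_square_iff[of 1, simplified])
    have pi: "1 / sqrt (2 * pi) \<le> 1" using pi_gt3 by simp
    have "?N (u / r) \<le> exp (- (u / r)\<^sup>2 / 2)"
      unfolding std_normal_density_def using mult_right_mono[OF pi, of "exp (- (u / r)\<^sup>2 / 2)"] by simp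
    also have "\<dots> \<le> exp (- (1 / (2 * r\<^sup>2)))"
      using u2 that by (simp add: power_divide field_simps)
    also have "\<dots> \<le> 2 * r\<^sup>2"
    proof -
      have "1 / (2 * r\<^sup>2) \<le> exp (1 / (2 * r\<^sup>2))"
        using exp_ge_add_one_self[of "1 / (2 * r\<^sup>2)"] by linarith
      hence "inverse (exp (1 / (2 * r\<^sup>2))) \<le> inverse (1 / (2 * r\<^sup>2))"
        using that by (intro le_imp_inverse_le) auto
      thus ?thesis by (simp add: exp_minus)
    qed
    finally show ?thesis using that by (simp add: field_simps power2_eq_square)
  qed
  have lim1: "(\<lambda>k. \<integral>z. p1 (x + s k * z) * ?N z \<partial>lborel) \<longlonglongrightarrow> (\<integral>z. \<phi> x * ?N z \<partial>lborel)"
  proof (rule integral_dominated_convergence[where w = "\<lambda>z. B * ?N z"])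
    show "AE z in lborel. (\<lambda>k. p1 (x + s k * z) * ?N z) \<longlonglongrightarrow> \<phi> x * ?N z"
    proof (intro AE_I2 tendsto_mult tendsto_const)
      fix z :: real
      have sz: "(\<lambda>k. s k * z) \<longlonglongrightarrow> 0" using tendsto_mult_left_zero[OF s(2)] by simp
      have l: "(\<lambda>k. x + s k * z) \<longlonglongrightarrow> x"
        using tendsto_add[OF tendsto_const sz, of x] by simp
      have "(\<lambda>k. \<phi> (x + s k * z)) \<longlonglongrightarrow> \<phi> x"
        using cont l by (intro isCont_tendsto_compose[of x \<phi>]) (auto simp: continuous_on_eq_continuous_at)
      moreover have "\<forall>\<^sub>F k in sequentially. \<bar>s k * z\<bar> < 1"
        using order_tendstoD(2)[OF tendsto_rabs_zero[OF sz], of 1] by simp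
      hence "\<forall>\<^sub>F k in sequentially. \<phi> (x + s k * z) = p1 (x + s k * z)"
        by eventually_elim (auto simp: p1_def dist_real_def indicator_def)
      ultimately show "(\<lambda>k. p1 (x + s k * z)) \<longlonglongrightarrow> \<phi> x"
        by (blast intro: Lim_transform_eventually)
    qed
    show "AE z in lborel. norm (p1 (x + s k * z) * ?N z) \<le> B * ?N z" for k
      using p1B by (intro AE_I2) (simp add: abs_mult mult_right_mono)
  qed auto
  \<comment> \<open>The substitution y = x + s z, followed by evenness of the Gaussian.\<close>
  have eq1: "(\<integral>y. p1 y * (?N ((x - y) / s k) / s k) \<partial>lborel) = (\<integral>z. p1 (x + s k * z) * ?N z \<partial>lborel)" for k
  proof -
    have "(\<integral>y. p1 y * (?N ((x - y) / s k) / s k) \<partial>lborel)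
      = \<bar>s k\<bar> *\<^sub>R (\<integral>z. p1 (x + s k * z) * (?N ((x - (x + s k * z)) / s k) / s k) \<partial>lborel)"
      using s(1)[of k] by (intro lborel_integral_real_affine) auto
    also have "\<dots> = (\<integral>z. s k * (p1 (x + s k * z) * (?N ((x - (x + s k * z)) / s k) / s k)) \<partial>lborel)"
      using s(1)[of k] by simp
    also have "\<dots> = (\<integral>z. p1 (x + s k * z) * ?N z \<partial>lborel)"
      using s(1)[of k] by (intro Bochner_Integration.integral_cong refl) (simp add: std_normal_density_def)
    finally show ?thesis .
  qed
  have N0: "0 \<le> ?N z" for z by simp
  have p2e: "\<bar>p2 y * (?N ((x - y) / s k) / s k)\<bar> \<le> 2 * s k * \<bar>\<phi> y\<bar>" for y k
  proof (cases "y \<in> cball x 1")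
    case True
    thus ?thesis using s(1)[of k] by (simp add: p2_def)
  next
    case False
    have "?N ((x - y) / s k) / s k \<le> 2 * s k"
      using False s(1)[of k] by (intro N_le) (auto simp: dist_real_def)
    hence "\<bar>\<phi> y\<bar> * (?N ((x - y) / s k) / s k) \<le> \<bar>\<phi> y\<bar> * (2 * s k)" by (rule mult_left_mono) simp
    moreover have "0 \<le> ?N ((x - y) / s k) / s k" using s(1)[of k] by simp
    hence "\<bar>p2 y * (?N ((x - y) / s k) / s k)\<bar> = \<bar>\<phi> y\<bar> * (?N ((x - y) / s k) / s k)"
      using False unfolding p2_def abs_mult by (simp only: abs_of_nonneg) simp
    ultimately show ?thesis by (simp only: mult.commute)
  qed
  have p2i: "integrable lborel (\<lambda>y. p2 y * (?N ((x - y) / s k) / s k))" for k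
    by (rule Bochner_Integration.integrable_bound[where f = "\<lambda>y. 2 * s k * \<bar>\<phi> y\<bar>"])
      (use \<phi> in \<open>auto simp only: real_norm_def intro!: order_trans[OF p2e abs_ge_self]\<close>, use \<phi> in auto)
  have lim2: "(\<lambda>k. \<integral>y. p2 y * (?N ((x - y) / s k) / s k) \<partial>lborel) \<longlonglongrightarrow> 0"
  proof (rule Lim_null_comparison[OF always_eventually], rule allI)
    fix k
    have "norm (\<integral>y. p2 y * (?N ((x - y) / s k) / s k) \<partial>lborel) \<le> (\<integral>y. 2 * s k * \<bar>\<phi> y\<bar> \<partial>lborel)"
      using p2i \<phi> p2e by (intro Bochner_Integration.integral_norm_bound_integral) auto
    thus "norm (\<integral>y. p2 y * (?N ((x - y) / s k) / s k) \<partial>lborel) \<le> s k * (2 * (\<integral>y. \<bar>\<phi> y\<bar> \<partial>lborel))"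
      by simp
  next
    show "(\<lambda>k. s k * (2 * (\<integral>y. \<bar>\<phi> y\<bar> \<partial>lborel))) \<longlonglongrightarrow> 0"
      using tendsto_mult_left_zero[OF s(2)] by simp
  qed
  have p1i: "integrable lborel (\<lambda>y. p1 y * (?N ((x - y) / s k) / s k))" for k
  proof -
    have "integrable lborel (\<lambda>y. ?N (x / s k + (- 1 / s k) * y))"
      using s(1)[of k] by (intro lborel_integrable_real_affine integrable_std_normal) auto
    hence *: "integrable lborel (\<lambda>y. B / s k * ?N ((x - y) / s k))"
      using s(1)[of k] by (simp add: diff_divide_distrib)
    show ?thesis
      by (rule Bochner_Integration.integrable_bound[OF *])
        (use p1B s(1)[of k] in \<open>auto simp: abs_mult intro!: divide_right_mono mult_right_mono order_trans[OF p1B]\<close>)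
  qed
  have "(\<integral>y. \<phi> y * (?N ((x - y) / s k) / s k) \<partial>lborel)
     = (\<integral>z. p1 (x + s k * z) * ?N z \<partial>lborel) + (\<integral>y. p2 y * (?N ((x - y) / s k) / s k) \<partial>lborel)" for k
  proof -
    have "(\<integral>y. \<phi> y * (?N ((x - y) / s k) / s k) \<partial>lborel) = (\<integral>y. p1 y * (?N ((x - y) / s k) / s k) + p2 y * (?N ((x - y) / s k) / s k) \<partial>lborel)"
      by (intro Bochner_Integration.integral_cong refl) (simp add: p1_def p2_def indicator_def)
    also have "\<dots> = (\<integral>y. p1 y * (?N ((x - y) / s k) / s k) \<partial>lborel) + (\<integral>y. p2 y * (?N ((x - y) / s k) / s k) \<partial>lborel)"
      by (rule Bochner_Integration.integral_add[OF p1i p2i])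
    finally show ?thesis by (simp only: eq1)
  qed
  thus ?thesis using tendsto_add[OF lim1 lim2] by simp
qed

text \<open>The damped integral has two limits as the damping disappears: the inversion integral, by
  dominated convergence with the integrable transform as majorant, and phi x, by the approximate
  identity.\<close>

theorem fourier_inversion:
  fixes \<phi> :: "real \<Rightarrow> real"
  assumes \<phi>: "integrable lborel \<phi>" and cont: "continuous_on UNIV \<phi>"
    and hat: "integrable lborel (fourier_hat \<phi>)"
  shows "of_real (\<phi> x) = (\<integral>t. iexp (t * x) * fourier_hat \<phi> t \<partial>lborel)"
proof -
  have [measurable]: "fourier_hat \<phi> \<in> borel_measurable borel" using borel_measurable_integrable[OF hat] by simp
  define s where "s k = 1 / real (Suc k)" for k
  have s: "s k > 0" for k by (simp add: s_def)
  have s0: "s \<longlonglongrightarrow> 0" unfolding s_def[abs_def] by (rule LIMSEQ_Suc[OF lim_1_over_n])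
  have "(\<lambda>k. \<integral>t. iexp (t * x) * fourier_hat \<phi> t * of_real (exp (- (s k * t)\<^sup>2 / 2)) \<partial>lborel)
     \<longlonglongrightarrow> (\<integral>t. iexp (t * x) * fourier_hat \<phi> t \<partial>lborel)"
  proof (rule integral_dominated_convergence[where w = "\<lambda>t. cmod (fourier_hat \<phi> t)"])
    show "AE t in lborel. (\<lambda>k. iexp (t * x) * fourier_hat \<phi> t * of_real (exp (- (s k * t)\<^sup>2 / 2)))
        \<longlonglongrightarrow> iexp (t * x) * fourier_hat \<phi> t"
    proof (rule AE_I2)
      fix t :: real
      have "(\<lambda>k. iexp (t * x) * fourier_hat \<phi> t * of_real (exp (- (s k * t)\<^sup>2 / 2)))
        \<longlonglongrightarrow> iexp (t * x) * fourier_hat \<phi> t * of_real (exp (- (0 * t)\<^sup>2 / 2))"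
        by (intro tendsto_intros s0) simp
      thus "(\<lambda>k. iexp (t * x) * fourier_hat \<phi> t * of_real (exp (- (s k * t)\<^sup>2 / 2)))
        \<longlonglongrightarrow> iexp (t * x) * fourier_hat \<phi> t" by simp
    qed
    show "AE t in lborel. norm (iexp (t * x) * fourier_hat \<phi> t * of_real (exp (- (s k * t)\<^sup>2 / 2))) \<le> cmod (fourier_hat \<phi> t)" for k
      by (intro AE_I2) (simp add: norm_mult mult_left_le)
  qed (use hat in auto)
  moreover have "(\<lambda>k. \<integral>t. iexp (t * x) * fourier_hat \<phi> t * of_real (exp (- (s k * t)\<^sup>2 / 2)) \<partial>lborel) \<longlonglongrightarrow> of_real (\<phi> x)"
    unfolding fourier_gaussian_mean[OF \<phi> s]
    by (intro tendsto_of_real gaussian_approximate_identity \<phi> cont s s0)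
  ultimately show ?thesis by (rule LIMSEQ_unique[symmetric])
qed

text \<open>The weight 1 + |t|^4 of the theorem dominates both constants that the exponential with
  frequency t requires in \<open>c11_bound\<close>.\<close>

lemma abs_square_le_one_plus_power4:
  fixes t :: real
  shows "\<bar>t\<bar> \<le> 1 + \<bar>t\<bar> ^ 4" "t\<^sup>2 \<le> 1 + \<bar>t\<bar> ^ 4"
proof -
  have p: "\<bar>t\<bar> ^ 4 = t\<^sup>2 * t\<^sup>2" by (simp add: power2_eq_square power4_eq_xxxx)
  have "0 \<le> (t\<^sup>2 - 1)\<^sup>2" by simp
  hence a: "2 * t\<^sup>2 \<le> 1 + \<bar>t\<bar> ^ 4" unfolding p by (simp add: power2_eq_square[of "t\<^sup>2 - 1"] algebra_simps)
  show "t\<^sup>2 \<le> 1 + \<bar>t\<bar> ^ 4" using a zero_le_power2[of t] by linarith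
  have "0 \<le> (\<bar>t\<bar> - 1)\<^sup>2" by simp
  hence "2 * \<bar>t\<bar> \<le> 1 + t\<^sup>2" by (simp add: power2_diff)
  moreover have "0 \<le> \<bar>t\<bar> ^ 4" by simp
  ultimately show "\<bar>t\<bar> \<le> 1 + \<bar>t\<bar> ^ 4" using a by linarith
qed

text \<open>Inversion writes phi as a superposition of exponentials. The candidate for the
  derivative is the real part of the formally differentiated integral \<open>H\<close>, and each of
  the three bounds is the integral over t of the corresponding bound for one exponential.\<close>

lemma c11_bound_fourier:
  fixes \<phi> :: "real \<Rightarrow> real"
  assumes \<phi>: "integrable lborel \<phi>" and cont: "continuous_on UNIV \<phi>"
    and hat: "integrable lborel (\<lambda>t. (1 + \<bar>t\<bar> ^ 4) * cmod (fourier_hat \<phi> t))"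
  obtains h where "c11_bound (\<integral>t. (1 + \<bar>t\<bar> ^ 4) * cmod (fourier_hat \<phi> t) \<partial>lborel) \<phi> h"
proof -
  let ?w = "\<lambda>t. (1 + \<bar>t\<bar> ^ 4) * cmod (fourier_hat \<phi> t)"
  let ?S = "integral\<^sup>L lborel ?w"
  let ?F = "fourier_hat \<phi>"
  have "\<phi> \<in> borel_measurable borel" using borel_measurable_integrable[OF \<phi>] by simp
  note [measurable] = this fourier_hat_measurable[OF this]
  note w = abs_square_le_one_plus_power4
  have bnd: "integrable lborel f" if "f \<in> borel_measurable borel" "\<And>t. cmod (f t) \<le> c * ?w t" for f :: "real \<Rightarrow> complex" and c
    by (rule Bochner_Integration.integrable_bound[where f = "\<lambda>t. c * ?w t"])
      (use hat that order_trans[OF that(2) abs_ge_self] in auto)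
  have bnd': "cmod (integral\<^sup>L lborel f) \<le> c * ?S" if "f \<in> borel_measurable borel" "\<And>t. cmod (f t) \<le> c * ?w t" for f :: "real \<Rightarrow> complex" and c
  proof -
    have "cmod (integral\<^sup>L lborel f) \<le> (\<integral>t. c * ?w t \<partial>lborel)"
      using bnd[OF that] that hat by (intro Bochner_Integration.integral_norm_bound_integral) auto
    thus ?thesis by simp
  qed
  have Fi: "integrable lborel ?F"
    by (rule bnd[where c = 1]) (auto simp: algebra_simps)
  have inv: "of_real (\<phi> x) = (\<integral>t. iexp (t * x) * ?F t \<partial>lborel)" for x
    by (rule fourier_inversion[OF \<phi> cont Fi])
  let ?d = "\<lambda>x t. \<i> * t * iexp (t * x) * ?F t"
  define H where "H x = (\<integral>t. ?d x t \<partial>lborel)" for x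
  have d1: "cmod (?d x t) \<le> 1 * ?w t" for x t
    using mult_right_mono[OF w(1)[of t], of "cmod (?F t)"] by (simp add: norm_mult)
  have d2: "cmod (?d x t - ?d y t) \<le> \<bar>x - y\<bar> * ?w t" for x y t
  proof -
    have "?d x t - ?d y t = \<i> * t * (iexp (t * x) - iexp (t * y)) * ?F t" by (simp add: algebra_simps)
    hence "cmod (?d x t - ?d y t) = \<bar>t\<bar> * cmod (iexp (t * x) - iexp (t * y)) * cmod (?F t)"
      by (simp add: norm_mult)
    also have "\<dots> \<le> \<bar>t\<bar> * (\<bar>t\<bar> * \<bar>x - y\<bar>) * cmod (?F t)"
      by (intro mult_right_mono mult_left_mono iexp_lipschitz) auto
    also have "\<dots> = t\<^sup>2 * (\<bar>x - y\<bar> * cmod (?F t))" by (simp add: power2_eq_square abs_mult_self_eq flip: mult.assoc)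
    also have "\<dots> \<le> (1 + \<bar>t\<bar> ^ 4) * (\<bar>x - y\<bar> * cmod (?F t))" by (intro mult_right_mono w) auto
    finally show ?thesis by (simp add: mult_ac)
  qed
  have d3: "cmod (iexp (t * x) * ?F t - iexp (t * y) * ?F t - ?d y t * (x - y)) \<le> (x - y)\<^sup>2 / 2 * ?w t" for x y t
  proof -
    have "iexp (t * x) * ?F t - iexp (t * y) * ?F t - ?d y t * (x - y)
      = (iexp (t * x) - iexp (t * y) - \<i> * t * iexp (t * y) * (x - y)) * ?F t" by (simp add: algebra_simps)
    hence "cmod (iexp (t * x) * ?F t - iexp (t * y) * ?F t - ?d y t * (x - y))
       = cmod (iexp (t * x) - iexp (t * y) - \<i> * t * iexp (t * y) * (x - y)) * cmod (?F t)"
      by (simp only: norm_mult)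
    also have "\<dots> \<le> t\<^sup>2 / 2 * (x - y)\<^sup>2 * cmod (?F t)" by (intro mult_right_mono iexp_taylor) auto
    also have "\<dots> = t\<^sup>2 * ((x - y)\<^sup>2 / 2 * cmod (?F t))" by simp
    also have "\<dots> \<le> (1 + \<bar>t\<bar> ^ 4) * ((x - y)\<^sup>2 / 2 * cmod (?F t))" by (intro mult_right_mono w) auto
    finally show ?thesis by (simp add: mult_ac)
  qed
  have di: "integrable lborel (?d x)" for x by (rule bnd[OF _ d1]) measurable
  have ei: "integrable lborel (\<lambda>t. iexp (t * x) * ?F t)" for x
    by (rule bnd[where c = 1]) (auto simp: norm_mult algebra_simps)
  have H1: "cmod (H x) \<le> ?S" for x
    unfolding H_def using bnd'[OF _ d1] by simp
  have H2: "cmod (H x - H y) \<le> \<bar>x - y\<bar> * ?S" for x y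
    unfolding H_def Bochner_Integration.integral_diff[OF di di, symmetric] by (rule bnd'[OF _ d2]) measurable
  have H3: "cmod (of_real (\<phi> x) - of_real (\<phi> y) - H y * (x - y)) \<le> (x - y)\<^sup>2 / 2 * ?S" for x y
  proof -
    have "of_real (\<phi> x) - of_real (\<phi> y) - H y * (x - y)
       = (\<integral>t. iexp (t * x) * ?F t - iexp (t * y) * ?F t - ?d y t * (x - y) \<partial>lborel)"
      unfolding inv H_def using ei[of x] ei[of y] di[of y] by simp
    thus ?thesis using bnd'[OF _ d3[of _ x y]] by simp
  qed
  have "c11_bound ?S \<phi> (\<lambda>x. Re (H x))"
    unfolding c11_bound_def
  proof (intro conjI allI)
    fix x y :: real
    show "\<bar>Re (H x)\<bar> \<le> ?S" by (rule order_trans[OF abs_Re_le_cmod H1])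
    show "\<bar>Re (H x) - Re (H y)\<bar> \<le> ?S * \<bar>x - y\<bar>"
      using order_trans[OF abs_Re_le_cmod H2[of x y]] by (simp add: mult.commute)
    show "\<bar>\<phi> x - \<phi> y - Re (H y) * (x - y)\<bar> \<le> ?S / 2 * (x - y)\<^sup>2"
      using order_trans[OF abs_Re_le_cmod H3[of x y]] by (simp add: mult.commute)
  qed
  thus ?thesis by (rule that)
qed

section \<open>Perturbation of a Gram matrix by one entry\<close>

definition symmetric_on :: "nat \<Rightarrow> (nat \<Rightarrow> nat \<Rightarrow> real) \<Rightarrow> bool" where
  "symmetric_on n A \<longleftrightarrow> (\<forall>j<n. \<forall>l<n. A j l = A l j)"

definition trace_fun :: "nat \<Rightarrow> (real \<Rightarrow> real) \<Rightarrow> (nat \<Rightarrow> nat \<Rightarrow> real) \<Rightarrow> real" where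
  "trace_fun n g A = tr_fun g (mat n n (\<lambda>(j, l). A j l))"

definition eigensystem :: "nat \<Rightarrow> (nat \<Rightarrow> nat \<Rightarrow> real) \<Rightarrow> (nat \<Rightarrow> nat \<Rightarrow> real) \<times> (nat \<Rightarrow> real) \<Rightarrow> bool" where
  "eigensystem n A e \<longleftrightarrow> orthonormal n (fst e) \<and>
     (\<forall>j<n. \<forall>l<n. A j l = spec_mat n (fst e) (snd e) j l) \<and>
     eigvals (mat n n (\<lambda>(j, l). A j l)) = image_mset (snd e) (mset_set {..<n})"

text \<open>The choice of an eigensystem makes \<open>mat_fun n f\<close> a function of the matrix, so that
  its measurability can be deduced from the Lipschitz bound below.\<close>

definition mat_fun :: "nat \<Rightarrow> (real \<Rightarrow> real) \<Rightarrow> (nat \<Rightarrow> nat \<Rightarrow> real) \<Rightarrow> nat \<Rightarrow> nat \<Rightarrow> real" where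
  "mat_fun n f A = (let e = SOME e. eigensystem n A e in spec_mat n (fst e) (\<lambda>i. f (snd e i)))"

lemma eigensystem_exists:
  assumes "symmetric_on n A" shows "\<exists>e. eigensystem n A e"
proof -
  have "(mat n n (\<lambda>(j, l). A j l))\<^sup>T = mat n n (\<lambda>(j, l). A j l)"
    by (rule eq_matI) (use assms in \<open>auto simp: symmetric_on_def\<close>)
  then obtain U a where *: "orthonormal n U"
    "\<And>j l. j < n \<Longrightarrow> l < n \<Longrightarrow> mat n n (\<lambda>(j, l). A j l) $$ (j,l) = spec_mat n U a j l"
    "eigvals (mat n n (\<lambda>(j, l). A j l)) = image_mset a (mset_set {..<n})"
    using symmetric_mat_spectral[of "mat n n (\<lambda>(j, l). A j l)" n] by auto
  have "eigensystem n A (U, a)" using * by (auto simp: eigensystem_def)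
  thus ?thesis ..
qed

text \<open>The eigensystem is chosen from A alone, before f and g, so one basis represents A, all
  its matrix functions and all its traces at once.\<close>

lemma mat_fun_eq:
  assumes "symmetric_on n A"
  obtains U a where "orthonormal n U" "\<And>j l. j < n \<Longrightarrow> l < n \<Longrightarrow> A j l = spec_mat n U a j l"
    "\<And>f. mat_fun n f A = spec_mat n U (\<lambda>i. f (a i))" "\<And>g. trace_fun n g A = (\<Sum>i<n. g (a i))"
proof -
  define e where "e = (SOME e. eigensystem n A e)"
  have e: "eigensystem n A e"
    unfolding e_def by (rule someI_ex[OF eigensystem_exists[OF assms]])
  show ?thesis
  proof (rule that[of "fst e" "snd e"])
    show "mat_fun n f A = spec_mat n (fst e) (\<lambda>i. f (snd e i))" for f
      by (simp add: mat_fun_def e_def Let_def)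
    show "trace_fun n g A = (\<Sum>i<n. g (snd e i))" for g
      using e by (simp add: trace_fun_def tr_fun_def eigensystem_def sum_unfold_sum_mset multiset.map_comp o_def)
  qed (use e in \<open>auto simp: eigensystem_def\<close>)
qed

lemma mat_fun_sym: "mat_fun n f A j l = mat_fun n f A l j"
  by (simp add: mat_fun_def Let_def spec_mat_def mult_ac)

text \<open>Eigenbases can jump as the matrix varies, but the Frobenius identity holds for every
  choice of them, so the matrix function still varies continuously.\<close>

lemma mat_fun_lipschitz:
  assumes "symmetric_on n A" "symmetric_on n B" "c11_bound K g h"
  shows "(\<Sum>j<n. \<Sum>l<n. (mat_fun n h A j l - mat_fun n h B j l)\<^sup>2) \<le> K\<^sup>2 * (\<Sum>j<n. \<Sum>l<n. (A j l - B j l)\<^sup>2)"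
proof -
  obtain U a where A: "orthonormal n U" "\<And>j l. j < n \<Longrightarrow> l < n \<Longrightarrow> A j l = spec_mat n U a j l"
    "\<And>f. mat_fun n f A = spec_mat n U (\<lambda>i. f (a i))"
    by (rule mat_fun_eq[OF assms(1)], rule that)
  obtain V b where B: "orthonormal n V" "\<And>j l. j < n \<Longrightarrow> l < n \<Longrightarrow> B j l = spec_mat n V b j l"
    "\<And>f. mat_fun n f B = spec_mat n V (\<lambda>i. f (b i))"
    by (rule mat_fun_eq[OF assms(2)], rule that)
  have "(\<Sum>j<n. \<Sum>l<n. (A j l - B j l)\<^sup>2) = (\<Sum>j<n. \<Sum>l<n. (spec_mat n U a j l - spec_mat n V b j l)\<^sup>2)"
    by (intro sum.cong refl) (simp add: A B)
  thus ?thesis unfolding A(3) B(3)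
    using spec_mat_lipschitz[OF A(1) B(1), of h K a b] assms(3) by (simp add: c11_bound_def)
qed

lemma mat_fun_vec_bound:
  assumes "symmetric_on n A" "c11_bound K g h"
  shows "(\<Sum>j<n. (\<Sum>l<n. mat_fun n h A j l * y l)\<^sup>2) \<le> K\<^sup>2 * (\<Sum>l<n. (y l)\<^sup>2)"
proof -
  obtain U a where A: "orthonormal n U" "\<And>f. mat_fun n f A = spec_mat n U (\<lambda>i. f (a i))"
    by (rule mat_fun_eq[OF assms(1)], rule that)
  show ?thesis unfolding A(2) by (rule spec_mat_vec_bound[OF A(1)]) (use assms(2) in \<open>simp add: c11_bound_def\<close>)
qed

lemma mat_fun_entry_bound:
  assumes "symmetric_on n A" "c11_bound K g h" "j < n" "l < n"
  shows "\<bar>mat_fun n h A j l\<bar> \<le> K"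
proof -
  obtain U a where A: "orthonormal n U" "\<And>f. mat_fun n f A = spec_mat n U (\<lambda>i. f (a i))"
    by (rule mat_fun_eq[OF assms(1)], rule that)
  show ?thesis unfolding A(2) by (rule spec_mat_entry_bound[OF A(1) _ assms(3,4)]) (use assms(2) in \<open>simp add: c11_bound_def\<close>)
qed

lemma trace_fun_taylor:
  assumes "symmetric_on n A" "symmetric_on n B" "c11_bound K g h"
  shows "\<bar>trace_fun n g B - trace_fun n g A - (\<Sum>j<n. \<Sum>l<n. mat_fun n h A j l * (B j l - A j l))\<bar>
    \<le> K / 2 * (\<Sum>j<n. \<Sum>l<n. (B j l - A j l)\<^sup>2)"
proof -
  obtain V b where A: "orthonormal n V" "\<And>j l. j < n \<Longrightarrow> l < n \<Longrightarrow> A j l = spec_mat n V b j l"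
    "\<And>f. mat_fun n f A = spec_mat n V (\<lambda>i. f (b i))" "\<And>g. trace_fun n g A = (\<Sum>i<n. g (b i))"
    by (rule mat_fun_eq[OF assms(1)], rule that)
  obtain U a where B: "orthonormal n U" "\<And>j l. j < n \<Longrightarrow> l < n \<Longrightarrow> B j l = spec_mat n U a j l"
    "\<And>g. trace_fun n g B = (\<Sum>i<n. g (a i))"
    by (rule mat_fun_eq[OF assms(2)], rule that)
  have e1: "(\<Sum>j<n. \<Sum>l<n. (B j l - A j l)\<^sup>2) = (\<Sum>j<n. \<Sum>l<n. (spec_mat n U a j l - spec_mat n V b j l)\<^sup>2)"
    by (intro sum.cong refl) (simp add: A B)
  have e2: "(\<Sum>j<n. \<Sum>l<n. mat_fun n h A j l * (B j l - A j l)) =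
     (\<Sum>j<n. \<Sum>l<n. spec_mat n V (\<lambda>i. h (b i)) j l * (spec_mat n U a j l - spec_mat n V b j l))"
    by (intro sum.cong refl) (simp add: A(2,3) B(2))
  show ?thesis unfolding e1 e2 A(4) B(3)
    by (rule trace_taylor[OF B(1) A(1)]) (use assms(3) in \<open>simp add: c11_bound_def\<close>)
qed

text \<open>A crude bound for qualitative use only, namely continuity and boundedness of the
  statistic at fixed n; summing absolute values over all entries does no harm there.\<close>

lemma trace_fun_continuity_bound:
  assumes "symmetric_on n A" "symmetric_on n B" "c11_bound K g h"
  shows "\<bar>trace_fun n g B - trace_fun n g A\<bar>
    \<le> K * (\<Sum>j<n. \<Sum>l<n. \<bar>B j l - A j l\<bar>) + K / 2 * (\<Sum>j<n. \<Sum>l<n. (B j l - A j l)\<^sup>2)"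
proof -
  have "\<bar>\<Sum>j<n. \<Sum>l<n. mat_fun n h A j l * (B j l - A j l)\<bar> \<le> (\<Sum>j<n. \<Sum>l<n. \<bar>mat_fun n h A j l * (B j l - A j l)\<bar>)"
    by (rule order_trans[OF sum_abs], intro sum_mono sum_abs)
  also have "\<dots> \<le> (\<Sum>j<n. \<Sum>l<n. K * \<bar>B j l - A j l\<bar>)"
    unfolding abs_mult by (intro sum_mono mult_right_mono mat_fun_entry_bound[OF assms(1,3)]) auto
  also have "\<dots> = K * (\<Sum>j<n. \<Sum>l<n. \<bar>B j l - A j l\<bar>)" by (simp add: sum_distrib_left)
  finally show ?thesis using trace_fun_taylor[OF assms] by linarith
qed

section \<open>The Gram matrix with one entry of the data removed\<close>

definition gram :: "nat \<Rightarrow> nat \<Rightarrow> (nat \<Rightarrow> nat \<Rightarrow> real) \<Rightarrow> nat \<Rightarrow> nat \<Rightarrow> real" where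
  "gram m n y j l = (\<Sum>\<alpha><m. y \<alpha> j * y \<alpha> l) / real n"

lemma symmetric_gram: "symmetric_on n (gram m n y)"
  by (simp add: symmetric_on_def gram_def mult.commute)

lemma sum_square3_le: "(x + y + z)\<^sup>2 \<le> 3 * (x\<^sup>2 + y\<^sup>2 + z\<^sup>2)" for x y z :: real
proof -
  have "0 \<le> (x - y)\<^sup>2 + (y - z)\<^sup>2 + (x - z)\<^sup>2" by simp
  thus ?thesis by (simp add: power2_eq_square algebra_simps)
qed

text \<open>The deterministic part of the estimate. Inside, \<open>v\<close> is the removed entry,
  \<open>s\<close> the squared norm of what remains of its row, and \<open>q\<close>,
  \<open>q0\<close> are the first order coefficients before and after removal.\<close>

locale entry_removal =
  fixes m n :: nat and y y0 :: "nat \<Rightarrow> nat \<Rightarrow> real" and \<alpha> j :: nat and K :: real and g h :: "real \<Rightarrow> real"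
  assumes \<alpha>: "\<alpha> < m" and j: "j < n"
    and y0: "\<And>\<beta> k. (\<beta>, k) \<noteq> (\<alpha>, j) \<Longrightarrow> y0 \<beta> k = y \<beta> k" "y0 \<alpha> j = 0"
    and gh: "c11_bound K g h"
begin

definition "v = y \<alpha> j"
definition "s = (\<Sum>k<n. (y0 \<alpha> k)\<^sup>2)"
definition "q = (\<Sum>l<n. mat_fun n h (gram m n y) j l * y \<alpha> l)"
definition "q0 = (\<Sum>l<n. mat_fun n h (gram m n y0) j l * y0 \<alpha> l)"

lemma n_pos: "real n > 0" using j by simp

text \<open>Only row alpha of the data changes. With r the row that remains, the difference is (v /
  n) (e_j r^T + r e_j^T + v e_j e_j^T).\<close>

lemma gram_diff:
  "gram m n y k l - gram m n y0 k l = v / n * ((if k = j then y0 \<alpha> l else 0) + (if l = j then y0 \<alpha> k else 0)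
     + (if k = j \<and> l = j then v else 0))"
proof -
  have "(\<Sum>\<beta><m. y \<beta> k * y \<beta> l) - (\<Sum>\<beta><m. y0 \<beta> k * y0 \<beta> l)
     = (\<Sum>\<beta><m. if \<beta> = \<alpha> then y \<alpha> k * y \<alpha> l - y0 \<alpha> k * y0 \<alpha> l else 0)"
    unfolding sum_subtractf[symmetric] using y0 by (intro sum.cong refl) auto
  also have "\<dots> = y \<alpha> k * y \<alpha> l - y0 \<alpha> k * y0 \<alpha> l" using \<alpha> by simp
  also have "\<dots> = v * ((if k = j then y0 \<alpha> l else 0) + (if l = j then y0 \<alpha> k else 0)
     + (if k = j \<and> l = j then v else 0))"
    using y0(1)[of \<alpha> k] y0(1)[of \<alpha> l] y0(2) by (auto simp: v_def)
  finally show ?thesis unfolding gram_def by (simp add: diff_divide_distrib[symmetric])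
qed

lemma gram_diff_frobenius:
  "(\<Sum>k<n. \<Sum>l<n. (gram m n y k l - gram m n y0 k l)\<^sup>2) = (2 * v\<^sup>2 * s + v ^ 4) / (real n)\<^sup>2"
proof -
  \<comment> \<open>Since \<open>y0\<close> vanishes at (alpha, j), the three pieces live at
    disjoint positions and the square has no cross terms.\<close>
  have "(gram m n y k l - gram m n y0 k l)\<^sup>2 = (v / n)\<^sup>2 * ((if k = j then (y0 \<alpha> l)\<^sup>2 else 0) +
      (if l = j then (y0 \<alpha> k)\<^sup>2 else 0) + (if l = j then (if k = j then v\<^sup>2 else 0) else 0))" for k l
    unfolding gram_diff power_mult_distrib using y0(2) by auto
  hence "(\<Sum>k<n. \<Sum>l<n. (gram m n y k l - gram m n y0 k l)\<^sup>2) = (v / n)\<^sup>2 * 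
      ((\<Sum>k<n. \<Sum>l<n. if k = j then (y0 \<alpha> l)\<^sup>2 else 0) + (\<Sum>k<n. \<Sum>l<n. if l = j then (y0 \<alpha> k)\<^sup>2 else 0)
        + (\<Sum>k<n. \<Sum>l<n. if l = j then (if k = j then v\<^sup>2 else 0) else 0))"
    by (simp only: sum_distrib_left[symmetric] sum.distrib)
  also have "(\<Sum>k<n. \<Sum>l<n. if k = j then (y0 \<alpha> l)\<^sup>2 else 0) = s"
    using j by (subst sum.swap) (simp add: s_def)
  also have "(\<Sum>k<n. \<Sum>l<n. if l = j then (y0 \<alpha> k)\<^sup>2 else 0) = s" using j by (simp add: s_def)
  also have "(\<Sum>k<n. \<Sum>l<n. if l = j then (if k = j then v\<^sup>2 else 0) else 0) = v\<^sup>2" using j by simp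
  finally show ?thesis by (simp add: power_divide power2_eq_square power4_eq_xxxx field_simps)
qed

text \<open>The matrix function is symmetric, so the pieces e_j r^T and r e_j^T contribute
  \<open>q0\<close> each; this is the factor 2.\<close>

lemma linear_term:
  "(\<Sum>k<n. \<Sum>l<n. mat_fun n h (gram m n y0) k l * (gram m n y k l - gram m n y0 k l)) =
     2 * v / n * q0 + v\<^sup>2 / n * mat_fun n h (gram m n y0) j j"
proof -
  let ?H = "mat_fun n h (gram m n y0)"
  have "?H k l * (gram m n y k l - gram m n y0 k l) = v / n * ((if k = j then ?H j l * y0 \<alpha> l else 0) +
      (if l = j then ?H j k * y0 \<alpha> k else 0) + (if l = j then (if k = j then v * ?H j j else 0) else 0))" for k l
    unfolding gram_diff using mat_fun_sym[of n h "gram m n y0" j k] by (auto simp: algebra_simps)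
  hence "(\<Sum>k<n. \<Sum>l<n. ?H k l * (gram m n y k l - gram m n y0 k l)) = v / n *
      ((\<Sum>k<n. \<Sum>l<n. if k = j then ?H j l * y0 \<alpha> l else 0) + (\<Sum>k<n. \<Sum>l<n. if l = j then ?H j k * y0 \<alpha> k else 0)
        + (\<Sum>k<n. \<Sum>l<n. if l = j then (if k = j then v * ?H j j else 0) else 0))"
    by (simp only: sum_distrib_left[symmetric] sum.distrib)
  also have "(\<Sum>k<n. \<Sum>l<n. if k = j then ?H j l * y0 \<alpha> l else 0) = q0"
    using j by (subst sum.swap) (simp add: q0_def)
  also have "(\<Sum>k<n. \<Sum>l<n. if l = j then ?H j k * y0 \<alpha> k else 0) = q0" using j by (simp add: q0_def)
  also have "(\<Sum>k<n. \<Sum>l<n. if l = j then (if k = j then v * ?H j j else 0) else 0) = v * ?H j j" using j by simp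
  finally show ?thesis by (simp add: power2_eq_square ring_distribs add_divide_distrib mult_ac)
qed

lemma s_nonneg: "s \<ge> 0" by (simp add: s_def sum_nonneg)

text \<open>The difference is split into the term in \<open>q0\<close>, the diagonal term and the
  Taylor remainder, which costs a factor 3 on the squares. The remainder would contain v^8; the
  bound on v^2, applied later with w = tau^2, trades half of that power for w^2 n^2, so that fourth
  moments suffice.\<close>

lemma trace_diff_square_le:
  fixes w :: real
  assumes w: "v\<^sup>2 \<le> w * n"
  shows "(trace_fun n g (gram m n y) - trace_fun n g (gram m n y0))\<^sup>2 \<le>
    12 / (real n)\<^sup>2 * (v\<^sup>2 * q0\<^sup>2) + K\<^sup>2 / (real n)\<^sup>2 * (3 + 3 / 2 * w\<^sup>2) * v ^ 4
     + 6 * K\<^sup>2 / (real n) ^ 4 * (v ^ 4 * s\<^sup>2)"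
proof -
  let ?D = "trace_fun n g (gram m n y) - trace_fun n g (gram m n y0)"
  let ?H = "mat_fun n h (gram m n y0) j j"
  define X where "X = 2 * v / n * q0"
  define Y where "Y = v\<^sup>2 / n * ?H"
  define R where "R = ?D - (X + Y)"
  have R: "\<bar>R\<bar> \<le> K / 2 * ((2 * v\<^sup>2 * s + v ^ 4) / (real n)\<^sup>2)"
    unfolding R_def X_def Y_def linear_term[symmetric] gram_diff_frobenius[symmetric]
    by (rule trace_fun_taylor[OF symmetric_gram symmetric_gram gh])
  have "?D\<^sup>2 = (X + Y + R)\<^sup>2" by (simp add: R_def)
  also have "\<dots> \<le> 3 * (X\<^sup>2 + Y\<^sup>2 + R\<^sup>2)" by (rule sum_square3_le)
  finally have 0: "?D\<^sup>2 \<le> 3 * X\<^sup>2 + 3 * Y\<^sup>2 + 3 * R\<^sup>2" by simp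
  have X2: "X\<^sup>2 = 4 / (real n)\<^sup>2 * (v\<^sup>2 * q0\<^sup>2)"
    by (simp add: X_def power_mult_distrib power_divide)
  have "?H\<^sup>2 \<le> K\<^sup>2"
    using power_mono[OF mat_fun_entry_bound[OF symmetric_gram gh j j, of m y0] abs_ge_zero, of 2] by simp
  hence "v ^ 4 / (real n)\<^sup>2 * ?H\<^sup>2 \<le> v ^ 4 / (real n)\<^sup>2 * K\<^sup>2" by (intro mult_left_mono) auto
  moreover have "Y\<^sup>2 = v ^ 4 / (real n)\<^sup>2 * ?H\<^sup>2"
    by (simp add: Y_def power_mult_distrib power_divide flip: power_mult)
  ultimately have Y2: "Y\<^sup>2 \<le> K\<^sup>2 / (real n)\<^sup>2 * v ^ 4" by (simp add: mult.commute)
  have v4: "v ^ 4 = v\<^sup>2 * v\<^sup>2" by (simp add: power2_eq_square power4_eq_xxxx)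
  have "v\<^sup>2 * v\<^sup>2 \<le> (w * n) * (w * n)" using w order_trans[OF zero_le_power2 w] by (intro mult_mono) auto
  hence v4w: "v ^ 4 \<le> w\<^sup>2 * (real n)\<^sup>2" by (simp add: v4 power2_eq_square mult_ac)
  have "R\<^sup>2 \<le> (K / 2 * ((2 * v\<^sup>2 * s + v ^ 4) / (real n)\<^sup>2))\<^sup>2"
    using power_mono[OF R abs_ge_zero, of 2] by simp
  also have "\<dots> = K\<^sup>2 / 4 / (real n) ^ 4 * (2 * v\<^sup>2 * s + v ^ 4)\<^sup>2"
    by (simp add: power_mult_distrib power_divide flip: power_mult)
  also have "\<dots> \<le> K\<^sup>2 / 4 / (real n) ^ 4 * (8 * (v ^ 4 * s\<^sup>2) + 2 * (v ^ 4 * (w\<^sup>2 * (real n)\<^sup>2)))"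
  proof (rule mult_left_mono)
    have "(2 * v\<^sup>2 * s + v ^ 4)\<^sup>2 \<le> 2 * (2 * v\<^sup>2 * s)\<^sup>2 + 2 * (v ^ 4)\<^sup>2"
      using zero_le_power2[of "2 * v\<^sup>2 * s - v ^ 4"] by (simp add: power2_sum power2_diff)
    also have "(2 * v\<^sup>2 * s)\<^sup>2 = 4 * (v ^ 4 * s\<^sup>2)" by (simp add: power_mult_distrib flip: power_mult)
    also have "(v ^ 4)\<^sup>2 \<le> v ^ 4 * (w\<^sup>2 * (real n)\<^sup>2)"
      unfolding power2_eq_square[of "v ^ 4"] by (rule mult_left_mono[OF v4w]) simp
    finally show "(2 * v\<^sup>2 * s + v ^ 4)\<^sup>2 \<le> 8 * (v ^ 4 * s\<^sup>2) + 2 * (v ^ 4 * (w\<^sup>2 * (real n)\<^sup>2))" by simp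
  qed simp
  also have "\<dots> = 2 * K\<^sup>2 / (real n) ^ 4 * (v ^ 4 * s\<^sup>2) + K\<^sup>2 / (real n)\<^sup>2 * (w\<^sup>2 / 2) * v ^ 4"
    using n_pos by (simp add: field_simps power2_eq_square power4_eq_xxxx)
  finally show ?thesis using 0 X2 Y2 by (simp add: algebra_simps)
qed

text \<open>The difference of \<open>q0\<close> and \<open>q\<close> consists of the contribution of
  the entry v itself and of \<open>Z\<close>, the change of the matrix function applied to the
  remaining row. Cauchy-Schwarz and the Lipschitz bound in Frobenius norm control
  \<open>Z\<close>.\<close>

lemma q0_square_le:
  fixes w :: real
  assumes w: "v\<^sup>2 \<le> w * n"
  shows "q0\<^sup>2 \<le> 3 * q\<^sup>2 + 3 * K\<^sup>2 * v\<^sup>2 + 3 * K\<^sup>2 * (2 / (real n)\<^sup>2 * (v\<^sup>2 * s\<^sup>2) + w / n * (v\<^sup>2 * s))"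
proof -
  let ?H = "mat_fun n h (gram m n y)" and ?G = "mat_fun n h (gram m n y0)"
  define Z where "Z = (\<Sum>l<n. (?G j l - ?H j l) * y0 \<alpha> l)"
  have q: "q = (\<Sum>l<n. ?H j l * y0 \<alpha> l) + v * ?H j j"
  proof -
    have "?H j l * y \<alpha> l = ?H j l * y0 \<alpha> l + (if l = j then v * ?H j j else 0)" for l
      using y0(1)[of \<alpha> l] y0(2) by (cases "l = j") (simp_all add: v_def)
    hence "q = (\<Sum>l<n. ?H j l * y0 \<alpha> l + (if l = j then v * ?H j j else 0))"
      by (simp only: q_def)
    thus ?thesis using j by (simp add: sum.distrib)
  qed
  have "q0 = q + Z + - (v * ?H j j)"
    unfolding q q0_def Z_def by (simp add: left_diff_distrib sum_subtractf)
  hence "q0\<^sup>2 \<le> 3 * (q\<^sup>2 + Z\<^sup>2 + (v * ?H j j)\<^sup>2)"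
    using sum_square3_le[of q Z "- (v * ?H j j)"] by simp
  moreover have "(v * ?H j j)\<^sup>2 \<le> K\<^sup>2 * v\<^sup>2"
    using power_mono[OF mat_fun_entry_bound[OF symmetric_gram gh j j, of m y] abs_ge_zero, of 2]
    by (simp add: power_mult_distrib mult.commute[of "K\<^sup>2"] mult_left_mono)
  moreover have "Z\<^sup>2 \<le> K\<^sup>2 * (2 / (real n)\<^sup>2 * (v\<^sup>2 * s\<^sup>2) + w / n * (v\<^sup>2 * s))"
  proof -
    have "Z\<^sup>2 \<le> (\<Sum>l<n. (?G j l - ?H j l)\<^sup>2) * s"
      unfolding Z_def s_def by (rule Cauchy_Schwarz_ineq_sum)
    also have "\<dots> \<le> (\<Sum>k<n. \<Sum>l<n. (?G k l - ?H k l)\<^sup>2) * s"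
      using j by (intro mult_right_mono s_nonneg member_le_sum[where f = "\<lambda>k. \<Sum>l<n. (?G k l - ?H k l)\<^sup>2"])
        (auto intro: sum_nonneg)
    also have "\<dots> \<le> (K\<^sup>2 * ((2 * v\<^sup>2 * s + v ^ 4) / (real n)\<^sup>2)) * s"
    proof (rule mult_right_mono[OF _ s_nonneg])
      have "(\<Sum>k<n. \<Sum>l<n. (?G k l - ?H k l)\<^sup>2) = (\<Sum>k<n. \<Sum>l<n. (?H k l - ?G k l)\<^sup>2)"
        by (simp add: power2_commute)
      thus "(\<Sum>k<n. \<Sum>l<n. (?G k l - ?H k l)\<^sup>2) \<le> K\<^sup>2 * ((2 * v\<^sup>2 * s + v ^ 4) / (real n)\<^sup>2)"
        using mat_fun_lipschitz[OF symmetric_gram[of n m y] symmetric_gram[of n m y0] gh] by (simp add: gram_diff_frobenius)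
    qed
    also have "\<dots> = K\<^sup>2 * (2 / (real n)\<^sup>2 * (v\<^sup>2 * s\<^sup>2) + v\<^sup>2 * (v\<^sup>2 * s) / (real n)\<^sup>2)"
      using n_pos by (simp add: field_simps power2_eq_square power4_eq_xxxx)
    \<comment> \<open>One factor v^2 is traded for w n, so no power of v above the second is
      left.\<close>
    also have "\<dots> \<le> K\<^sup>2 * (2 / (real n)\<^sup>2 * (v\<^sup>2 * s\<^sup>2) + (w * n) * (v\<^sup>2 * s) / (real n)\<^sup>2)"
      by (intro mult_left_mono add_left_mono divide_right_mono mult_right_mono w) (auto simp: s_nonneg)
    also have "(w * n) * (v\<^sup>2 * s) / (real n)\<^sup>2 = w / n * (v\<^sup>2 * s)"
      using n_pos by (simp add: field_simps power2_eq_square)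
    finally show ?thesis .
  qed
  moreover have "a \<le> 3 * b + 3 * e + 3 * f" if "a \<le> 3 * (b + c + d)" "d \<le> e" "c \<le> f" for a b c d e f :: real
    using that by simp
  ultimately have "q0\<^sup>2 \<le> 3 * q\<^sup>2 + 3 * (K\<^sup>2 * v\<^sup>2) + 3 * (K\<^sup>2 * (2 / (real n)\<^sup>2 * (v\<^sup>2 * s\<^sup>2) + w / n * (v\<^sup>2 * s)))"
    by blast
  thus ?thesis by (simp only: mult.assoc)
qed

end

section \<open>Linear statistics of truncated sample covariance matrices\<close>

lemma trunc_zero [simp]: "trunc \<tau> n 0 = 0" by (simp add: trunc_def)

lemma abs_trunc_le:
  assumes "\<tau> > 0" shows "\<bar>trunc \<tau> n x\<bar> \<le> \<tau> * sqrt n"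
  using assms by (auto simp: trunc_def abs_mult sgn_if)

lemma abs_trunc_le_self:
  assumes "\<tau> > 0" shows "\<bar>trunc \<tau> n x\<bar> \<le> \<bar>x\<bar>"
  using assms by (auto simp: trunc_def abs_mult sgn_if)

lemma trunc_eq_max_min:
  assumes "\<tau> > 0" shows "trunc \<tau> n x = max (- (\<tau> * sqrt n)) (min x (\<tau> * sqrt n))"
proof -
  have "0 \<le> \<tau> * sqrt n" using assms by simp
  thus ?thesis by (auto simp: trunc_def sgn_if min_def max_def abs_if)
qed

text \<open>The data matrix on its canonical product space. The coordinates are the original entries
  and truncation is applied by \<open>T\<close>; the moment assumptions are inequalities because
  truncation can only lower even moments.\<close>

locale truncated_gram =
  fixes M :: "nat \<times> nat \<Rightarrow> real measure" and m n :: nat and \<tau> a \<mu>4 K :: real and g h :: "real \<Rightarrow> real"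
  assumes prob: "\<And>p. prob_space (M p)" and sets_M: "\<And>p. sets (M p) = sets borel"
    and n: "n > 0" and \<tau>: "\<tau> > 0" and \<mu>4: "\<mu>4 \<ge> 0"
    and moment2: "\<And>\<alpha> j. \<alpha> < m \<Longrightarrow> j < n \<Longrightarrow> (\<integral>y. (trunc \<tau> n y)\<^sup>2 \<partial>M (\<alpha>, j)) \<le> a\<^sup>2"
    and moment4: "\<And>\<alpha> j. \<alpha> < m \<Longrightarrow> j < n \<Longrightarrow> (\<integral>y. (trunc \<tau> n y) ^ 4 \<partial>M (\<alpha>, j)) \<le> \<mu>4"
    and gh: "c11_bound K g h"
begin

definition I where "I = {..<m} \<times> {..<n}"
definition Q where "Q = PiM I M"
definition T where "T x \<alpha> k = trunc \<tau> n (x (\<alpha>, k))" for x :: "nat \<times> nat \<Rightarrow> real"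
definition F where "F x = trace_fun n g (gram m n (T x))"
definition q where "q \<alpha> j x = (\<Sum>l<n. mat_fun n h (gram m n (T x)) j l * T x \<alpha> l)"
definition S where "S \<alpha> x = (\<Sum>k<n. (T x \<alpha> k)\<^sup>2)"

sublocale Q: prob_space Q
  unfolding Q_def by (rule prob_space_PiM[OF prob])

lemma finite_I: "finite I" by (simp add: I_def)

lemma space_M: "space (M p) = UNIV"
  using sets_eq_imp_space_eq[OF sets_M[of p]] by simp

section \<open>Continuity, measurability and boundedness of the statistic\<close>

lemma continuous_T: "continuous_on UNIV (\<lambda>x. T x \<alpha> k)"
  unfolding T_def trunc_eq_max_min[OF \<tau>]
  by (intro continuous_intros continuous_on_product_coordinates)

lemma tendsto_gram: "((\<lambda>x. gram m n (T x) j l) \<longlongrightarrow> gram m n (T x0) j l) (at x0)"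
proof -
  have "continuous_on UNIV (\<lambda>x. gram m n (T x) j l)"
    unfolding gram_def using n by (intro continuous_intros continuous_T) auto
  thus ?thesis by (simp add: continuous_on_eq_continuous_at isCont_def)
qed

text \<open>Eigenvalues are never followed individually: the increment of the trace is bounded by
  the increments of the Gram entries, which are continuous in the data.\<close>

lemma continuous_F: "continuous_on UNIV F"
proof (simp add: continuous_on_eq_continuous_at isCont_def, rule allI, rule Lim_null[THEN iffD2])
  fix x0
  let ?d = "\<lambda>x j l. gram m n (T x) j l - gram m n (T x0) j l"
  let ?b = "\<lambda>x. K * (\<Sum>j<n. \<Sum>l<n. \<bar>?d x j l\<bar>) + K / 2 * (\<Sum>j<n. \<Sum>l<n. (?d x j l)\<^sup>2)"
  have "(?b \<longlongrightarrow> ?b x0) (at x0)" by (intro tendsto_intros tendsto_gram)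
  hence b: "(?b \<longlongrightarrow> 0) (at x0)" by simp
  have "norm (F x - F x0) \<le> ?b x" for x
    unfolding F_def real_norm_def
    by (rule trace_fun_continuity_bound[OF symmetric_gram symmetric_gram gh])
  from this b show "((\<lambda>x. F x - F x0) \<longlongrightarrow> 0) (at x0)"
    by (rule Lim_null_comparison[OF always_eventually, OF allI])
qed

lemma continuous_mat_fun:
  assumes jl: "j < n" "l < n"
  shows "continuous_on UNIV (\<lambda>x. mat_fun n h (gram m n (T x)) j l)"
proof (simp add: continuous_on_eq_continuous_at isCont_def, rule allI, rule Lim_null[THEN iffD2])
  fix x0
  let ?d = "\<lambda>x j l. gram m n (T x) j l - gram m n (T x0) j l"
  let ?e = "\<lambda>x j l. mat_fun n h (gram m n (T x)) j l - mat_fun n h (gram m n (T x0)) j l"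
  let ?b = "\<lambda>x. sqrt (K\<^sup>2 * (\<Sum>j<n. \<Sum>l<n. (?d x j l)\<^sup>2))"
  have "(?b \<longlongrightarrow> ?b x0) (at x0)" by (intro tendsto_intros tendsto_gram)
  hence b: "(?b \<longlongrightarrow> 0) (at x0)" by simp
  have "norm (?e x j l) \<le> ?b x" for x
  proof -
    have "(?e x j l)\<^sup>2 \<le> (\<Sum>l<n. (?e x j l)\<^sup>2)"
      using jl by (intro member_le_sum[where f = "\<lambda>l. (?e x j l)\<^sup>2"]) auto
    also have "\<dots> \<le> (\<Sum>j<n. \<Sum>l<n. (?e x j l)\<^sup>2)"
      using jl by (intro member_le_sum[where f = "\<lambda>j. \<Sum>l<n. (?e x j l)\<^sup>2"]) (auto intro: sum_nonneg)
    also have "\<dots> \<le> K\<^sup>2 * (\<Sum>j<n. \<Sum>l<n. (?d x j l)\<^sup>2)"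
      by (rule mat_fun_lipschitz[OF symmetric_gram symmetric_gram gh])
    finally have "sqrt ((?e x j l)\<^sup>2) \<le> ?b x" by (rule real_sqrt_le_mono)
    thus ?thesis by simp
  qed
  from this b show "((\<lambda>x. ?e x j l) \<longlongrightarrow> 0) (at x0)"
    by (rule Lim_null_comparison[OF always_eventually, OF allI])
qed

lemma continuous_q: "j < n \<Longrightarrow> continuous_on UNIV (q \<alpha> j)"
  unfolding q_def[abs_def] by (intro continuous_intros continuous_mat_fun continuous_T) auto

lemma continuous_S: "continuous_on UNIV (S \<alpha>)"
  unfolding S_def[abs_def] by (intro continuous_intros continuous_T)

text \<open>Links the product sigma-algebra over the finite index set with the Borel sets of the
  product topology on all functions, so that continuity yields measurability. Off \<open>I\<close>
  every point of the space has the value \<open>undefined\<close>, and these coordinates are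
  constant.\<close>

lemma measurable_Q_borel: "(\<lambda>x. x) \<in> measurable Q borel"
proof (rule measurable_coordinatewise_then_product)
  fix p
  show "(\<lambda>x. x p) \<in> borel_measurable Q"
  proof (cases "p \<in> I")
    case True
    have "(\<lambda>x. x p) \<in> measurable Q (M p)"
      unfolding Q_def by (rule measurable_component_singleton[OF True])
    thus ?thesis by (simp add: measurable_cong_sets[OF refl sets_M])
  next
    case False
    have "(\<lambda>x. x p) \<in> borel_measurable Q \<longleftrightarrow> (\<lambda>x. undefined :: real) \<in> borel_measurable Q"
      using False by (intro measurable_cong) (auto simp: Q_def space_PiM dest: PiE_arb)
    thus ?thesis by simp
  qed
qed

lemma borel_measurable_continuous_Q: "continuous_on UNIV (f :: _ \<Rightarrow> real) \<Longrightarrow> f \<in> borel_measurable Q"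
  using measurable_compose[OF measurable_Q_borel borel_measurable_continuous_onI] by auto

lemma measurable_upd:
  assumes "p \<in> I" "f \<in> borel_measurable Q" shows "(\<lambda>x. f (x(p := 0))) \<in> borel_measurable Q"
  unfolding Q_def
  by (rule measurable_compose[OF measurable_fun_upd_const[OF assms(1)] assms(2)[unfolded Q_def]]) (simp add: space_M)

lemma T_square_le: "(T x \<alpha> k)\<^sup>2 \<le> \<tau>\<^sup>2 * n"
proof -
  have "(T x \<alpha> k)\<^sup>2 \<le> (\<tau> * sqrt n)\<^sup>2"
    using power_mono[OF abs_trunc_le[OF \<tau>, of n "x (\<alpha>, k)"] abs_ge_zero, of 2] by (simp add: T_def)
  thus ?thesis by (simp add: power_mult_distrib)
qed

lemma S_nonneg: "0 \<le> S \<alpha> x" by (simp add: S_def sum_nonneg)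

lemma S_le: "S \<alpha> x \<le> n * (\<tau>\<^sup>2 * n)"
  unfolding S_def using sum_bounded_above[of "{..<n}" "\<lambda>k. (T x \<alpha> k)\<^sup>2" "\<tau>\<^sup>2 * n", OF T_square_le] by simp

lemma S_square_le: "(S \<alpha> x)\<^sup>2 \<le> n * (\<Sum>k<n. (T x \<alpha> k) ^ 4)"
proof -
  have "(\<Sum>k<n. 1 * (T x \<alpha> k)\<^sup>2)\<^sup>2 \<le> (\<Sum>k<n. 1\<^sup>2) * (\<Sum>k<n. ((T x \<alpha> k)\<^sup>2)\<^sup>2)"
    by (rule Cauchy_Schwarz_ineq_sum)
  thus ?thesis by (simp add: S_def flip: power_mult)
qed

text \<open>All coordinates come from one matrix applied to one row, so the whole row of first order
  coefficients costs no more than its squared norm.\<close>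

lemma sum_q_square_le: "(\<Sum>j<n. (q \<alpha> j x)\<^sup>2) \<le> K\<^sup>2 * S \<alpha> x"
  unfolding q_def S_def by (rule mat_fun_vec_bound[OF symmetric_gram gh])

lemma q_square_le:
  assumes "j < n" shows "(q \<alpha> j x)\<^sup>2 \<le> K\<^sup>2 * (n * (\<tau>\<^sup>2 * n))"
proof -
  have "(q \<alpha> j x)\<^sup>2 \<le> (\<Sum>j<n. (q \<alpha> j x)\<^sup>2)"
    using assms by (intro member_le_sum[where f = "\<lambda>j. (q \<alpha> j x)\<^sup>2"]) auto
  also have "\<dots> \<le> K\<^sup>2 * S \<alpha> x" by (rule sum_q_square_le)
  also have "\<dots> \<le> K\<^sup>2 * (n * (\<tau>\<^sup>2 * n))" by (intro mult_left_mono S_le) auto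
  finally show ?thesis .
qed

text \<open>Comparison with the zero matrix; truncation bounds the Gram entries uniformly. The bound
  may grow with n, since it only serves integrability.\<close>

lemma F_bounded: "\<exists>B. \<forall>x. \<bar>F x\<bar> \<le> B"
proof -
  define b where "b = (\<Sum>\<alpha><m. \<tau>\<^sup>2 * n) / real n"
  have gb: "\<bar>gram m n (T x) j l\<bar> \<le> b" for x j l
  proof -
    have "\<bar>T x \<alpha> j * T x \<alpha> l\<bar> \<le> \<tau>\<^sup>2 * n" for \<alpha>
    proof -
      have "\<bar>T x \<alpha> j\<bar> * \<bar>T x \<alpha> l\<bar> \<le> (\<tau> * sqrt n) * (\<tau> * sqrt n)"
        unfolding T_def using \<tau> by (intro mult_mono abs_trunc_le) auto
      thus ?thesis by (simp add: abs_mult power2_eq_square mult_ac)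
    qed
    hence "\<bar>\<Sum>\<alpha><m. T x \<alpha> j * T x \<alpha> l\<bar> \<le> (\<Sum>\<alpha><m. \<tau>\<^sup>2 * n)"
      by (intro order_trans[OF sum_abs] sum_mono)
    thus ?thesis unfolding gram_def b_def by (simp only: abs_divide abs_of_nat divide_right_mono of_nat_0_le_iff)
  qed
  have "\<bar>h 0\<bar> \<le> K" using gh by (simp add: c11_bound_def)
  hence K: "K \<ge> 0" by linarith
  let ?z = "\<lambda>(_::nat) (_::nat). 0 :: real"
  have "\<bar>F x\<bar> \<le> \<bar>trace_fun n g ?z\<bar> + (K * (\<Sum>j<n. \<Sum>l<n. b) + K / 2 * (\<Sum>j<n. \<Sum>l<n. b\<^sup>2))" for x
  proof -
    have "\<bar>F x - trace_fun n g ?z\<bar> \<le> K * (\<Sum>j<n. \<Sum>l<n. \<bar>gram m n (T x) j l - 0\<bar>) + K / 2 * (\<Sum>j<n. \<Sum>l<n. (gram m n (T x) j l - 0)\<^sup>2)"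
      unfolding F_def by (rule trace_fun_continuity_bound[OF _ symmetric_gram gh]) (simp add: symmetric_on_def)
    also have "\<dots> \<le> K * (\<Sum>j<n. \<Sum>l<n. b) + K / 2 * (\<Sum>j<n. \<Sum>l<n. b\<^sup>2)"
    proof (intro add_mono mult_left_mono sum_mono)
      show "(gram m n (T x) j l - 0)\<^sup>2 \<le> b\<^sup>2" for j l
        using power_mono[OF gb[of x j l] abs_ge_zero, of 2] by simp
    qed (use gb K in auto)
    finally show ?thesis by linarith
  qed
  thus ?thesis by blast
qed

section \<open>Expectations under the product measure\<close>

lemma integrable_continuous_bounded:
  fixes f :: "(nat \<times> nat \<Rightarrow> real) \<Rightarrow> real"
  assumes "continuous_on UNIV f" "\<And>x. \<bar>f x\<bar> \<le> B"
  shows "integrable Q f"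
  by (rule Q.integrable_bounded[OF borel_measurable_continuous_Q[OF assms(1)] assms(2)])

lemma integrable_continuous_upd:
  fixes f :: "(nat \<times> nat \<Rightarrow> real) \<Rightarrow> real"
  assumes "p \<in> I" "continuous_on UNIV f" "\<And>x. \<bar>f x\<bar> \<le> B"
  shows "integrable Q (\<lambda>x. f (x(p := 0)))"
  by (rule Q.integrable_bounded[OF measurable_upd[OF assms(1) borel_measurable_continuous_Q[OF assms(2)]] assms(3)])

text \<open>The form in which independence is used below: a power of one truncated entry against a
  function of the data with that entry removed.\<close>

lemma expectation_mult_upd:
  assumes p: "(\<alpha>, j) \<in> I" and f: "continuous_on UNIV f" "\<And>x. \<bar>f x\<bar> \<le> B"
  shows "integrable Q (\<lambda>x. (T x \<alpha> j) ^ k * f (x((\<alpha>, j) := 0)))" (is ?A)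
    and "(\<integral>x. (T x \<alpha> j) ^ k * f (x((\<alpha>, j) := 0)) \<partial>Q) =
      (\<integral>y. (trunc \<tau> n y) ^ k \<partial>M (\<alpha>, j)) * (\<integral>x. f (x((\<alpha>, j) := 0)) \<partial>Q)" (is ?B)
proof -
  have tb: "\<bar>(trunc \<tau> n y) ^ k\<bar> \<le> (\<tau> * sqrt n) ^ k" for y
    unfolding power_abs by (rule power_mono[OF abs_trunc_le[OF \<tau>] abs_ge_zero])
  have fm: "f \<in> borel_measurable Q" by (rule borel_measurable_continuous_Q[OF f(1)])
  show ?A
  proof (rule Q.integrable_bounded[where B = "(\<tau> * sqrt n) ^ k * B"])
    have "(\<lambda>x. (T x \<alpha> j) ^ k) \<in> borel_measurable Q"
      by (intro borel_measurable_continuous_Q continuous_intros continuous_T)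
    thus "(\<lambda>x. (T x \<alpha> j) ^ k * f (x((\<alpha>, j) := 0))) \<in> borel_measurable Q"
      by (rule borel_measurable_times[OF _ measurable_upd[OF p fm]])
    show "\<bar>(T x \<alpha> j) ^ k * f (x((\<alpha>, j) := 0))\<bar> \<le> (\<tau> * sqrt n) ^ k * B" for x
      unfolding abs_mult T_def by (intro mult_mono tb f(2)) (use \<tau> in auto)
  qed
  have tm: "(\<lambda>y. (trunc \<tau> n y) ^ k) \<in> borel_measurable (M (\<alpha>, j))"
  proof -
    have "(\<lambda>y. (trunc \<tau> n y) ^ k) \<in> borel_measurable borel"
      unfolding trunc_eq_max_min[OF \<tau>] by measurable
    thus ?thesis by (simp add: measurable_cong_sets[OF sets_M refl])
  qed
  show ?B
    unfolding T_def Q_def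
    by (rule integral_PiM_mult_upd[where u = "\<lambda>y. (trunc \<tau> n y) ^ k", OF prob _ finite_I p fm[unfolded Q_def] f(2) tm tb])
      (simp add: space_M)
qed

lemma expectation_T_power:
  assumes p: "(\<alpha>, j) \<in> I"
  shows "integrable Q (\<lambda>x. (T x \<alpha> j) ^ k)"
    and "(\<integral>x. (T x \<alpha> j) ^ k \<partial>Q) = (\<integral>y. (trunc \<tau> n y) ^ k \<partial>M (\<alpha>, j))"
  using expectation_mult_upd[OF p, of "\<lambda>_. 1" 1 k] by (simp_all add: Q.prob_space)

lemma expectation_T2: "(\<alpha>, j) \<in> I \<Longrightarrow> (\<integral>x. (T x \<alpha> j)\<^sup>2 \<partial>Q) \<le> a\<^sup>2"
  using moment2 by (simp add: expectation_T_power(2)) (simp add: I_def)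

lemma expectation_T4: "(\<alpha>, j) \<in> I \<Longrightarrow> (\<integral>x. (T x \<alpha> j) ^ 4 \<partial>Q) \<le> \<mu>4"
  using moment4 by (simp add: expectation_T_power(2)) (simp add: I_def)

lemma expectation_S:
  assumes "\<alpha> < m" shows "(\<integral>x. S \<alpha> x \<partial>Q) \<le> n * a\<^sup>2"
proof -
  have I: "(\<alpha>, k) \<in> I" if "k < n" for k using that assms by (simp add: I_def)
  have "(\<integral>x. S \<alpha> x \<partial>Q) = (\<Sum>k<n. \<integral>x. (T x \<alpha> k)\<^sup>2 \<partial>Q)"
    unfolding S_def by (rule Bochner_Integration.integral_sum) (use expectation_T_power(1)[OF I] in auto)
  also have "\<dots> \<le> (\<Sum>k<n. a\<^sup>2)" by (intro sum_mono expectation_T2 I) auto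
  finally show ?thesis by simp
qed

lemma S_bounds: "\<bar>S \<alpha> x\<bar> \<le> n * (\<tau>\<^sup>2 * n)" "\<bar>(S \<alpha> x)\<^sup>2\<bar> \<le> (n * (\<tau>\<^sup>2 * n))\<^sup>2"
  using S_nonneg[of \<alpha> x] S_le[of \<alpha> x] power_mono[OF S_le[of \<alpha> x] S_nonneg, of 2] by simp_all

lemma integrable_S: "integrable Q (S \<alpha>)" "integrable Q (\<lambda>x. (S \<alpha> x)\<^sup>2)"
  by (rule integrable_continuous_bounded[OF continuous_S S_bounds(1)],
      rule integrable_continuous_bounded[OF _ S_bounds(2)], intro continuous_intros continuous_S)

lemma expectation_S2:
  assumes "\<alpha> < m" shows "(\<integral>x. (S \<alpha> x)\<^sup>2 \<partial>Q) \<le> (real n)\<^sup>2 * \<mu>4"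
proof -
  have I: "(\<alpha>, k) \<in> I" if "k < n" for k using that assms by (simp add: I_def)
  have i: "integrable Q (\<lambda>x. \<Sum>k<n. (T x \<alpha> k) ^ 4)"
    by (rule Bochner_Integration.integrable_sum) (use expectation_T_power(1)[OF I] in auto)
  have "(\<integral>x. (S \<alpha> x)\<^sup>2 \<partial>Q) \<le> (\<integral>x. n * (\<Sum>k<n. (T x \<alpha> k) ^ 4) \<partial>Q)"
    by (rule integral_mono[OF integrable_S(2)]) (use i S_square_le in auto)
  also have "\<dots> = n * (\<integral>x. (\<Sum>k<n. (T x \<alpha> k) ^ 4) \<partial>Q)" by simp
  also have "(\<integral>x. (\<Sum>k<n. (T x \<alpha> k) ^ 4) \<partial>Q) = (\<Sum>k<n. \<integral>x. (T x \<alpha> k) ^ 4 \<partial>Q)"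
    by (rule Bochner_Integration.integral_sum) (use expectation_T_power(1)[OF I] in auto)
  also have "real n * \<dots> \<le> n * (\<Sum>k<n. \<mu>4)" by (intro mult_left_mono sum_mono expectation_T4 I) auto
  finally show ?thesis by (simp add: power2_eq_square)
qed

lemma S_upd_le: "S \<alpha> (x(p := 0)) \<le> S \<alpha> x"
  unfolding S_def by (intro sum_mono) (auto simp: T_def)

lemma expectation_S_upd:
  assumes p: "(\<alpha>, j) \<in> I"
  shows "(\<integral>x. S \<alpha> (x((\<alpha>, j) := 0)) \<partial>Q) \<le> n * a\<^sup>2"
    and "(\<integral>x. (S \<alpha> (x((\<alpha>, j) := 0)))\<^sup>2 \<partial>Q) \<le> (real n)\<^sup>2 * \<mu>4"
proof -
  have \<alpha>: "\<alpha> < m" using p by (simp add: I_def)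
  have "(\<integral>x. S \<alpha> (x((\<alpha>, j) := 0)) \<partial>Q) \<le> (\<integral>x. S \<alpha> x \<partial>Q)"
    by (rule integral_mono[OF integrable_continuous_upd[OF p continuous_S S_bounds(1)] integrable_S(1) S_upd_le])
  thus "(\<integral>x. S \<alpha> (x((\<alpha>, j) := 0)) \<partial>Q) \<le> n * a\<^sup>2" using expectation_S[OF \<alpha>] by linarith
  have "continuous_on UNIV (\<lambda>x. (S \<alpha> x)\<^sup>2)" by (intro continuous_intros continuous_S)
  from integrable_continuous_upd[OF p this S_bounds(2)]
  have "(\<integral>x. (S \<alpha> (x((\<alpha>, j) := 0)))\<^sup>2 \<partial>Q) \<le> (\<integral>x. (S \<alpha> x)\<^sup>2 \<partial>Q)"
    by (rule integral_mono[OF _ integrable_S(2)]) (intro power_mono S_upd_le S_nonneg)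
  thus "(\<integral>x. (S \<alpha> (x((\<alpha>, j) := 0)))\<^sup>2 \<partial>Q) \<le> (real n)\<^sup>2 * \<mu>4" using expectation_S2[OF \<alpha>] by linarith
qed

section \<open>Mean square effect of one entry, and the variance\<close>

lemma entry_removal_upd:
  assumes "(\<alpha>, j) \<in> I"
  shows "entry_removal m n (T x) (T (x((\<alpha>, j) := 0))) \<alpha> j K g h"
  by standard (use assms gh in \<open>auto simp: I_def T_def\<close>)

lemma F_diff_square_le:
  assumes p: "(\<alpha>, j) \<in> I"
  shows "(F x - F (x((\<alpha>, j) := 0)))\<^sup>2 \<le> 12 / (real n)\<^sup>2 * ((T x \<alpha> j)\<^sup>2 * (q \<alpha> j (x((\<alpha>, j) := 0)))\<^sup>2)
    + K\<^sup>2 / (real n)\<^sup>2 * (3 + 3 / 2 * (\<tau>\<^sup>2)\<^sup>2) * (T x \<alpha> j) ^ 4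
    + 6 * K\<^sup>2 / (real n) ^ 4 * ((T x \<alpha> j) ^ 4 * (S \<alpha> (x((\<alpha>, j) := 0)))\<^sup>2)"
  using entry_removal.trace_diff_square_le[OF entry_removal_upd[OF p], of x "\<tau>\<^sup>2"] T_square_le[of x \<alpha> j]
  unfolding entry_removal.v_def[OF entry_removal_upd[OF p]] entry_removal.s_def[OF entry_removal_upd[OF p]]
    entry_removal.q0_def[OF entry_removal_upd[OF p]]
  by (simp add: F_def q_def S_def)

lemma q_upd_square_le:
  assumes p: "(\<alpha>, j) \<in> I"
  shows "(q \<alpha> j (x((\<alpha>, j) := 0)))\<^sup>2 \<le> 3 * (q \<alpha> j x)\<^sup>2 + 3 * K\<^sup>2 * (T x \<alpha> j)\<^sup>2
    + 3 * K\<^sup>2 * (2 / (real n)\<^sup>2 * ((T x \<alpha> j)\<^sup>2 * (S \<alpha> (x((\<alpha>, j) := 0)))\<^sup>2)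
      + \<tau>\<^sup>2 / n * ((T x \<alpha> j)\<^sup>2 * S \<alpha> (x((\<alpha>, j) := 0))))"
  using entry_removal.q0_square_le[OF entry_removal_upd[OF p], of x "\<tau>\<^sup>2"] T_square_le[of x \<alpha> j]
  unfolding entry_removal.v_def[OF entry_removal_upd[OF p]] entry_removal.s_def[OF entry_removal_upd[OF p]]
    entry_removal.q0_def[OF entry_removal_upd[OF p]] entry_removal.q_def[OF entry_removal_upd[OF p]]
  by (simp add: F_def q_def S_def)

lemma continuous_q2: "j < n \<Longrightarrow> continuous_on UNIV (\<lambda>x. (q \<alpha> j x)\<^sup>2)"
  by (intro continuous_intros continuous_q)

lemma q2_bound: "j < n \<Longrightarrow> \<bar>(q \<alpha> j x)\<^sup>2\<bar> \<le> K\<^sup>2 * (n * (\<tau>\<^sup>2 * n))"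
  using q_square_le by simp

lemma continuous_S2: "continuous_on UNIV (\<lambda>x. (S \<alpha> x)\<^sup>2)"
  by (intro continuous_intros continuous_S)

lemma expectation_nonneg: "(\<And>x. f x \<ge> 0) \<Longrightarrow> (\<integral>x. f x \<partial>Q) \<ge> (0::real)"
  by (rule integral_nonneg_AE) simp

lemma expectation_q_upd_square_le:
  assumes p: "(\<alpha>, j) \<in> I"
  shows "(\<integral>x. (q \<alpha> j (x((\<alpha>, j) := 0)))\<^sup>2 \<partial>Q) \<le>
    3 * (\<integral>x. (q \<alpha> j x)\<^sup>2 \<partial>Q) + 3 * K\<^sup>2 * (a\<^sup>2 + 2 * a\<^sup>2 * \<mu>4 + \<tau>\<^sup>2 * a\<^sup>2 * a\<^sup>2)"
proof -
  have j: "\<alpha> < m" "j < n" using p by (auto simp: I_def)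
  let ?S = "\<lambda>x. S \<alpha> (x((\<alpha>, j) := 0))"
  let ?E = "\<lambda>f. integral\<^sup>L Q f"
  note i = integrable_continuous_bounded[OF continuous_q2[OF j(2)] q2_bound[OF j(2)]]
    expectation_T_power(1)[OF p, of 2]
    expectation_mult_upd(1)[OF p continuous_S2 S_bounds(2), of 2]
    expectation_mult_upd(1)[OF p continuous_S S_bounds(1), of 2]
  have "?E (\<lambda>x. (q \<alpha> j (x((\<alpha>, j) := 0)))\<^sup>2) \<le> ?E (\<lambda>x. 3 * (q \<alpha> j x)\<^sup>2 + 3 * K\<^sup>2 * (T x \<alpha> j)\<^sup>2
    + 3 * K\<^sup>2 * (2 / (real n)\<^sup>2 * ((T x \<alpha> j)\<^sup>2 * (?S x)\<^sup>2) + \<tau>\<^sup>2 / n * ((T x \<alpha> j)\<^sup>2 * ?S x)))"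
    by (rule integral_mono[OF integrable_continuous_upd[OF p continuous_q2[OF j(2)] q2_bound[OF j(2)]] _ q_upd_square_le[OF p]])
      (intro Bochner_Integration.integrable_add integrable_mult_right i)
  also have "\<dots> = 3 * ?E (\<lambda>x. (q \<alpha> j x)\<^sup>2) + 3 * K\<^sup>2 * ?E (\<lambda>x. (T x \<alpha> j)\<^sup>2)
    + 3 * K\<^sup>2 * (2 / (real n)\<^sup>2 * ?E (\<lambda>x. (T x \<alpha> j)\<^sup>2 * (?S x)\<^sup>2) + \<tau>\<^sup>2 / n * ?E (\<lambda>x. (T x \<alpha> j)\<^sup>2 * ?S x))"
    using i by simp
  \<comment> \<open>The mixed expectations factor by independence. The bounds n^2 mu4 and n a^2 for
    the row norms cancel the powers of n, so the correction from \<open>q0\<close> to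
    \<open>q\<close> is of order one per entry.\<close>
  also have "\<dots> \<le> 3 * ?E (\<lambda>x. (q \<alpha> j x)\<^sup>2) + 3 * K\<^sup>2 * a\<^sup>2
    + 3 * K\<^sup>2 * (2 / (real n)\<^sup>2 * (a\<^sup>2 * ((real n)\<^sup>2 * \<mu>4)) + \<tau>\<^sup>2 / n * (a\<^sup>2 * (n * a\<^sup>2)))"
  proof (intro add_mono mult_left_mono order_refl)
    show "?E (\<lambda>x. (T x \<alpha> j)\<^sup>2) \<le> a\<^sup>2" by (rule expectation_T2[OF p])
    show "?E (\<lambda>x. (T x \<alpha> j)\<^sup>2 * (?S x)\<^sup>2) \<le> a\<^sup>2 * ((real n)\<^sup>2 * \<mu>4)"
      unfolding expectation_mult_upd(2)[OF p continuous_S2 S_bounds(2)]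
      by (intro mult_mono moment2 j expectation_S_upd(2)[OF p] expectation_nonneg) auto
    show "?E (\<lambda>x. (T x \<alpha> j)\<^sup>2 * ?S x) \<le> a\<^sup>2 * (n * a\<^sup>2)"
      unfolding expectation_mult_upd(2)[OF p continuous_S S_bounds(1)]
      by (intro mult_mono moment2 j expectation_S_upd(1)[OF p] expectation_nonneg S_nonneg) auto
  qed auto
  also have "\<dots> = 3 * ?E (\<lambda>x. (q \<alpha> j x)\<^sup>2) + 3 * K\<^sup>2 * (a\<^sup>2 + 2 * a\<^sup>2 * \<mu>4 + \<tau>\<^sup>2 * a\<^sup>2 * a\<^sup>2)"
    using n by (simp add: field_simps)
  finally show ?thesis .
qed

text \<open>Independence turns the leading term into a^2 times the second moment of q after removal,
  and the previous lemma returns to q on the full data; 36 is 12 from the first order term times 3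
  from that comparison. All else is of order n^-2 per entry.\<close>

lemma expectation_F_diff_square_le:
  assumes p: "(\<alpha>, j) \<in> I"
  shows "(\<integral>x. (F x - F (x((\<alpha>, j) := 0)))\<^sup>2 \<partial>Q) \<le>
    36 * a\<^sup>2 / (real n)\<^sup>2 * (\<integral>x. (q \<alpha> j x)\<^sup>2 \<partial>Q) + K\<^sup>2 / (real n)\<^sup>2 *
     (36 * a\<^sup>2 * (a\<^sup>2 + 2 * a\<^sup>2 * \<mu>4 + \<tau>\<^sup>2 * a\<^sup>2 * a\<^sup>2) + (3 + 3 / 2 * (\<tau>\<^sup>2)\<^sup>2) * \<mu>4 + 6 * \<mu>4\<^sup>2)"
proof -
  have j: "\<alpha> < m" "j < n" using p by (auto simp: I_def)
  let ?S = "\<lambda>x. S \<alpha> (x((\<alpha>, j) := 0))"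
  let ?q = "\<lambda>x. q \<alpha> j (x((\<alpha>, j) := 0))"
  let ?E = "\<lambda>f. integral\<^sup>L Q f"
  note i = expectation_T_power(1)[OF p, of 4]
    expectation_mult_upd(1)[OF p continuous_q2[OF j(2)] q2_bound[OF j(2)], of 2]
    expectation_mult_upd(1)[OF p continuous_S2 S_bounds(2), of 4]
  obtain B where B: "\<And>x. \<bar>F x\<bar> \<le> B" using F_bounded by auto
  have "integrable Q (\<lambda>x. (F x - F (x((\<alpha>, j) := 0)))\<^sup>2)"
  proof (rule Q.integrable_bounded)
    show "(\<lambda>x. (F x - F (x((\<alpha>, j) := 0)))\<^sup>2) \<in> borel_measurable Q"
      by (intro borel_measurable_power borel_measurable_diff measurable_upd[OF p] borel_measurable_continuous_Q continuous_F)
    have "\<bar>F x - F (x((\<alpha>, j) := 0))\<bar> \<le> 2 * B" for x using B[of x] B[of "x((\<alpha>, j) := 0)"] by linarith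
    thus "\<bar>(F x - F (x((\<alpha>, j) := 0)))\<^sup>2\<bar> \<le> (2 * B)\<^sup>2" for x
      using power_mono[OF _ abs_ge_zero, of "F x - F (x((\<alpha>, j) := 0))" "2 * B" 2] by simp
  qed
  hence "?E (\<lambda>x. (F x - F (x((\<alpha>, j) := 0)))\<^sup>2) \<le> ?E (\<lambda>x. 12 / (real n)\<^sup>2 * ((T x \<alpha> j)\<^sup>2 * (?q x)\<^sup>2)
    + K\<^sup>2 / (real n)\<^sup>2 * (3 + 3 / 2 * (\<tau>\<^sup>2)\<^sup>2) * (T x \<alpha> j) ^ 4
    + 6 * K\<^sup>2 / (real n) ^ 4 * ((T x \<alpha> j) ^ 4 * (?S x)\<^sup>2))"
    by (rule integral_mono[OF _ _ F_diff_square_le[OF p]])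
      (intro Bochner_Integration.integrable_add integrable_mult_right i)
  also have "\<dots> = 12 / (real n)\<^sup>2 * ?E (\<lambda>x. (T x \<alpha> j)\<^sup>2 * (?q x)\<^sup>2)
    + K\<^sup>2 / (real n)\<^sup>2 * (3 + 3 / 2 * (\<tau>\<^sup>2)\<^sup>2) * ?E (\<lambda>x. (T x \<alpha> j) ^ 4)
    + 6 * K\<^sup>2 / (real n) ^ 4 * ?E (\<lambda>x. (T x \<alpha> j) ^ 4 * (?S x)\<^sup>2)"
    using i by simp
  also have "\<dots> \<le> 12 / (real n)\<^sup>2 * (a\<^sup>2 * (3 * ?E (\<lambda>x. (q \<alpha> j x)\<^sup>2) + 3 * K\<^sup>2 * (a\<^sup>2 + 2 * a\<^sup>2 * \<mu>4 + \<tau>\<^sup>2 * a\<^sup>2 * a\<^sup>2)))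
    + K\<^sup>2 / (real n)\<^sup>2 * (3 + 3 / 2 * (\<tau>\<^sup>2)\<^sup>2) * \<mu>4
    + 6 * K\<^sup>2 / (real n) ^ 4 * (\<mu>4 * ((real n)\<^sup>2 * \<mu>4))"
  proof (intro add_mono mult_left_mono)
    show "?E (\<lambda>x. (T x \<alpha> j)\<^sup>2 * (?q x)\<^sup>2) \<le> a\<^sup>2 * (3 * ?E (\<lambda>x. (q \<alpha> j x)\<^sup>2) + 3 * K\<^sup>2 * (a\<^sup>2 + 2 * a\<^sup>2 * \<mu>4 + \<tau>\<^sup>2 * a\<^sup>2 * a\<^sup>2))"
      unfolding expectation_mult_upd(2)[OF p continuous_q2[OF j(2)] q2_bound[OF j(2)]]
      by (intro mult_mono moment2 j expectation_q_upd_square_le[OF p] expectation_nonneg) auto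
    show "?E (\<lambda>x. (T x \<alpha> j) ^ 4) \<le> \<mu>4" by (rule expectation_T4[OF p])
    show "?E (\<lambda>x. (T x \<alpha> j) ^ 4 * (?S x)\<^sup>2) \<le> \<mu>4 * ((real n)\<^sup>2 * \<mu>4)"
      unfolding expectation_mult_upd(2)[OF p continuous_S2 S_bounds(2)]
      by (intro mult_mono moment4 j expectation_S_upd(2)[OF p] expectation_nonneg \<mu>4) auto
  qed auto
  also have "\<dots> = 36 * a\<^sup>2 / (real n)\<^sup>2 * ?E (\<lambda>x. (q \<alpha> j x)\<^sup>2) + K\<^sup>2 / (real n)\<^sup>2 *
     (36 * a\<^sup>2 * (a\<^sup>2 + 2 * a\<^sup>2 * \<mu>4 + \<tau>\<^sup>2 * a\<^sup>2 * a\<^sup>2) + (3 + 3 / 2 * (\<tau>\<^sup>2)\<^sup>2) * \<mu>4 + 6 * \<mu>4\<^sup>2)"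
  proof -
    have e: "6 * K\<^sup>2 / (real n) ^ 4 * (\<mu>4 * ((real n)\<^sup>2 * \<mu>4)) = K\<^sup>2 / (real n)\<^sup>2 * (6 * \<mu>4\<^sup>2)"
      using n by (simp add: field_simps power2_eq_square power4_eq_xxxx)
    have "12 / N * (A * (3 * x + 3 * k * y)) + k / N * P * z + k / N * w = 36 * A / N * x + k / N * (36 * A * y + P * z + w)"
      for N A x k y P z w :: real
      by (simp add: algebra_simps add_divide_distrib)
    thus ?thesis unfolding e .
  qed
  finally show ?thesis .
qed

text \<open>The sum over j is taken inside the expectation, where the pointwise row bound
  applies.\<close>

lemma expectation_sum_q: "(\<Sum>p\<in>I. \<integral>x. (q (fst p) (snd p) x)\<^sup>2 \<partial>Q) \<le> m * (K\<^sup>2 * (n * a\<^sup>2))"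
proof -
  have "(\<Sum>p\<in>I. \<integral>x. (q (fst p) (snd p) x)\<^sup>2 \<partial>Q) = (\<Sum>\<alpha><m. \<Sum>j<n. \<integral>x. (q \<alpha> j x)\<^sup>2 \<partial>Q)"
    unfolding I_def by (simp add: sum.cartesian_product case_prod_unfold)
  also have "\<dots> \<le> (\<Sum>\<alpha><m. K\<^sup>2 * (n * a\<^sup>2))"
  proof (rule sum_mono)
    fix \<alpha> assume "\<alpha> \<in> {..<m}"
    hence \<alpha>: "\<alpha> < m" by simp
    have i: "integrable Q (\<lambda>x. (q \<alpha> j x)\<^sup>2)" if "j \<in> {..<n}" for j
      using that by (intro integrable_continuous_bounded[OF continuous_q2 q2_bound]) auto
    have "(\<Sum>j<n. \<integral>x. (q \<alpha> j x)\<^sup>2 \<partial>Q) = (\<integral>x. (\<Sum>j<n. (q \<alpha> j x)\<^sup>2) \<partial>Q)"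
      by (rule Bochner_Integration.integral_sum[symmetric, OF i])
    also have "\<dots> \<le> (\<integral>x. K\<^sup>2 * S \<alpha> x \<partial>Q)"
      by (intro integral_mono Bochner_Integration.integrable_sum i integrable_mult_right integrable_S sum_q_square_le)
    also have "\<dots> = K\<^sup>2 * (\<integral>x. S \<alpha> x \<partial>Q)" by simp
    also have "\<dots> \<le> K\<^sup>2 * (n * a\<^sup>2)" by (intro mult_left_mono expectation_S[OF \<alpha>]) auto
    finally show "(\<Sum>j<n. \<integral>x. (q \<alpha> j x)\<^sup>2 \<partial>Q) \<le> K\<^sup>2 * (n * a\<^sup>2)" .
  qed
  finally show ?thesis by simp
qed

lemma variance_F_le:
  "(\<integral>x. (F x - integral\<^sup>L Q F)\<^sup>2 \<partial>Q) \<le> K\<^sup>2 * (real m / real n) *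
     (36 * a\<^sup>2 * (2 * a\<^sup>2 + 2 * a\<^sup>2 * \<mu>4 + \<tau>\<^sup>2 * a\<^sup>2 * a\<^sup>2) + (3 + 3 / 2 * (\<tau>\<^sup>2)\<^sup>2) * \<mu>4 + 6 * \<mu>4\<^sup>2)"
proof -
  define c where "c = 36 * a\<^sup>2 * (a\<^sup>2 + 2 * a\<^sup>2 * \<mu>4 + \<tau>\<^sup>2 * a\<^sup>2 * a\<^sup>2) + (3 + 3 / 2 * (\<tau>\<^sup>2)\<^sup>2) * \<mu>4 + 6 * \<mu>4\<^sup>2"
  obtain B where B: "\<And>x. \<bar>F x\<bar> \<le> B" using F_bounded by auto
  have "(\<integral>x. (F x - integral\<^sup>L Q F)\<^sup>2 \<partial>Q) \<le> (\<Sum>p\<in>I. \<integral>x. (F x - F (x(p := 0)))\<^sup>2 \<partial>Q)"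
    unfolding Q_def
    by (rule efron_stein[OF prob _ finite_I borel_measurable_continuous_Q[OF continuous_F, unfolded Q_def] B]) (simp add: space_M)
  also have "\<dots> \<le> (\<Sum>p\<in>I. 36 * a\<^sup>2 / (real n)\<^sup>2 * (\<integral>x. (q (fst p) (snd p) x)\<^sup>2 \<partial>Q) + K\<^sup>2 / (real n)\<^sup>2 * c)"
  proof (rule sum_mono)
    fix p assume "p \<in> I"
    thus "(\<integral>x. (F x - F (x(p := 0)))\<^sup>2 \<partial>Q) \<le> 36 * a\<^sup>2 / (real n)\<^sup>2 * (\<integral>x. (q (fst p) (snd p) x)\<^sup>2 \<partial>Q) + K\<^sup>2 / (real n)\<^sup>2 * c"
      using expectation_F_diff_square_le[of "fst p" "snd p"] by (simp add: c_def)
  qed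
  also have "\<dots> = 36 * a\<^sup>2 / (real n)\<^sup>2 * (\<Sum>p\<in>I. \<integral>x. (q (fst p) (snd p) x)\<^sup>2 \<partial>Q) + (real m * real n) * (K\<^sup>2 / (real n)\<^sup>2 * c)"
    by (simp add: sum.distrib sum_distrib_left I_def)
  also have "\<dots> \<le> 36 * a\<^sup>2 / (real n)\<^sup>2 * (m * (K\<^sup>2 * (n * a\<^sup>2))) + (real m * real n) * (K\<^sup>2 / (real n)\<^sup>2 * c)"
    by (intro add_right_mono mult_left_mono expectation_sum_q) auto
  also have "\<dots> = K\<^sup>2 * (real m / real n) * (36 * a\<^sup>2 * a\<^sup>2 + c)"
    using n by (simp add: field_simps power2_eq_square[of "real n"])
  \<comment> \<open>The summed first order terms contribute 36 a^4, which merges with the a^2 inside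
    \<open>c\<close>; hence the 2 a^2 in the final constant.\<close>
  also have "36 * a\<^sup>2 * a\<^sup>2 + c = 36 * a\<^sup>2 * (2 * a\<^sup>2 + 2 * a\<^sup>2 * \<mu>4 + \<tau>\<^sup>2 * a\<^sup>2 * a\<^sup>2) + (3 + 3 / 2 * (\<tau>\<^sup>2)\<^sup>2) * \<mu>4 + 6 * \<mu>4\<^sup>2"
    by (simp add: c_def algebra_simps)
  finally show ?thesis .
qed

end

section \<open>Transfer to the given random variables and conclusion\<close>

definition var_const :: "real \<Rightarrow> real \<Rightarrow> real \<Rightarrow> real" where
  "var_const \<tau> \<mu>4 a = 36 * a\<^sup>2 * (2 * a\<^sup>2 + 2 * a\<^sup>2 * \<mu>4 + \<tau>\<^sup>2 * a\<^sup>2 * a\<^sup>2) + (3 + 3 / 2 * (\<tau>\<^sup>2)\<^sup>2) * \<mu>4 + 6 * \<mu>4\<^sup>2"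

lemma var_const_nonneg: "\<mu>4 \<ge> 0 \<Longrightarrow> var_const \<tau> \<mu>4 a \<ge> 0"
  by (simp add: var_const_def)

text \<open>The statistic depends on the probability space only through the joint law of the
  entries, which independence identifies with the product measure of
  \<open>truncated_gram\<close>.\<close>

lemma (in prob_space) linear_statistic_variance:
  fixes X :: "nat \<Rightarrow> nat \<Rightarrow> 'a \<Rightarrow> real"
  assumes n: "n > 0" and m: "m > 0" and \<tau>: "\<tau> > 0"
    and indep: "indep_vars (\<lambda>_. borel) (\<lambda>(\<alpha>, j). X \<alpha> j) ({..<m} \<times> {..<n})"
    and moments: "\<forall>\<alpha><m. \<forall>j<n. integrable M (X \<alpha> j) \<and> integrable M (\<lambda>\<omega>. (X \<alpha> j \<omega>) ^ 4) \<and>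
      (\<integral>\<omega>. (X \<alpha> j \<omega>)\<^sup>2 \<partial>M) = a\<^sup>2 \<and> (\<integral>\<omega>. (X \<alpha> j \<omega>) ^ 4 \<partial>M) = \<mu>4"
    and gh: "c11_bound K g h"
  defines "Z \<equiv> \<lambda>\<omega>. tr_fun g (Mtau \<tau> m n (\<lambda>\<alpha> j. X \<alpha> j \<omega>))"
  shows "Z \<in> borel_measurable M" "\<exists>B. \<forall>\<omega>. \<bar>Z \<omega>\<bar> \<le> B" "rvar M Z \<le> K\<^sup>2 * (real m / real n) * var_const \<tau> \<mu>4 a"
proof -
  have int: "\<And>\<alpha> j. \<alpha> < m \<Longrightarrow> j < n \<Longrightarrow> integrable M (X \<alpha> j)"
      "\<And>\<alpha> j. \<alpha> < m \<Longrightarrow> j < n \<Longrightarrow> integrable M (\<lambda>\<omega>. (X \<alpha> j \<omega>) ^ 4)"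
    and m2: "\<And>\<alpha> j. \<alpha> < m \<Longrightarrow> j < n \<Longrightarrow> (\<integral>\<omega>. (X \<alpha> j \<omega>)\<^sup>2 \<partial>M) = a\<^sup>2"
    and m4: "\<And>\<alpha> j. \<alpha> < m \<Longrightarrow> j < n \<Longrightarrow> (\<integral>\<omega>. (X \<alpha> j \<omega>) ^ 4 \<partial>M) = \<mu>4"
    using moments by auto
  let ?I = "{..<m} \<times> {..<n}"
  \<comment> \<open>Entries outside the index set are set to 0, so that every pair has a probability
    law, as the locale requires.\<close>
  define Y where "Y p = (if p \<in> ?I then X (fst p) (snd p) else (\<lambda>_. 0))" for p
  have Ym [measurable]: "Y p \<in> borel_measurable M" for p
    using borel_measurable_integrable[OF int(1)] by (auto simp: Y_def)
  define D where "D p = distr M borel (Y p)" for p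
  have D_int: "(\<integral>y. f y \<partial>D p) = (\<integral>\<omega>. f (Y p \<omega>) \<partial>M)" if "f \<in> borel_measurable borel" for f :: "real \<Rightarrow> real" and p
    unfolding D_def by (rule integral_distr[OF Ym that])
  have [measurable]: "trunc \<tau> n \<in> borel_measurable borel"
    unfolding trunc_eq_max_min[OF \<tau>, abs_def] by measurable
  have "0 \<le> (\<integral>\<omega>. (X 0 0 \<omega>) ^ 4 \<partial>M)" by simp
  hence \<mu>4: "\<mu>4 \<ge> 0" using m4[OF m n] by simp
  interpret truncated_gram D m n \<tau> a \<mu>4 K g h
  proof (rule truncated_gram.intro)
    show "prob_space (D p)" for p unfolding D_def by (rule prob_space_distr[OF Ym])
    show "sets (D p) = sets borel" for p by (simp add: D_def)
    fix \<alpha> j assume \<alpha>: "\<alpha> < m" and j: "j < n"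
    have Y: "Y (\<alpha>, j) = X \<alpha> j" using \<alpha> j by (simp add: Y_def)
    note [measurable] = Ym[of "(\<alpha>, j)", unfolded Y]
    \<comment> \<open>Square integrability follows from the fourth moment through x^2 <= 1 +
      x^4.\<close>
    have i2: "integrable M (\<lambda>\<omega>. (X \<alpha> j \<omega>)\<^sup>2)"
    proof (rule Bochner_Integration.integrable_bound[of _ "\<lambda>\<omega>. 1 + (X \<alpha> j \<omega>) ^ 4"])
      have "x\<^sup>2 \<le> 1 + x ^ 4" for x :: real
        using abs_square_le_one_plus_power4(2)[of x] by simp
      thus "AE \<omega> in M. norm ((X \<alpha> j \<omega>)\<^sup>2) \<le> norm (1 + (X \<alpha> j \<omega>) ^ 4)"
        by (intro AE_I2) (simp add: order_trans[OF _ abs_ge_self])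
    qed (use int(2)[OF \<alpha> j] in auto)
    have le: "\<bar>trunc \<tau> n x\<bar> ^ k \<le> \<bar>x\<bar> ^ k" for x k
      by (rule power_mono[OF abs_trunc_le_self[OF \<tau>] abs_ge_zero])
    have le2: "(trunc \<tau> n x)\<^sup>2 \<le> x\<^sup>2" for x using le[of x 2] by simp
    have le4: "(trunc \<tau> n x) ^ 4 \<le> x ^ 4" for x using le[of x 4] by simp
    have "(\<integral>\<omega>. (trunc \<tau> n (X \<alpha> j \<omega>))\<^sup>2 \<partial>M) \<le> (\<integral>\<omega>. (X \<alpha> j \<omega>)\<^sup>2 \<partial>M)"
      by (rule integral_mono[OF Bochner_Integration.integrable_bound[OF i2] i2]) (auto simp: le2)
    thus "(\<integral>y. (trunc \<tau> n y)\<^sup>2 \<partial>D (\<alpha>, j)) \<le> a\<^sup>2"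
      by (subst D_int) (use m2[OF \<alpha> j] in \<open>simp_all add: Y\<close>)
    have "(\<integral>\<omega>. (trunc \<tau> n (X \<alpha> j \<omega>)) ^ 4 \<partial>M) \<le> (\<integral>\<omega>. (X \<alpha> j \<omega>) ^ 4 \<partial>M)"
      by (rule integral_mono[OF Bochner_Integration.integrable_bound[OF int(2)[OF \<alpha> j]] int(2)[OF \<alpha> j]]) (auto simp: le4)
    thus "(\<integral>y. (trunc \<tau> n y) ^ 4 \<partial>D (\<alpha>, j)) \<le> \<mu>4"
      by (subst D_int) (use m4[OF \<alpha> j] in \<open>simp_all add: Y\<close>)
  qed (fact n \<tau> \<mu>4 gh)+
  define \<xi> where "\<xi> \<omega> = (\<lambda>p\<in>I. Y p \<omega>)" for \<omega>
  have II: "I = ?I" by (simp add: I_def)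
  have \<xi>m: "\<xi> \<in> measurable M (PiM I (\<lambda>_. borel))"
    unfolding \<xi>_def[abs_def] by (rule measurable_restrict) (rule Ym)
  have "indep_vars (\<lambda>_. borel) Y I"
    using indep unfolding II by (rule indep_vars_cong[THEN iffD1, rotated 3]) (auto simp: Y_def)
  \<comment> \<open>Independence as a product form of the joint law; positivity of m and n makes the
    index set nonempty.\<close>
  hence Qd: "Q = distr M (PiM I (\<lambda>_. borel)) \<xi>"
    unfolding Q_def D_def \<xi>_def[abs_def]
    using m n by (subst (asm) indep_vars_iff_distr_eq_PiM) (auto simp: II)
  have Fm: "F \<in> borel_measurable (PiM I (\<lambda>_. borel))"
    using borel_measurable_continuous_Q[OF continuous_F] unfolding Qd by simp
  have Z: "Z \<omega> = F (\<xi> \<omega>)" for \<omega>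
  proof -
    have "Mtau \<tau> m n (\<lambda>\<alpha> j. X \<alpha> j \<omega>) = mat n n (\<lambda>(j, l). gram m n (T (\<xi> \<omega>)) j l)"
      by (rule eq_matI) (auto simp: Mtau_def gram_def T_def \<xi>_def II Y_def)
    thus ?thesis by (simp add: Z_def F_def trace_fun_def)
  qed
  show "Z \<in> borel_measurable M"
    unfolding Z[abs_def] by (rule measurable_compose[OF \<xi>m Fm])
  show "\<exists>B. \<forall>\<omega>. \<bar>Z \<omega>\<bar> \<le> B" unfolding Z using F_bounded by blast
  have "integral\<^sup>L Q F = integral\<^sup>L M Z"
    unfolding Qd Z[abs_def] by (rule integral_distr[OF \<xi>m Fm])
  moreover have "(\<integral>x. (F x - c)\<^sup>2 \<partial>Q) = (\<integral>\<omega>. (Z \<omega> - c)\<^sup>2 \<partial>M)" for c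
    unfolding Qd Z by (rule integral_distr[OF \<xi>m]) (use Fm in auto)
  ultimately show "rvar M Z \<le> K\<^sup>2 * (real m / real n) * var_const \<tau> \<mu>4 a"
    using variance_F_le by (simp add: rvar_def var_const_def)
qed

lemma tr_fun_Re_Im:
  "Re (tr_fun f A) = tr_fun (\<lambda>x. Re (f x)) A" "Im (tr_fun f A) = tr_fun (\<lambda>x. Im (f x)) A"
proof -
  have "Re (sum_mset (image_mset f E)) = sum_mset (image_mset (\<lambda>x. Re (f x)) E)" for E by (induction E) auto
  thus "Re (tr_fun f A) = tr_fun (\<lambda>x. Re (f x)) A" by (simp add: tr_fun_def)
  have "Im (sum_mset (image_mset f E)) = sum_mset (image_mset (\<lambda>x. Im (f x)) E)" for E by (induction E) auto
  thus "Im (tr_fun f A) = tr_fun (\<lambda>x. Im (f x)) A" by (simp add: tr_fun_def)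
qed

lemma (in prob_space) cvar_eq_rvar_Re_Im:
  fixes Z :: "'a \<Rightarrow> complex"
  assumes R: "(\<lambda>\<omega>. Re (Z \<omega>)) \<in> borel_measurable M" "\<And>\<omega>. \<bar>Re (Z \<omega>)\<bar> \<le> B1"
    and I: "(\<lambda>\<omega>. Im (Z \<omega>)) \<in> borel_measurable M" "\<And>\<omega>. \<bar>Im (Z \<omega>)\<bar> \<le> B2"
  shows "cvar M Z = rvar M (\<lambda>\<omega>. Re (Z \<omega>)) + rvar M (\<lambda>\<omega>. Im (Z \<omega>))"
proof -
  have "integrable M (\<lambda>\<omega>. complex_of_real (Re (Z \<omega>)) + \<i> * complex_of_real (Im (Z \<omega>)))"
    using integrable_bounded[OF R] integrable_bounded[OF I]
    by (intro Bochner_Integration.integrable_add integrable_mult_right integrable_of_real)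
  hence Z: "integrable M Z" by (simp flip: complex_eq)
  have sq: "integrable M (\<lambda>\<omega>. (f \<omega> - c)\<^sup>2)" if "f \<in> borel_measurable M" "\<And>\<omega>. \<bar>f \<omega>\<bar> \<le> B" for f :: "'a \<Rightarrow> real" and B c
  proof (rule integrable_bounded[where B = "(B + \<bar>c\<bar>)\<^sup>2"])
    fix \<omega>
    have "\<bar>f \<omega> - c\<bar> \<le> B + \<bar>c\<bar>" using that(2)[of \<omega>] by linarith
    from power_mono[OF this abs_ge_zero, of 2] show "\<bar>(f \<omega> - c)\<^sup>2\<bar> \<le> (B + \<bar>c\<bar>)\<^sup>2" by simp
  qed (use that(1) in auto)
  have "cvar M Z = (\<integral>\<omega>. (Re (Z \<omega>) - (\<integral>\<omega>. Re (Z \<omega>) \<partial>M))\<^sup>2 + (Im (Z \<omega>) - (\<integral>\<omega>. Im (Z \<omega>) \<partial>M))\<^sup>2 \<partial>M)"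
    unfolding cvar_def using Z by (simp add: cmod_power2)
  also have "\<dots> = rvar M (\<lambda>\<omega>. Re (Z \<omega>)) + rvar M (\<lambda>\<omega>. Im (Z \<omega>))"
    unfolding rvar_def by (rule Bochner_Integration.integral_add[OF sq[OF R] sq[OF I]])
  finally show ?thesis .
qed

text \<open>Continuity and integrability of phi give the transform its meaning and make inversion
  hold at every point: the Bochner integral of a non-integrable function is 0 by default, which
  would make the right side vanish. The threshold N precedes t and phi, so it is uniform in
  both.\<close>

theorem theorem4p4:
  shows "\<exists>C :: real \<Rightarrow> real \<Rightarrow> real \<Rightarrow> real \<Rightarrow> real.
    \<forall>(P :: nat \<Rightarrow> 'a measure) X m a c \<mu>3 \<mu>4.
      scm_hyp P X m a c \<mu>3 \<mu>4 \<longrightarrow>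
      (\<forall>\<tau>>0. \<exists>N. \<forall>n\<ge>N.
         (\<forall>t::real. cvar (P n) (\<lambda>\<omega>. tr_fun (\<lambda>x. exp (\<i> * complex_of_real (t * x)))
                                         (Mtau \<tau> (m n) n (\<lambda>\<alpha> j. X n \<alpha> j \<omega>)))
                     \<le> C \<tau> \<mu>4 a c * (1 + \<bar>t\<bar> ^ 4)\<^sup>2) \<and>
         (\<forall>\<phi> :: real \<Rightarrow> real.
            continuous_on UNIV \<phi> \<longrightarrow> integrable lborel \<phi> \<longrightarrow>
            integrable lborel (\<lambda>t. (1 + \<bar>t\<bar> ^ 4) * cmod (fourier_hat \<phi> t)) \<longrightarrow>
            rvar (P n) (\<lambda>\<omega>. tr_fun \<phi> (Mtau \<tau> (m n) n (\<lambda>\<alpha> j. X n \<alpha> j \<omega>)))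
              \<le> C \<tau> \<mu>4 a c * (integral\<^sup>L lborel (\<lambda>t. (1 + \<bar>t\<bar> ^ 4) * cmod (fourier_hat \<phi> t)))\<^sup>2))"
\<comment> \<open>The factor c + 1 bounds m / n for large n, and the factor 2 accounts for the real
  and imaginary parts of the exponential.\<close>
proof (rule exI[where x = "\<lambda>\<tau> \<mu>4 a c. 2 * ((c + 1) * var_const \<tau> \<mu>4 a)"], intro allI impI)
  fix P :: "nat \<Rightarrow> 'a measure" and X m a c \<mu>3 \<mu>4 and \<tau> :: real
  assume hyp: "scm_hyp P X m a c \<mu>3 \<mu>4" and \<tau>: "\<tau> > 0"
  have lim: "(\<lambda>n. real (m n) / real n) \<longlonglongrightarrow> c" and c: "c \<ge> 1" using hyp by (auto simp: scm_hyp_def)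
  have "\<forall>\<^sub>F n in sequentially. 0 < real (m n) / real n \<and> real (m n) / real n < c + 1"
    using order_tendstoD(1)[OF lim, of 0] order_tendstoD(2)[OF lim, of "c + 1"] c
    by (intro eventually_conj) auto
  then obtain N where N: "\<And>n. n \<ge> N \<Longrightarrow> 0 < real (m n) / real n \<and> real (m n) / real n < c + 1"
    unfolding eventually_sequentially by blast
  let ?V = "(c + 1) * var_const \<tau> \<mu>4 a"
  show "\<exists>N. \<forall>n\<ge>N.
         (\<forall>t::real. cvar (P n) (\<lambda>\<omega>. tr_fun (\<lambda>x. exp (\<i> * complex_of_real (t * x)))
                                         (Mtau \<tau> (m n) n (\<lambda>\<alpha> j. X n \<alpha> j \<omega>)))
                     \<le> 2 * ?V * (1 + \<bar>t\<bar> ^ 4)\<^sup>2) \<and>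
         (\<forall>\<phi> :: real \<Rightarrow> real.
            continuous_on UNIV \<phi> \<longrightarrow> integrable lborel \<phi> \<longrightarrow>
            integrable lborel (\<lambda>t. (1 + \<bar>t\<bar> ^ 4) * cmod (fourier_hat \<phi> t)) \<longrightarrow>
            rvar (P n) (\<lambda>\<omega>. tr_fun \<phi> (Mtau \<tau> (m n) n (\<lambda>\<alpha> j. X n \<alpha> j \<omega>)))
              \<le> 2 * ?V * (integral\<^sup>L lborel (\<lambda>t. (1 + \<bar>t\<bar> ^ 4) * cmod (fourier_hat \<phi> t)))\<^sup>2)"
  proof (rule exI[of _ N], intro allI impI)
    fix n assume "n \<ge> N"
    note Nn = N[OF this]
    \<comment> \<open>Division by zero yields 0, so a positive ratio forces both n and m n to be
      positive.\<close>
    have n: "n > 0" and m: "m n > 0" using Nn by (auto simp: zero_less_divide_iff)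
    interpret prob_space "P n" using hyp by (simp add: scm_hyp_def)
    let ?Z = "\<lambda>g \<omega>. tr_fun g (Mtau \<tau> (m n) n (\<lambda>\<alpha> j. X n \<alpha> j \<omega>))"
    have hyps: "indep_vars (\<lambda>_. borel) (\<lambda>(\<alpha>, j). X n \<alpha> j) ({..<m n} \<times> {..<n})"
      "\<forall>\<alpha><m n. \<forall>j<n. integrable (P n) (X n \<alpha> j) \<and> integrable (P n) (\<lambda>\<omega>. (X n \<alpha> j \<omega>) ^ 4) \<and>
        (\<integral>\<omega>. (X n \<alpha> j \<omega>)\<^sup>2 \<partial>P n) = a\<^sup>2 \<and> (\<integral>\<omega>. (X n \<alpha> j \<omega>) ^ 4 \<partial>P n) = \<mu>4"
      using hyp unfolding scm_hyp_def by auto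
    have "0 \<le> (\<integral>\<omega>. (X n 0 0 \<omega>) ^ 4 \<partial>P n)" by simp
    hence V0: "var_const \<tau> \<mu>4 a \<ge> 0" using hyps(2) m n by (intro var_const_nonneg) simp
    note stat = linear_statistic_variance[OF n m \<tau> hyps]
    have bound: "rvar (P n) (?Z g) \<le> K\<^sup>2 * ?V" if "c11_bound K g h" for K g h
    proof -
      have "rvar (P n) (?Z g) \<le> K\<^sup>2 * (real (m n) / real n) * var_const \<tau> \<mu>4 a" by (rule stat(3)[OF that])
      also have "\<dots> \<le> K\<^sup>2 * (c + 1) * var_const \<tau> \<mu>4 a"
        using Nn V0 by (intro mult_right_mono mult_left_mono) auto
      finally show ?thesis by (simp add: mult.assoc)
    qed
    have V: "?V \<ge> 0" using V0 c by simp
    show "(\<forall>t::real. cvar (P n) (?Z (\<lambda>x. exp (\<i> * complex_of_real (t * x)))) \<le> 2 * ?V * (1 + \<bar>t\<bar> ^ 4)\<^sup>2) \<and>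
         (\<forall>\<phi> :: real \<Rightarrow> real.
            continuous_on UNIV \<phi> \<longrightarrow> integrable lborel \<phi> \<longrightarrow>
            integrable lborel (\<lambda>t. (1 + \<bar>t\<bar> ^ 4) * cmod (fourier_hat \<phi> t)) \<longrightarrow>
            rvar (P n) (?Z \<phi>)
              \<le> 2 * ?V * (integral\<^sup>L lborel (\<lambda>t. (1 + \<bar>t\<bar> ^ 4) * cmod (fourier_hat \<phi> t)))\<^sup>2)"
    proof (intro conjI allI impI)
      fix t :: real
      note trig = c11_bound_trig[OF abs_square_le_one_plus_power4]
      let ?e = "\<lambda>x. exp (\<i> * complex_of_real (t * x))"
      obtain B1 where B1: "\<And>\<omega>. \<bar>?Z (\<lambda>x. Re (?e x)) \<omega>\<bar> \<le> B1" using stat(2)[OF trig(1)] by blast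
      obtain B2 where B2: "\<And>\<omega>. \<bar>?Z (\<lambda>x. Im (?e x)) \<omega>\<bar> \<le> B2" using stat(2)[OF trig(2)] by blast
      have "cvar (P n) (?Z ?e) = rvar (P n) (?Z (\<lambda>x. Re (?e x))) + rvar (P n) (?Z (\<lambda>x. Im (?e x)))"
        using cvar_eq_rvar_Re_Im[of "?Z ?e", unfolded tr_fun_Re_Im, OF stat(1)[OF trig(1)] B1 stat(1)[OF trig(2)] B2] .
      also have "\<dots> \<le> 2 * ?V * (1 + \<bar>t\<bar> ^ 4)\<^sup>2"
        using bound[OF trig(1), of t] bound[OF trig(2), of t] by (simp add: mult.commute)
      finally show "cvar (P n) (?Z ?e) \<le> 2 * ?V * (1 + \<bar>t\<bar> ^ 4)\<^sup>2" .
    next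
      fix \<phi> :: "real \<Rightarrow> real"
      assume \<phi>: "continuous_on UNIV \<phi>" "integrable lborel \<phi>"
        "integrable lborel (\<lambda>t. (1 + \<bar>t\<bar> ^ 4) * cmod (fourier_hat \<phi> t))"
      let ?S = "integral\<^sup>L lborel (\<lambda>t. (1 + \<bar>t\<bar> ^ 4) * cmod (fourier_hat \<phi> t))"
      obtain h where "c11_bound ?S \<phi> h" by (rule c11_bound_fourier[OF \<phi>(2,1,3)])
      hence "rvar (P n) (?Z \<phi>) \<le> ?S\<^sup>2 * ?V" by (rule bound)
      \<comment> \<open>A real statistic does not need the factor 2; it is inserted to match the
        constant shared with the complex case.\<close>
      also have "\<dots> \<le> ?S\<^sup>2 * (2 * ?V)" using V by (intro mult_left_mono) auto
      finally show "rvar (P n) (?Z \<phi>) \<le> 2 * ?V * ?S\<^sup>2" by (simp only: mult.commute)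
    qed
  qed
qed

end
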